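(* Let $\omega$ be a Borel measure on $\mathbb R$ such that $$\int_{\mathbb R}\frac{d\omega(\lambda)}{1+\lambda^2}=1,\qquad\int_{\mathbb R}d\omega(\lambda)=\infty,$$ and let $H$ be the self-adjoint operator of multiplication by $\lambda$ in $L^2(\mathbb R;d\omega)$, $(Hf)(\lambda)=\lambda f(\lambda)$, $f\in\mathrm{dom}(H)=L^2(\mathbb R;(1+\lambda^2)d\omega)$. Define $\dot H$ to be the densely defined closed prime symmetric restriction of $H$, $$\dot H=H\big|_{\mathrm{dom}(\dot H)},\qquad\mathrm{dom}(\dot H)=\Bigl\{f\in\mathrm{dom}(H)\,\Big|\,\int_{\mathbb R}f(\lambda)d\omega(\lambda)=0\Bigr\},$$ with deficiency indices $(1,1)$. Then $\dot H$ admits a quasi-hermitian extension with pure point spectrum the open upper (respectively, lower) half-plane and spectrum the closed upper (respectively, lower) half-plane if and only if the following representation holds: $$\int_{\mathbb R}d\omega(\lambda)\bigl((\lambda-z)^{-1}-\lambda(1+\lambda^2)^{-1}\bigr)=\begin{cases}i,&\mathrm{Im}(z)>0,\\-i,&\mathrm{Im}(z)<0.\end{cases}$$ In this case $d\omega=\pi^{-1}d\lambda$, where $d\lambda$ denotes Lebesgue measure on $\mathbb R$.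
   Context: A closed operator $S$ is a quasi-hermitian extension of a densely defined closed prime symmetric operator $\dot H$ with deficiency indices $(1,1)$ if $\dot H\subsetneqq S\subsetneqq\dot H^*$ and $S$ is not self-adjoint. "Pure point spectrum" here means the set of eigenvalues. A densely defined closed symmetric operator $\dot H$ with equal deficiency indices is prime if $\overline{\mathrm{lin.span}\{(H-z)^{-1}u_+\,|\,u_+\in\ker(\dot H^*-i),\ z\in\mathbb C\setminus\mathbb R\}}$ is the whole Hilbert space for a (equivalently, every) self-adjoint extension $H$ of $\dot H$. *)

theory Defs
  imports "HOL-Analysis.Analysis"
begin

section \<open>Unbounded operators in a complex inner product space\<close>

text \<open>The space is given by a carrier set with its operations, because the carrier of
  \<open>L\<^sup>2(\<real>; d\<omega>)\<close> depends on the measure \<open>\<omega>\<close> and hence cannot be a type.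
  The inner product is linear in the second argument.\<close>

record 'v cspace =
  vecs :: "'v set"
  vzero :: "'v"
  vadd :: "'v \<Rightarrow> 'v \<Rightarrow> 'v"
  vscale :: "complex \<Rightarrow> 'v \<Rightarrow> 'v"
  vinner :: "'v \<Rightarrow> 'v \<Rightarrow> complex"

definition vdiff :: "'v cspace \<Rightarrow> 'v \<Rightarrow> 'v \<Rightarrow> 'v" where
  "vdiff X x y = vadd X x (vscale X (-1) y)"

definition vnorm :: "'v cspace \<Rightarrow> 'v \<Rightarrow> real" where
  "vnorm X x = sqrt (Re (vinner X x x))"

definition vtendsto :: "'v cspace \<Rightarrow> (nat \<Rightarrow> 'v) \<Rightarrow> 'v \<Rightarrow> bool" where
  "vtendsto X s x \<longleftrightarrow> (\<lambda>n. vnorm X (vdiff X (s n) x)) \<longlonglongrightarrow> 0"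

definition vclosure :: "'v cspace \<Rightarrow> 'v set \<Rightarrow> 'v set" where
  "vclosure X U = {x \<in> vecs X. \<forall>e>0. \<exists>u\<in>U. vnorm X (vdiff X u x) < e}"

definition vsubspace :: "'v cspace \<Rightarrow> 'v set \<Rightarrow> bool" where
  "vsubspace X U \<longleftrightarrow> U \<subseteq> vecs X \<and> vzero X \<in> U \<and>
     (\<forall>x\<in>U. \<forall>y\<in>U. vadd X x y \<in> U) \<and> (\<forall>c. \<forall>x\<in>U. vscale X c x \<in> U)"

definition vspan :: "'v cspace \<Rightarrow> 'v set \<Rightarrow> 'v set" where
  "vspan X B = vsubspace X hull B"

definition has_vdim :: "'v cspace \<Rightarrow> 'v set \<Rightarrow> nat \<Rightarrow> bool" where
  "has_vdim X W n \<longleftrightarrow>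
     (\<exists>B. finite B \<and> card B = n \<and> B \<subseteq> vecs X \<and> (\<forall>b\<in>B. b \<notin> vspan X (B - {b})) \<and> vspan X B = W)"

text \<open>Operators are identified with their graphs, so that \<open>S \<subseteq> T\<close> says that \<open>T\<close> extends \<open>S\<close>,
  and \<open>T\<inverse>\<close> is the graph of the inverse.\<close>

definition linear_operator :: "'v cspace \<Rightarrow> ('v \<times> 'v) set \<Rightarrow> bool" where
  "linear_operator X T \<longleftrightarrow> T \<subseteq> vecs X \<times> vecs X \<and> single_valued T \<and> (vzero X, vzero X) \<in> T \<and>
     (\<forall>(x, u)\<in>T. \<forall>(y, v)\<in>T. (vadd X x y, vadd X u v) \<in> T) \<and>
     (\<forall>c. \<forall>(x, u)\<in>T. (vscale X c x, vscale X c u) \<in> T)"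

definition densely_defined :: "'v cspace \<Rightarrow> ('v \<times> 'v) set \<Rightarrow> bool" where
  "densely_defined X T \<longleftrightarrow> linear_operator X T \<and> vclosure X (Domain T) = vecs X"

definition closed_operator :: "'v cspace \<Rightarrow> ('v \<times> 'v) set \<Rightarrow> bool" where
  "closed_operator X T \<longleftrightarrow> linear_operator X T \<and>
     (\<forall>f g. \<forall>x\<in>vecs X. \<forall>y\<in>vecs X.
        (\<forall>n. (f n, g n) \<in> T) \<and> vtendsto X f x \<and> vtendsto X g y \<longrightarrow> (x, y) \<in> T)"

definition adjoint_op :: "'v cspace \<Rightarrow> ('v \<times> 'v) set \<Rightarrow> ('v \<times> 'v) set" where
  "adjoint_op X T = {(y, w) \<in> vecs X \<times> vecs X. \<forall>(x, u)\<in>T. vinner X u y = vinner X x w}"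

definition symmetric_operator :: "'v cspace \<Rightarrow> ('v \<times> 'v) set \<Rightarrow> bool" where
  "symmetric_operator X T \<longleftrightarrow> densely_defined X T \<and> T \<subseteq> adjoint_op X T"

definition self_adjoint :: "'v cspace \<Rightarrow> ('v \<times> 'v) set \<Rightarrow> bool" where
  "self_adjoint X T \<longleftrightarrow> densely_defined X T \<and> T = adjoint_op X T"

text \<open>The graph of \<open>T - z\<close>.\<close>

definition shift_op :: "'v cspace \<Rightarrow> ('v \<times> 'v) set \<Rightarrow> complex \<Rightarrow> ('v \<times> 'v) set" where
  "shift_op X T z = (\<lambda>(x, u). (x, vdiff X u (vscale X z x))) ` T"

definition kernel_op :: "'v cspace \<Rightarrow> ('v \<times> 'v) set \<Rightarrow> 'v set" where
  "kernel_op X T = {x. (x, vzero X) \<in> T}"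

definition bounded_everywhere_defined :: "'v cspace \<Rightarrow> ('v \<times> 'v) set \<Rightarrow> bool" where
  "bounded_everywhere_defined X T \<longleftrightarrow> linear_operator X T \<and> Domain T = vecs X \<and>
     (\<exists>C. \<forall>(x, u)\<in>T. vnorm X u \<le> C * vnorm X x)"

definition resolvent_set :: "'v cspace \<Rightarrow> ('v \<times> 'v) set \<Rightarrow> complex set" where
  "resolvent_set X T = {z. bounded_everywhere_defined X ((shift_op X T z)\<inverse>)}"

definition op_spectrum :: "'v cspace \<Rightarrow> ('v \<times> 'v) set \<Rightarrow> complex set" where
  "op_spectrum X T = - resolvent_set X T"

definition eigenvalues :: "'v cspace \<Rightarrow> ('v \<times> 'v) set \<Rightarrow> complex set" where
  "eigenvalues X T = {z. \<exists>x\<in>kernel_op X (shift_op X T z). x \<noteq> vzero X}"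

definition has_deficiency_indices :: "'v cspace \<Rightarrow> ('v \<times> 'v) set \<Rightarrow> nat \<Rightarrow> nat \<Rightarrow> bool" where
  "has_deficiency_indices X T m n \<longleftrightarrow>
     has_vdim X (kernel_op X (shift_op X (adjoint_op X T) \<i>)) m \<and>
     has_vdim X (kernel_op X (shift_op X (adjoint_op X T) (- \<i>))) n"

text \<open>The operator \<open>T\<close> is prime if, for some self-adjoint extension \<open>H\<close>, the vectors
  \<open>(H - z)\<^sup>-\<^sup>1 u\<close> with \<open>u \<in> ker (T\<^sup>* - \<i>)\<close> and \<open>z\<close> nonreal span a dense subspace.\<close>

definition prime_operator :: "'v cspace \<Rightarrow> ('v \<times> 'v) set \<Rightarrow> bool" where
  "prime_operator X T \<longleftrightarrow> (\<exists>H. self_adjoint X H \<and> T \<subseteq> H \<and>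
     vclosure X (vspan X (\<Union>z\<in>{z. Im z \<noteq> 0}.
       (shift_op X H z)\<inverse> `` kernel_op X (shift_op X (adjoint_op X T) \<i>))) = vecs X)"

definition prime_symmetric_operator_11 :: "'v cspace \<Rightarrow> ('v \<times> 'v) set \<Rightarrow> bool" where
  "prime_symmetric_operator_11 X T \<longleftrightarrow> densely_defined X T \<and> closed_operator X T \<and>
     symmetric_operator X T \<and> has_deficiency_indices X T 1 1 \<and> prime_operator X T"

definition quasi_hermitian_extension ::
    "'v cspace \<Rightarrow> ('v \<times> 'v) set \<Rightarrow> ('v \<times> 'v) set \<Rightarrow> bool" where
  "quasi_hermitian_extension X T S \<longleftrightarrow> prime_symmetric_operator_11 X T \<and>
     closed_operator X S \<and> T \<subset> S \<and> S \<subset> adjoint_op X T \<and> \<not> self_adjoint X S"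

section \<open>The Hilbert space of square integrable functions\<close>

definition square_integrable :: "'a measure \<Rightarrow> ('a \<Rightarrow> complex) set" where
  "square_integrable M = {f \<in> borel_measurable M. integrable M (\<lambda>x. (cmod (f x))\<^sup>2)}"

definition L2_class :: "'a measure \<Rightarrow> ('a \<Rightarrow> complex) \<Rightarrow> ('a \<Rightarrow> complex) set" where
  "L2_class M f = {g \<in> square_integrable M. AE x in M. g x = f x}"

text \<open>The vectors are the classes modulo equality almost everywhere; the operations are those
  of representatives, on which they do not depend.\<close>

definition L2_space :: "'a measure \<Rightarrow> ('a \<Rightarrow> complex) set cspace" where
  "L2_space M = \<lparr>
     vecs = L2_class M ` square_integrable M,
     vzero = L2_class M (\<lambda>x. 0),
     vadd = (\<lambda>F G. \<Union>f\<in>F. \<Union>g\<in>G. L2_class M (\<lambda>x. f x + g x)),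
     vscale = (\<lambda>c F. \<Union>f\<in>F. L2_class M (\<lambda>x. c * f x)),
     vinner = (\<lambda>F G. the_elem (\<Union>f\<in>F. \<Union>g\<in>G. {\<integral>x. cnj (f x) * g x \<partial>M}))\<rparr>"

definition mult_dom :: "real measure \<Rightarrow> (real \<Rightarrow> complex) set" where
  "mult_dom \<omega> = square_integrable (density \<omega> (\<lambda>t. ennreal (1 + t\<^sup>2)))"

definition mult_op :: "real measure \<Rightarrow> ((real \<Rightarrow> complex) set \<times> (real \<Rightarrow> complex) set) set" where
  "mult_op \<omega> = (\<lambda>f. (L2_class \<omega> f, L2_class \<omega> (\<lambda>t. of_real t * f t))) ` mult_dom \<omega>"

text \<open>A function in \<open>dom(H)\<close> is \<open>\<omega>\<close>-integrable when \<open>(1 + t\<^sup>2)\<inverse>\<close> is, by Cauchy--Schwarz, so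
  the condition on the integral below, which is independent of the representative, never
  concerns the default value of the integral of a non-integrable function.\<close>

definition mult_op_dot :: "real measure \<Rightarrow> ((real \<Rightarrow> complex) set \<times> (real \<Rightarrow> complex) set) set" where
  "mult_op_dot \<omega> = {(F, G) \<in> mult_op \<omega>.
     F \<in> L2_class \<omega> ` {f \<in> mult_dom \<omega>. (\<integral>t. f t \<partial>\<omega>) = 0}}"

definition half_plane_representation :: "real measure \<Rightarrow> bool" where
  "half_plane_representation \<omega> \<longleftrightarrow>
     (\<forall>z. (Im z > 0 \<longrightarrow>
             (\<integral>t. inverse (of_real t - z) - of_real (t * inverse (1 + t\<^sup>2)) \<partial>\<omega>) = \<i>) \<and>
          (Im z < 0 \<longrightarrow>
             (\<integral>t. inverse (of_real t - z) - of_real (t * inverse (1 + t\<^sup>2)) \<partial>\<omega>) = - \<i>))"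

end

theory Submission
  imports Defs "HOL-Probability.Sinc_Integral"
begin

text \<open>
  Write \<open>g\<^sub>z(t) = 1 / (t - z)\<close> for the Cauchy kernels. They lie in \<open>L\<^sup>2(\<omega>)\<close> for nonreal \<open>z\<close>, while the constant
  \<open>1\<close> does not, as \<open>\<omega>\<close> is infinite. The whole argument rests on an explicit description of the adjoint
  of the symmetric operator: it consists of the pairs \<open>(f, t f - c)\<close> with a constant \<open>c\<close>
  (\<open>adjoint_dot_iff\<close>). So its eigenvectors at a nonreal \<open>z\<close> are the multiples of \<open>g\<^sub>z\<close>, with \<open>c = 1\<close>, and the
  deficiency indices are \<open>(1,1)\<close>.

  Let \<open>M(z)\<close> be the integral of the half-plane representation. Then \<open>M(\<plusminus>\<i>) = \<plusminus>\<i>\<close> by the normalization of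
  \<open>\<omega>\<close>, and \<open>M(z) - M(s) = \<integral> (g\<^sub>z - g\<^sub>s) d\<omega>\<close>. A proper extension with eigenvalues \<open>s\<close> and \<open>z\<close> contains \<open>g\<^sub>z - g\<^sub>s\<close>,
  which lies in \<open>dom H\<close>. It has to lie in the domain of the symmetric operator, since otherwise the
  extension would contain the two missing dimensions of the adjoint; so \<open>M(z) = M(s)\<close>
  (\<open>proper_extension_kernel_pairing\<close>). If a half-plane consists of eigenvalues, then \<open>M\<close> is constant
  on it, and by conjugation on the other one too.

  Conversely, given the representation, take the extension by \<open>g\<^sub>s\<close> with \<open>s = \<i>\<close> or \<open>s = -\<i>\<close>. It contains \<open>g\<^sub>z\<close>
  exactly when \<open>M(z) = M(s)\<close>, that is, on the side of \<open>s\<close>. On the other side \<open>M(z) - M(s) = - 2 s\<close>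
  does not vanish, which is what one has to divide by in the resolvent (\<open>kernel_extension_resolvent\<close>).
  Real points are limits of eigenvalues, and are not eigenvalues themselves because \<open>1 / (t - z)\<close> is not
  square integrable for Lebesgue measure.

  That \<open>\<omega>\<close> is then \<open>\<pi>\<^sup>-\<^sup>1 d\<lambda>\<close>, and that the symmetric operator is prime, are both instances of Stieltjes
  inversion (\<open>poisson_class_contains_intervals\<close>): a class of functions that contains the Poisson
  kernels and is closed under linear combinations and dominated limits contains the indicators of
  bounded intervals. It is applied to the functions with equal integrals for the two measures, and
  to the functions \<open>F\<close> for which \<open>F g\<^sub>\<i>\<close> lies in the closed span of the vectors \<open>(H - z)\<^sup>-\<^sup>1 g\<^sub>\<i>\<close>.
\<close>

section \<open>Square integrable functions\<close>

lemma square_integrableI: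
  assumes "f \<in> borel_measurable M" "integrable M (\<lambda>x. (cmod (f x))\<^sup>2)"
  shows "f \<in> square_integrable M"
  using assms by (simp add: square_integrable_def)

lemma square_integrable_measurable [measurable_dest]:
  "f \<in> square_integrable M \<Longrightarrow> f \<in> borel_measurable M"
  by (simp add: square_integrable_def)

lemma borel_measurable_cnj [measurable]:
  "f \<in> borel_measurable M \<Longrightarrow> (\<lambda>x. cnj (f x)) \<in> borel_measurable M"
  by (rule borel_measurable_continuous_on[of cnj]) (intro continuous_intros)

lemma square_integrable_norm: "f \<in> square_integrable M \<Longrightarrow> integrable M (\<lambda>x. (cmod (f x))\<^sup>2)"
  by (simp add: square_integrable_def)

lemma square_integrable_dominated:
  assumes "g \<in> square_integrable M" and [measurable]: "f \<in> borel_measurable M"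
    and "AE x in M. cmod (f x) \<le> C * cmod (g x)"
  shows "f \<in> square_integrable M"
proof (rule square_integrableI)
  have "integrable M (\<lambda>x. C\<^sup>2 * (cmod (g x))\<^sup>2)"
    using square_integrable_norm[OF assms(1)] by simp
  then show "integrable M (\<lambda>x. (cmod (f x))\<^sup>2)"
  proof (rule Bochner_Integration.integrable_bound)
    show "AE x in M. norm ((cmod (f x))\<^sup>2) \<le> norm (C\<^sup>2 * (cmod (g x))\<^sup>2)"
      using assms(3)
    proof eventually_elim
      fix x assume "cmod (f x) \<le> C * cmod (g x)"
      then have "(cmod (f x))\<^sup>2 \<le> (C * cmod (g x))\<^sup>2" by (intro power_mono) auto
      then show "norm ((cmod (f x))\<^sup>2) \<le> norm (C\<^sup>2 * (cmod (g x))\<^sup>2)"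
        by (simp add: power_mult_distrib)
    qed
  qed simp
qed fact

lemma cmod_add_power2_le: "(cmod (a + b))\<^sup>2 \<le> 2 * (cmod a)\<^sup>2 + 2 * (cmod b)\<^sup>2"
proof -
  have "(cmod (a + b))\<^sup>2 \<le> (cmod a + cmod b)\<^sup>2"
    by (intro power_mono norm_triangle_ineq) auto
  also have "\<dots> \<le> 2 * (cmod a)\<^sup>2 + 2 * (cmod b)\<^sup>2"
    using zero_le_power2[of "cmod a - cmod b"] by (simp add: power2_sum power2_diff)
  finally show ?thesis .
qed

lemma square_integrable_zero [simp]: "(\<lambda>x. 0) \<in> square_integrable M"
  by (rule square_integrableI) auto

lemma square_integrable_add [simp, intro]:
  assumes "f \<in> square_integrable M" "g \<in> square_integrable M"
  shows "(\<lambda>x. f x + g x) \<in> square_integrable M"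
proof (rule square_integrableI)
  show "(\<lambda>x. f x + g x) \<in> borel_measurable M" using assms[THEN square_integrable_measurable] by measurable
  have "integrable M (\<lambda>x. 2 * (cmod (f x))\<^sup>2 + 2 * (cmod (g x))\<^sup>2)"
    using assms[THEN square_integrable_norm] by simp
  then show "integrable M (\<lambda>x. (cmod (f x + g x))\<^sup>2)"
  proof (rule Bochner_Integration.integrable_bound)
    show "(\<lambda>x. (cmod (f x + g x))\<^sup>2) \<in> borel_measurable M" using assms[THEN square_integrable_measurable] by measurable
  qed (auto intro!: AE_I2 simp: cmod_add_power2_le)
qed

lemma square_integrable_scale [simp, intro]:
  assumes "f \<in> square_integrable M"
  shows "(\<lambda>x. c * f x) \<in> square_integrable M"
  using assms by (intro square_integrable_dominated[OF assms, of _ "cmod c"]) (auto simp: norm_mult)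

lemma square_integrable_diff [simp, intro]:
  assumes "f \<in> square_integrable M" "g \<in> square_integrable M"
  shows "(\<lambda>x. f x - g x) \<in> square_integrable M"
  using square_integrable_add[OF assms(1) square_integrable_scale[OF assms(2), of "-1"]] by simp

lemma integrable_cnj_mult [simp, intro]:
  assumes "f \<in> square_integrable M" "g \<in> square_integrable M"
  shows "integrable M (\<lambda>x. cnj (f x) * g x)"
proof (rule Bochner_Integration.integrable_bound)
  show "integrable M (\<lambda>x. (cmod (f x))\<^sup>2 + (cmod (g x))\<^sup>2)"
    using assms[THEN square_integrable_norm] by simp
  show "(\<lambda>x. cnj (f x) * g x) \<in> borel_measurable M" using assms[THEN square_integrable_measurable] by measurable
  have "cmod a * cmod b \<le> (cmod a)\<^sup>2 + (cmod b)\<^sup>2" for a b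
    using sum_squares_bound[of "cmod a" "cmod b"] mult_nonneg_nonneg[OF norm_ge_zero norm_ge_zero, of a b]
    by linarith
  then show "AE x in M. cmod (cnj (f x) * g x) \<le> norm ((cmod (f x))\<^sup>2 + (cmod (g x))\<^sup>2)"
    by (auto simp: norm_mult)
qed

definition l2_inner :: "'a measure \<Rightarrow> ('a \<Rightarrow> complex) \<Rightarrow> ('a \<Rightarrow> complex) \<Rightarrow> complex" where
  "l2_inner M f g = (\<integral>x. cnj (f x) * g x \<partial>M)"

definition l2_norm :: "'a measure \<Rightarrow> ('a \<Rightarrow> complex) \<Rightarrow> real" where
  "l2_norm M f = sqrt (\<integral>x. (cmod (f x))\<^sup>2 \<partial>M)"

lemma l2_norm_nonneg [simp]: "0 \<le> l2_norm M f"
  by (simp add: l2_norm_def)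

lemma l2_norm_power2: "(l2_norm M f)\<^sup>2 = (\<integral>x. (cmod (f x))\<^sup>2 \<partial>M)"
  by (simp add: l2_norm_def)

lemma l2_inner_self: "l2_inner M f f = of_real ((l2_norm M f)\<^sup>2)"
  by (simp add: l2_inner_def l2_norm_power2 mult.commute flip: complex_norm_square integral_complex_of_real)

lemma l2_inner_add_right:
  assumes "f \<in> square_integrable M" "g \<in> square_integrable M" "h \<in> square_integrable M"
  shows "l2_inner M f (\<lambda>x. g x + h x) = l2_inner M f g + l2_inner M f h"
  using assms by (simp add: l2_inner_def distrib_left)

lemma l2_inner_diff_right:
  assumes "f \<in> square_integrable M" "g \<in> square_integrable M" "h \<in> square_integrable M"
  shows "l2_inner M f (\<lambda>x. g x - h x) = l2_inner M f g - l2_inner M f h"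
  using assms by (simp add: l2_inner_def right_diff_distrib)

lemma l2_inner_scale_right: "l2_inner M f (\<lambda>x. c * g x) = c * l2_inner M f g"
  by (simp add: l2_inner_def mult.left_commute[of _ c])

lemma l2_inner_scale_left: "l2_inner M (\<lambda>x. c * f x) g = cnj c * l2_inner M f g"
  by (simp add: l2_inner_def mult.assoc)

lemma l2_inner_cnj: "cnj (l2_inner M f g) = l2_inner M g f"
  unfolding l2_inner_def by (subst Bochner_Integration.integral_cnj[symmetric]) (simp add: mult.commute)

lemma l2_inner_cong:
  assumes "AE x in M. f x = f' x" "AE x in M. g x = g' x"
    "f \<in> square_integrable M" "g \<in> square_integrable M"
    "f' \<in> square_integrable M" "g' \<in> square_integrable M"
  shows "l2_inner M f g = l2_inner M f' g'"
  unfolding l2_inner_def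
proof (rule integral_cong_AE)
  show "AE x in M. cnj (f x) * g x = cnj (f' x) * g' x"
    using assms(1,2) by eventually_elim simp
qed (use assms(3-6)[THEN square_integrable_measurable] in measurable)

lemma l2_norm_eq_0_iff:
  assumes "f \<in> square_integrable M"
  shows "l2_norm M f = 0 \<longleftrightarrow> (AE x in M. f x = 0)"
proof -
  have "l2_norm M f = 0 \<longleftrightarrow> (\<integral>x. (cmod (f x))\<^sup>2 \<partial>M) = 0" by (simp add: l2_norm_def)
  also have "\<dots> \<longleftrightarrow> (AE x in M. (cmod (f x))\<^sup>2 = 0)"
    by (rule integral_nonneg_eq_0_iff_AE) (use assms in \<open>auto simp: square_integrable_norm\<close>)
  finally show ?thesis by simp
qed

lemma l2_norm_scale: "l2_norm M (\<lambda>x. c * f x) = cmod c * l2_norm M f"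
  by (simp add: l2_norm_def norm_mult power_mult_distrib real_sqrt_mult)

lemma l2_norm_mono:
  assumes "g \<in> square_integrable M" and [measurable]: "f \<in> borel_measurable M"
    and "AE x in M. cmod (f x) \<le> C * cmod (g x)" and "0 \<le> C"
  shows "l2_norm M f \<le> C * l2_norm M g"
proof -
  have f: "f \<in> square_integrable M" by (rule square_integrable_dominated[OF assms(1-3)])
  have "(\<integral>x. (cmod (f x))\<^sup>2 \<partial>M) \<le> (\<integral>x. C\<^sup>2 * (cmod (g x))\<^sup>2 \<partial>M)"
  proof (rule integral_mono_AE)
    show "AE x in M. (cmod (f x))\<^sup>2 \<le> C\<^sup>2 * (cmod (g x))\<^sup>2"
      using assms(3) by eventually_elim (use power_mono in \<open>fastforce simp flip: power_mult_distrib\<close>)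
  qed (use assms f in \<open>auto simp: square_integrable_norm\<close>)
  then have "(\<integral>x. (cmod (f x))\<^sup>2 \<partial>M) \<le> C\<^sup>2 * (\<integral>x. (cmod (g x))\<^sup>2 \<partial>M)" by simp
  then have "l2_norm M f \<le> sqrt (C\<^sup>2 * (\<integral>x. (cmod (g x))\<^sup>2 \<partial>M))"
    unfolding l2_norm_def by (rule real_sqrt_le_mono)
  then show ?thesis using assms(4) by (simp add: real_sqrt_mult l2_norm_def)
qed

text \<open>Unless \<open>g\<close> vanishes, expand \<open>\<parallel>f - (\<langle>g, f\<rangle> / \<parallel>g\<parallel>\<^sup>2) g\<parallel>\<^sup>2 \<ge> 0\<close>, where the projection on \<open>g\<close> is subtracted.\<close>

lemma l2_Cauchy_Schwarz:
  assumes f: "f \<in> square_integrable M" and g: "g \<in> square_integrable M"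
  shows "cmod (l2_inner M g f) \<le> l2_norm M g * l2_norm M f"
proof (cases "l2_norm M g = 0")
  case True
  then have "AE x in M. g x = 0" using g by (simp add: l2_norm_eq_0_iff)
  then have "l2_inner M g f = l2_inner M (\<lambda>x. 0) f"
    by (intro l2_inner_cong) (use f g in auto)
  then show ?thesis by (simp add: l2_inner_def)
next
  case False
  define a :: complex where "a = of_real ((l2_norm M g)\<^sup>2)"
  define b where "b = l2_inner M g f"
  define c where "c = b / a"
  define h where "h = (\<lambda>x. f x - c * g x)"
  have h: "h \<in> square_integrable M" unfolding h_def by (intro square_integrable_diff square_integrable_scale f g)
  have a0: "a \<noteq> 0" using False by (simp add: a_def)
  have gg: "l2_inner M g g = a" by (simp add: l2_inner_self a_def)
  have gh: "l2_inner M g h = 0"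
    unfolding h_def using f g a0
    by (simp add: l2_inner_diff_right l2_inner_scale_right gg b_def[symmetric])
      (simp add: c_def)
  then have hg: "l2_inner M h g = 0" using l2_inner_cnj[of M g h] by simp
  have "of_real ((l2_norm M h)\<^sup>2) = l2_inner M h h" by (simp add: l2_inner_self)
  also have "\<dots> = l2_inner M h f - c * l2_inner M h g"
    using f g h by (subst (2) h_def) (simp add: l2_inner_diff_right l2_inner_scale_right)
  also have "\<dots> = l2_inner M h f" using hg by simp
  also have "\<dots> = cnj (l2_inner M f h)" by (simp add: l2_inner_cnj)
  also have "l2_inner M f h = l2_inner M f f - c * l2_inner M f g"
    using f g by (simp add: h_def l2_inner_diff_right l2_inner_scale_right)
  also have "l2_inner M f g = cnj b" by (simp add: b_def l2_inner_cnj)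
  finally have "of_real ((l2_norm M h)\<^sup>2) = cnj (of_real ((l2_norm M f)\<^sup>2) - b / a * cnj b)"
    by (simp add: l2_inner_self c_def)
  also have "b / a * cnj b = of_real ((cmod b)\<^sup>2 / (l2_norm M g)\<^sup>2)"
    by (simp add: a_def complex_norm_square flip: of_real_power)
  finally have "complex_of_real ((l2_norm M h)\<^sup>2)
      = complex_of_real ((l2_norm M f)\<^sup>2 - (cmod b)\<^sup>2 / (l2_norm M g)\<^sup>2)"
    by simp
  then have "(l2_norm M h)\<^sup>2 = (l2_norm M f)\<^sup>2 - (cmod b)\<^sup>2 / (l2_norm M g)\<^sup>2"
    by (simp only: of_real_eq_iff)
  then have "(cmod b)\<^sup>2 / (l2_norm M g)\<^sup>2 \<le> (l2_norm M f)\<^sup>2" using zero_le_power2[of "l2_norm M h"] by linarith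
  then have "(cmod b)\<^sup>2 \<le> (l2_norm M g * l2_norm M f)\<^sup>2"
    using False by (simp add: divide_simps power_mult_distrib mult.commute split: if_splits)
  then show ?thesis unfolding b_def by (rule power2_le_imp_le) simp
qed

lemma l2_norm_add_le:
  assumes f: "f \<in> square_integrable M" and g: "g \<in> square_integrable M"
  shows "l2_norm M (\<lambda>x. f x + g x) \<le> l2_norm M f + l2_norm M g"
proof -
  have "of_real ((l2_norm M (\<lambda>x. f x + g x))\<^sup>2) = l2_inner M (\<lambda>x. f x + g x) (\<lambda>x. f x + g x)"
    by (simp add: l2_inner_self)
  also have "\<dots> = cnj (l2_inner M f (\<lambda>x. f x + g x)) + cnj (l2_inner M g (\<lambda>x. f x + g x))"
    using f g by (subst l2_inner_add_right) (auto simp: l2_inner_cnj)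
  also have "\<dots> = cnj (l2_inner M f f + l2_inner M f g + (l2_inner M g f + l2_inner M g g))"
    using f g by (simp add: l2_inner_add_right)
  also have "\<dots> = of_real ((l2_norm M f)\<^sup>2 + (l2_norm M g)\<^sup>2) + (cnj (l2_inner M g f) + l2_inner M g f)"
    by (simp add: l2_inner_self flip: l2_inner_cnj[of M f g])
  also have "\<dots> = of_real ((l2_norm M f)\<^sup>2 + (l2_norm M g)\<^sup>2 + 2 * Re (l2_inner M g f))"
    by (simp add: complex_eq_iff)
  finally have "(l2_norm M (\<lambda>x. f x + g x))\<^sup>2 = (l2_norm M f)\<^sup>2 + (l2_norm M g)\<^sup>2 + 2 * Re (l2_inner M g f)"
    by (simp only: of_real_eq_iff)
  also have "\<dots> \<le> (l2_norm M f)\<^sup>2 + (l2_norm M g)\<^sup>2 + 2 * (l2_norm M g * l2_norm M f)"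
    using l2_Cauchy_Schwarz[OF f g] complex_Re_le_cmod[of "l2_inner M g f"] by linarith
  also have "\<dots> = (l2_norm M f + l2_norm M g)\<^sup>2" by (simp add: power2_sum mult.commute)
  finally show ?thesis by (rule power2_le_imp_le) simp
qed

lemma l2_dominated_convergence:
  assumes g: "g \<in> square_integrable M"
    and [measurable]: "\<And>n. f n \<in> borel_measurable M" "h \<in> borel_measurable M"
    and lim: "AE x in M. (\<lambda>n. f n x) \<longlonglongrightarrow> h x"
    and bound: "\<And>n. AE x in M. cmod (f n x) \<le> C * cmod (g x)"
  shows "h \<in> square_integrable M" "f n \<in> square_integrable M"
    "(\<lambda>n. l2_norm M (\<lambda>x. f n x - h x)) \<longlonglongrightarrow> 0"
proof -
  have ball: "AE x in M. \<forall>n. cmod (f n x) \<le> C * cmod (g x)"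
    unfolding AE_all_countable using bound by blast
  have hb: "AE x in M. cmod (h x) \<le> C * cmod (g x)"
    using ball lim
  proof eventually_elim
    fix x assume "\<forall>n. cmod (f n x) \<le> C * cmod (g x)" "(\<lambda>n. f n x) \<longlonglongrightarrow> h x"
    then show "cmod (h x) \<le> C * cmod (g x)"
      by (intro tendsto_upperbound[OF tendsto_norm]) auto
  qed
  show "h \<in> square_integrable M" by (rule square_integrable_dominated[OF g _ hb]) simp
  show "f n \<in> square_integrable M" by (rule square_integrable_dominated[OF g _ bound]) simp
  have "(\<lambda>n. \<integral>x. (cmod (f n x - h x))\<^sup>2 \<partial>M) \<longlonglongrightarrow> (\<integral>x. 0 \<partial>M)"
  proof (rule integral_dominated_convergence[where w = "\<lambda>x. 4 * C\<^sup>2 * (cmod (g x))\<^sup>2"])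
    show "AE x in M. (\<lambda>n. (cmod (f n x - h x))\<^sup>2) \<longlonglongrightarrow> 0"
      using lim
    proof eventually_elim
      fix x assume "(\<lambda>n. f n x) \<longlonglongrightarrow> h x"
      then have "(\<lambda>n. cmod (f n x - h x)) \<longlonglongrightarrow> 0" using LIM_zero_iff tendsto_norm_zero by blast
      from tendsto_power[OF this, of 2] show "(\<lambda>n. (cmod (f n x - h x))\<^sup>2) \<longlonglongrightarrow> 0" by simp
    qed
    show "AE x in M. norm ((cmod (f n x - h x))\<^sup>2) \<le> 4 * C\<^sup>2 * (cmod (g x))\<^sup>2" for n
      using ball hb
    proof eventually_elim
      fix x assume a: "\<forall>n. cmod (f n x) \<le> C * cmod (g x)" "cmod (h x) \<le> C * cmod (g x)"
      have "cmod (f n x - h x) \<le> cmod (f n x) + cmod (h x)" by (rule norm_triangle_ineq4)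
      also have "\<dots> \<le> 2 * C * cmod (g x)" using a(1)[rule_format, of n] a(2) by simp
      finally have "(cmod (f n x - h x))\<^sup>2 \<le> (2 * C * cmod (g x))\<^sup>2" by (intro power_mono) auto
      then show "norm ((cmod (f n x - h x))\<^sup>2) \<le> 4 * C\<^sup>2 * (cmod (g x))\<^sup>2"
        by (simp add: power_mult_distrib)
    qed
  qed (use square_integrable_norm[OF g] in auto)
  then have "(\<lambda>n. sqrt (\<integral>x. (cmod (f n x - h x))\<^sup>2 \<partial>M)) \<longlonglongrightarrow> sqrt 0"
    by (intro tendsto_real_sqrt) simp
  then show "(\<lambda>n. l2_norm M (\<lambda>x. f n x - h x)) \<longlonglongrightarrow> 0" by (simp add: l2_norm_def)
qed

lemma l2_inner_tendsto:
  assumes "f \<in> square_integrable M" "\<And>n. s n \<in> square_integrable M" "x \<in> square_integrable M"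
    and "(\<lambda>n. l2_norm M (\<lambda>t. s n t - x t)) \<longlonglongrightarrow> 0"
  shows "(\<lambda>n. l2_inner M f (s n)) \<longlonglongrightarrow> l2_inner M f x"
proof -
  have "(\<lambda>n. l2_norm M f * l2_norm M (\<lambda>t. s n t - x t)) \<longlonglongrightarrow> 0"
    using tendsto_mult_left[OF assms(4), of "l2_norm M f"] by simp
  then have "(\<lambda>n. l2_inner M f (s n) - l2_inner M f x) \<longlonglongrightarrow> 0"
  proof (rule Lim_null_comparison[rotated], intro always_eventually allI)
    fix n
    have "l2_inner M f (s n) - l2_inner M f x = l2_inner M f (\<lambda>t. s n t - x t)"
      using assms by (simp add: l2_inner_diff_right)
    then show "cmod (l2_inner M f (s n) - l2_inner M f x) \<le> l2_norm M f * l2_norm M (\<lambda>t. s n t - x t)"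
      using assms by (simp add: l2_Cauchy_Schwarz)
  qed
  then show ?thesis by (simp add: LIM_zero_iff)
qed

section \<open>Classes of square integrable functions\<close>

lemma L2_class_eq_iff:
  assumes "f \<in> square_integrable M" "g \<in> square_integrable M"
  shows "L2_class M f = L2_class M g \<longleftrightarrow> (AE x in M. f x = g x)"
proof
  assume "L2_class M f = L2_class M g"
  moreover have "f \<in> L2_class M f" using assms by (simp add: L2_class_def)
  ultimately show "AE x in M. f x = g x" by (simp add: L2_class_def)
next
  assume *: "AE x in M. f x = g x"
  show "L2_class M f = L2_class M g"
  proof (rule Set.set_eqI)
    fix h
    have "(AE x in M. h x = f x) \<longleftrightarrow> (AE x in M. h x = g x)"
    proof
      assume "AE x in M. h x = f x" then show "AE x in M. h x = g x" using * by eventually_elim simp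
    next
      assume "AE x in M. h x = g x" then show "AE x in M. h x = f x" using * by eventually_elim simp
    qed
    then show "h \<in> L2_class M f \<longleftrightarrow> h \<in> L2_class M g" by (simp add: L2_class_def)
  qed
qed

lemma L2_class_cong:
  assumes "f \<in> square_integrable M" "g \<in> square_integrable M" "AE x in M. f x = g x"
  shows "L2_class M f = L2_class M g"
  using assms by (simp add: L2_class_eq_iff)

lemma L2_class_self: "f \<in> square_integrable M \<Longrightarrow> f \<in> L2_class M f"
  by (simp add: L2_class_def)

lemma L2_class_member:
  assumes "f' \<in> L2_class M f"
  shows "f' \<in> square_integrable M" "AE x in M. f' x = f x"
  using assms by (auto simp: L2_class_def)

lemma vecs_L2: "vecs (L2_space M) = L2_class M ` square_integrable M"
  by (simp add: L2_space_def)

lemma L2_class_in_vecs [simp, intro]: "f \<in> square_integrable M \<Longrightarrow> L2_class M f \<in> vecs (L2_space M)"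
  by (simp add: vecs_L2)

lemma vecs_L2E:
  assumes "F \<in> vecs (L2_space M)"
  obtains f where "f \<in> square_integrable M" "F = L2_class M f"
  using assms by (auto simp: vecs_L2)

lemma vzero_L2: "vzero (L2_space M) = L2_class M (\<lambda>x. 0)"
  by (simp add: L2_space_def)

lemma vadd_L2:
  assumes "f \<in> square_integrable M" "g \<in> square_integrable M"
  shows "vadd (L2_space M) (L2_class M f) (L2_class M g) = L2_class M (\<lambda>x. f x + g x)"
proof -
  have "L2_class M (\<lambda>x. f' x + g' x) = L2_class M (\<lambda>x. f x + g x)"
    if "f' \<in> L2_class M f" "g' \<in> L2_class M g" for f' g'
  proof (rule L2_class_cong)
    show "AE x in M. f' x + g' x = f x + g x"
      using L2_class_member(2)[OF that(1)] L2_class_member(2)[OF that(2)] by eventually_elim simp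
  qed (use assms that L2_class_member in blast)+
  moreover have "f \<in> L2_class M f" "g \<in> L2_class M g" using assms by (auto intro: L2_class_self)
  ultimately have "(\<Union>f'\<in>L2_class M f. \<Union>g'\<in>L2_class M g. L2_class M (\<lambda>x. f' x + g' x))
    = L2_class M (\<lambda>x. f x + g x)" by blast
  then show ?thesis by (simp add: L2_space_def)
qed

lemma vscale_L2:
  assumes "f \<in> square_integrable M"
  shows "vscale (L2_space M) c (L2_class M f) = L2_class M (\<lambda>x. c * f x)"
proof -
  have "L2_class M (\<lambda>x. c * f' x) = L2_class M (\<lambda>x. c * f x)" if "f' \<in> L2_class M f" for f'
  proof (rule L2_class_cong)
    show "AE x in M. c * f' x = c * f x"
      using L2_class_member(2)[OF that(1)] by eventually_elim simp
  qed (use assms that L2_class_member in blast)+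
  moreover have "f \<in> L2_class M f" using assms by (auto intro: L2_class_self)
  ultimately have "(\<Union>f'\<in>L2_class M f. L2_class M (\<lambda>x. c * f' x)) = L2_class M (\<lambda>x. c * f x)"
    by blast
  then show ?thesis by (simp add: L2_space_def)
qed

lemma vdiff_L2:
  assumes "f \<in> square_integrable M" "g \<in> square_integrable M"
  shows "vdiff (L2_space M) (L2_class M f) (L2_class M g) = L2_class M (\<lambda>x. f x - g x)"
  using assms by (simp add: vdiff_def vscale_L2 vadd_L2 square_integrable_scale[of _ _ "-1", simplified])

lemma vinner_L2:
  assumes "f \<in> square_integrable M" "g \<in> square_integrable M"
  shows "vinner (L2_space M) (L2_class M f) (L2_class M g) = l2_inner M f g"
proof -
  have "l2_inner M f' g' = l2_inner M f g"
    if "f' \<in> L2_class M f" "g' \<in> L2_class M g" for f' g'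
    by (rule l2_inner_cong) (use assms that L2_class_member in blast)+
  moreover have "f \<in> L2_class M f" "g \<in> L2_class M g" using assms by (auto intro: L2_class_self)
  ultimately have "(\<Union>f'\<in>L2_class M f. \<Union>g'\<in>L2_class M g. {l2_inner M f' g'}) = {l2_inner M f g}"
    by blast
  then show ?thesis by (simp add: L2_space_def l2_inner_def)
qed

lemma vnorm_L2:
  assumes "f \<in> square_integrable M"
  shows "vnorm (L2_space M) (L2_class M f) = l2_norm M f"
  using assms by (simp add: vnorm_def vinner_L2 l2_inner_self)

lemmas L2_ops = vzero_L2 vadd_L2 vscale_L2 vdiff_L2 vinner_L2 vnorm_L2

text \<open>Distances between classes are computed on representatives, so that closures can be handled without
  mentioning classes.\<close>

lemma L2_class_vclosure_iff:
  assumes "f \<in> square_integrable M" "U \<subseteq> vecs (L2_space M)"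
  shows "L2_class M f \<in> vclosure (L2_space M) U \<longleftrightarrow>
    (\<forall>e>0. \<exists>g\<in>square_integrable M. L2_class M g \<in> U \<and> l2_norm M (\<lambda>x. g x - f x) < e)"
proof -
  have "(\<exists>u\<in>U. vnorm (L2_space M) (vdiff (L2_space M) u (L2_class M f)) < e) \<longleftrightarrow>
    (\<exists>g\<in>square_integrable M. L2_class M g \<in> U \<and> l2_norm M (\<lambda>x. g x - f x) < e)" for e
  proof
    assume "\<exists>u\<in>U. vnorm (L2_space M) (vdiff (L2_space M) u (L2_class M f)) < e"
    then obtain u where "u \<in> U" "vnorm (L2_space M) (vdiff (L2_space M) u (L2_class M f)) < e" by blast
    moreover from \<open>u \<in> U\<close> assms(2) obtain g where "g \<in> square_integrable M" "u = L2_class M g"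
      by (auto elim: vecs_L2E)
    ultimately show "\<exists>g\<in>square_integrable M. L2_class M g \<in> U \<and> l2_norm M (\<lambda>x. g x - f x) < e"
      using assms by (auto simp: vdiff_L2 vnorm_L2)
  qed (use assms in \<open>force simp: vdiff_L2 vnorm_L2\<close>)
  then show ?thesis using assms by (simp add: vclosure_def)
qed

lemma vtendsto_L2:
  assumes "\<And>n. f n \<in> square_integrable M" "h \<in> square_integrable M"
  shows "vtendsto (L2_space M) (\<lambda>n. L2_class M (f n)) (L2_class M h) \<longleftrightarrow>
    (\<lambda>n. l2_norm M (\<lambda>x. f n x - h x)) \<longlonglongrightarrow> 0"
  using assms by (simp add: vtendsto_def vdiff_L2 vnorm_L2)

section \<open>Classes of functions containing the Poisson kernels\<close>

definition poisson_kernel :: "real \<Rightarrow> real \<Rightarrow> real \<Rightarrow> real" where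
  "poisson_kernel x y t = y / ((t - x)\<^sup>2 + y\<^sup>2)"

lemma poisson_kernel_nonneg: "y > 0 \<Longrightarrow> 0 \<le> poisson_kernel x y t"
  by (simp add: poisson_kernel_def)

text \<open>The Lipschitz constant in the centre \<open>x\<close> does not depend on \<open>t\<close>; it controls the error of Riemann sums
  over \<open>x\<close>.\<close>

lemma poisson_kernel_lipschitz:
  assumes "y > 0"
  shows "\<bar>poisson_kernel x y t - poisson_kernel x' y t\<bar> \<le> \<bar>x - x'\<bar> / y\<^sup>2"
proof -
  define u v where "u = t - x" and "v = t - x'"
  define U V where "U = u\<^sup>2 + y\<^sup>2" and "V = v\<^sup>2 + y\<^sup>2"
  have pos: "U > 0" "V > 0" using assms by (simp_all add: U_def V_def add_nonneg_pos)
  have le: "2 * \<bar>u\<bar> * y \<le> U" "2 * \<bar>v\<bar> * y \<le> V" "y\<^sup>2 \<le> U" "y\<^sup>2 \<le> V"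
    using sum_squares_bound[of "\<bar>u\<bar>" y] sum_squares_bound[of "\<bar>v\<bar>" y] by (simp_all add: U_def V_def)
  have "2 * \<bar>u\<bar> * y * y\<^sup>2 \<le> U * V" "2 * \<bar>v\<bar> * y * y\<^sup>2 \<le> V * U"
    using le assms pos by (auto intro!: mult_mono)
  then have key: "y * (\<bar>u\<bar> + \<bar>v\<bar>) * y\<^sup>2 \<le> U * V" by (simp add: algebra_simps)
  have "poisson_kernel x y t - poisson_kernel x' y t = y * (V - U) / (U * V)"
  proof -
    have "poisson_kernel x y t = y / U" "poisson_kernel x' y t = y / V"
      by (simp_all add: poisson_kernel_def U_def V_def u_def v_def)
    moreover have "y * (V - U) / (U * V) = y / U - y / V"
      using pos by (simp add: diff_divide_distrib right_diff_distrib)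
    ultimately show ?thesis by simp
  qed
  also have "V - U = (v - u) * (v + u)" by (simp add: U_def V_def power2_eq_square algebra_simps)
  finally have "\<bar>poisson_kernel x y t - poisson_kernel x' y t\<bar> = \<bar>v - u\<bar> * (y * \<bar>v + u\<bar>) / (U * V)"
    using pos assms by (simp add: abs_mult mult.left_commute)
  also have "\<dots> \<le> \<bar>v - u\<bar> * (y * (\<bar>u\<bar> + \<bar>v\<bar>)) / (U * V)"
    using pos assms by (intro divide_right_mono mult_left_mono) auto
  also have "\<dots> \<le> \<bar>v - u\<bar> / y\<^sup>2"
    using mult_left_mono[OF key, of "\<bar>v - u\<bar>"] pos assms by (simp add: divide_simps mult_ac)
  finally show ?thesis by (simp add: u_def v_def abs_minus_commute)
qed

lemma one_plus_square_le: "1 + t\<^sup>2 \<le> 1 + 2 * x\<^sup>2 + 2 * (t - x)\<^sup>2" for t x :: real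
proof -
  have "0 \<le> (t - 2 * x)\<^sup>2" by simp
  then show ?thesis by (simp add: power2_eq_square algebra_simps)
qed

lemma poisson_kernel_le:
  assumes "y > 0" "\<bar>x\<bar> \<le> m"
  shows "poisson_kernel x y t \<le> y * (2 + (1 + 2 * m\<^sup>2) / y\<^sup>2) / (1 + t\<^sup>2)"
proof -
  have "x\<^sup>2 \<le> m\<^sup>2" using assms(2) by (metis abs_le_square_iff abs_ge_self order_trans)
  have "1 + t\<^sup>2 \<le> 1 + 2 * m\<^sup>2 + 2 * (t - x)\<^sup>2"
    using one_plus_square_le[of t x] \<open>x\<^sup>2 \<le> m\<^sup>2\<close> by linarith
  also have "\<dots> \<le> (2 + (1 + 2 * m\<^sup>2) / y\<^sup>2) * ((t - x)\<^sup>2 + y\<^sup>2)"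
  proof -
    have "(2 + (1 + 2 * m\<^sup>2) / y\<^sup>2) * ((t - x)\<^sup>2 + y\<^sup>2)
        = 2 * (t - x)\<^sup>2 + 2 * y\<^sup>2 + (1 + 2 * m\<^sup>2) / y\<^sup>2 * (t - x)\<^sup>2 + (1 + 2 * m\<^sup>2)"
      using assms by (simp add: field_simps)
    moreover have "0 \<le> (1 + 2 * m\<^sup>2) / y\<^sup>2 * (t - x)\<^sup>2" "0 \<le> y\<^sup>2" by simp_all
    ultimately show ?thesis by linarith
  qed
  finally have *: "1 + t\<^sup>2 \<le> (2 + (1 + 2 * m\<^sup>2) / y\<^sup>2) * ((t - x)\<^sup>2 + y\<^sup>2)" .
  have "0 < 1 + t\<^sup>2" "0 < (t - x)\<^sup>2 + y\<^sup>2" using assms by (simp_all add: add_pos_nonneg add_nonneg_pos)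
  then show ?thesis
    unfolding poisson_kernel_def using mult_left_mono[OF *, of y] assms
    by (subst frac_le_eq) (auto simp: divide_simps mult_ac)
qed

lemma has_derivative_arctan_poisson:
  assumes "y > 0"
  shows "((\<lambda>x. arctan ((x - t) / y)) has_real_derivative poisson_kernel x y t) (at x)"
proof -
  have "((\<lambda>x. arctan ((x - t) / y)) has_real_derivative (1 / y) * inverse (1 + ((x - t) / y)\<^sup>2)) (at x)"
    using assms by (auto intro!: derivative_eq_intros)
  also have "(1 / y) * inverse (1 + ((x - t) / y)\<^sup>2) = poisson_kernel x y t"
  proof -
    have "(t - x)\<^sup>2 + y\<^sup>2 > 0" using assms by (simp add: add_nonneg_pos)
    moreover have "1 + ((x - t) / y)\<^sup>2 = ((t - x)\<^sup>2 + y\<^sup>2) / y\<^sup>2"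
      using assms by (simp add: power_divide power2_commute[of x t] divide_simps)
    ultimately show ?thesis using assms by (simp add: poisson_kernel_def power2_eq_square)
  qed
  finally show ?thesis .
qed

lemma arctan_diff_poisson:
  assumes "y > 0" "a < b"
  obtains \<xi> where "a < \<xi>" "\<xi> < b"
    "arctan ((b - t) / y) - arctan ((a - t) / y) = (b - a) * poisson_kernel \<xi> y t"
  using MVT2[of a b "\<lambda>x. arctan ((x - t) / y)" "\<lambda>x. poisson_kernel x y t"] assms
    has_derivative_arctan_poisson by blast

text \<open>As a function of its centre the Poisson kernel has the primitive \<open>arctan ((x - t) / y)\<close>. On each cell
  the increment of the primitive is the kernel at an intermediate point, which the Lipschitz bound
  compares with the kernel at the left end; the total error is \<open>O(1 / n)\<close>.\<close>

lemma poisson_riemann_sum: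
  assumes "y > 0" "a < b"
  shows "(\<lambda>n. \<Sum>k<Suc n. (b - a) / Suc n * poisson_kernel (a + k * ((b - a) / Suc n)) y t)
    \<longlonglongrightarrow> arctan ((b - t) / y) - arctan ((a - t) / y)"
proof (rule Lim_transform2)
  let ?R = "\<lambda>n. \<Sum>k<Suc n. (b - a) / Suc n * poisson_kernel (a + k * ((b - a) / Suc n)) y t"
  let ?A = "arctan ((b - t) / y) - arctan ((a - t) / y)"
  show "(\<lambda>n. ?A) \<longlonglongrightarrow> ?A" by simp
  show "(\<lambda>n. ?A - ?R n) \<longlonglongrightarrow> 0"
  proof (rule Lim_null_comparison, intro always_eventually allI)
    show "(\<lambda>n. (b - a)\<^sup>2 / y\<^sup>2 * inverse (real (Suc n))) \<longlonglongrightarrow> 0"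
      using tendsto_mult_left[OF LIMSEQ_inverse_real_of_nat, of "(b - a)\<^sup>2 / y\<^sup>2"] by simp
    fix n
    define h where "h = (b - a) / Suc n"
    define x where "x k = a + real k * h" for k
    have h: "h > 0" using assms by (simp add: h_def)
    have xS: "x (Suc k) - x k = h" for k by (simp add: x_def algebra_simps)
    have step: "\<bar>arctan ((x (Suc k) - t) / y) - arctan ((x k - t) / y) - h * poisson_kernel (x k) y t\<bar>
        \<le> h * (h / y\<^sup>2)" for k
    proof -
      obtain \<xi> where \<xi>: "x k < \<xi>" "\<xi> < x (Suc k)"
        "arctan ((x (Suc k) - t) / y) - arctan ((x k - t) / y) = h * poisson_kernel \<xi> y t"
        using arctan_diff_poisson[OF assms(1), of "x k" "x (Suc k)" t] xS[of k] h by auto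
      have "\<bar>poisson_kernel \<xi> y t - poisson_kernel (x k) y t\<bar> \<le> \<bar>\<xi> - x k\<bar> / y\<^sup>2"
        by (rule poisson_kernel_lipschitz) fact
      also have "\<dots> \<le> h / y\<^sup>2" using \<xi> xS[of k] by (intro divide_right_mono) auto
      finally have "h * \<bar>poisson_kernel \<xi> y t - poisson_kernel (x k) y t\<bar> \<le> h * (h / y\<^sup>2)"
        using h by (intro mult_left_mono) auto
      moreover have "h * \<bar>poisson_kernel \<xi> y t - poisson_kernel (x k) y t\<bar>
          = \<bar>h * poisson_kernel \<xi> y t - h * poisson_kernel (x k) y t\<bar>"
        using h by (simp add: abs_mult flip: right_diff_distrib)
      ultimately show ?thesis using \<xi>(3) by simp
    qed
    have "?A = (\<Sum>k<Suc n. arctan ((x (Suc k) - t) / y) - arctan ((x k - t) / y))"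
      by (subst sum_lessThan_telescope) (simp add: x_def h_def)
    then have "?A - ?R n = (\<Sum>k<Suc n. arctan ((x (Suc k) - t) / y) - arctan ((x k - t) / y)
        - h * poisson_kernel (x k) y t)"
      by (simp only: sum_subtractf x_def h_def)
    then have "norm (?A - ?R n) \<le> (\<Sum>k<Suc n. h * (h / y\<^sup>2))"
      by (simp only: real_norm_def) (rule order_trans[OF sum_abs], rule sum_mono, rule step)
    also have "\<dots> = (b - a)\<^sup>2 / y\<^sup>2 * inverse (real (Suc n))"
      by (simp add: h_def power2_eq_square divide_simps)
    finally show "norm (?A - ?R n) \<le> (b - a)\<^sup>2 / y\<^sup>2 * inverse (real (Suc n))" .
  qed
qed

text \<open>A bound that is uniform in \<open>y\<close> and integrable with respect to every measure that integrates
  \<open>1 / (1 + t\<^sup>2)\<close>. Near \<open>[a, b]\<close> the difference is at most \<open>\<pi>\<close>; away from it, the kernel at the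
  intermediate point \<open>\<xi>\<close> is at most \<open>1 / (t - \<xi>)\<^sup>2\<close> as \<open>y \<le> 1\<close>.\<close>

lemma arctan_diff_bound:
  assumes "a < b"
  obtains C where "\<And>y t. 0 < y \<Longrightarrow> y \<le> 1 \<Longrightarrow>
    \<bar>arctan ((b - t) / y) - arctan ((a - t) / y)\<bar> \<le> C / (1 + t\<^sup>2)"
proof -
  define m where "m = max \<bar>a\<bar> \<bar>b\<bar>"
  define C where "C = pi * (1 + (m + 1)\<^sup>2) + (b - a) * (3 + 2 * m\<^sup>2)"
  have "\<bar>arctan ((b - t) / y) - arctan ((a - t) / y)\<bar> \<le> C / (1 + t\<^sup>2)" if y: "0 < y" "y \<le> 1" for y t
  proof (cases "\<bar>t\<bar> \<le> m + 1")
    case True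
    then have "t\<^sup>2 \<le> (m + 1)\<^sup>2" by (simp add: power2_le_iff_abs_le)
    then have "pi * (1 + t\<^sup>2) \<le> pi * (1 + (m + 1)\<^sup>2)" by simp
    also have "\<dots> \<le> C" using assms by (simp add: C_def)
    finally have "pi \<le> C / (1 + t\<^sup>2)" by (simp add: pos_le_divide_eq add_pos_nonneg)
    moreover have "\<bar>arctan ((b - t) / y) - arctan ((a - t) / y)\<bar> \<le> pi"
      using arctan_lbound[of "(b - t) / y"] arctan_ubound[of "(b - t) / y"]
        arctan_lbound[of "(a - t) / y"] arctan_ubound[of "(a - t) / y"] by linarith
    ultimately show ?thesis by linarith
  next
    case False
    obtain \<xi> where \<xi>: "a < \<xi>" "\<xi> < b"
      "arctan ((b - t) / y) - arctan ((a - t) / y) = (b - a) * poisson_kernel \<xi> y t"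
      using arctan_diff_poisson[OF y(1) assms] by blast
    have \<xi>m: "\<bar>\<xi>\<bar> \<le> m" using \<xi> by (auto simp: m_def)
    then have ge1: "1 \<le> (t - \<xi>)\<^sup>2" using False abs_le_square_iff[of 1 "t - \<xi>"] by auto
    have "1 + t\<^sup>2 \<le> 1 + 2 * m\<^sup>2 + 2 * (t - \<xi>)\<^sup>2"
    proof -
      have "\<xi>\<^sup>2 \<le> m\<^sup>2" using \<xi>m by (metis abs_le_square_iff abs_ge_self order_trans)
      then show ?thesis using one_plus_square_le[of t \<xi>] by linarith
    qed
    also have "\<dots> \<le> (3 + 2 * m\<^sup>2) * (t - \<xi>)\<^sup>2"
      using mult_left_mono[OF ge1, of "1 + 2 * m\<^sup>2"] by (simp add: algebra_simps)
    finally have *: "1 + t\<^sup>2 \<le> (3 + 2 * m\<^sup>2) * (t - \<xi>)\<^sup>2" .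
    have "poisson_kernel \<xi> y t \<le> 1 / (t - \<xi>)\<^sup>2"
      unfolding poisson_kernel_def using y ge1 by (intro frac_le) auto
    also have "\<dots> \<le> (3 + 2 * m\<^sup>2) / (1 + t\<^sup>2)"
    proof -
      have "1 / D \<le> K / E" if "E \<le> K * D" "1 \<le> D" "0 < E" for D E K :: real
        using that by (simp add: pos_le_divide_eq pos_divide_le_eq)
      from this[OF * ge1] show ?thesis by (simp add: add_pos_nonneg)
    qed
    finally have "(b - a) * poisson_kernel \<xi> y t \<le> (b - a) * ((3 + 2 * m\<^sup>2) / (1 + t\<^sup>2))"
      using assms by (intro mult_left_mono) auto
    also have "\<dots> \<le> C / (1 + t\<^sup>2)"
      unfolding times_divide_eq_right by (intro divide_right_mono) (auto simp: C_def)
    finally show ?thesis using \<xi>(3) poisson_kernel_nonneg[OF y(1), of \<xi> t] assms by simp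
  qed
  then show ?thesis by (rule that)
qed

lemma arctan_scaled_tendsto:
  "(\<lambda>n. arctan (c / inverse (real (Suc n)))) \<longlonglongrightarrow> pi / 2 * sgn c"
proof -
  have *: "filterlim (\<lambda>n. real (Suc n)) at_top sequentially"
    using filterlim_real_sequentially filterlim_sequentially_Suc by blast
  consider "c > 0" | "c = 0" | "c < 0" by linarith
  then show ?thesis
  proof cases
    case 1
    then have "filterlim (\<lambda>n. c * real (Suc n)) at_top sequentially"
      using * by (rule filterlim_tendsto_pos_mult_at_top[OF tendsto_const])
    from filterlim_compose[OF tendsto_arctan_at_top this] 1 show ?thesis
      by (simp add: field_simps)
  next
    case 3
    then have "filterlim (\<lambda>n. c * real (Suc n)) at_bot sequentially"
      using * by (intro filterlim_tendsto_neg_mult_at_bot[OF tendsto_const])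
    from filterlim_compose[OF tendsto_arctan_at_bot this] 3 show ?thesis
      by (simp add: field_simps)
  qed simp
qed

text \<open>Approaching \<open>b\<close> from the right turns the symmetric value \<open>0\<close> of the sign at the jump into the value
  that belongs to a closed right end.\<close>

lemma indicator_sgn_tendsto:
  "(\<lambda>n. sgn (b + inverse (real (Suc n)) - t)) \<longlonglongrightarrow> 2 * indicator {..b} t - 1" for b t :: real
proof (cases "t \<le> b")
  case True
  then have "sgn (b + inverse (real (Suc n)) - t) = 1" for n
    by (intro sgn_1_pos[THEN iffD2]) (smt (verit) inverse_positive_iff_positive of_nat_0_less_iff zero_less_Suc)
  then show ?thesis using True by simp
next
  case False
  have "eventually (\<lambda>n. inverse (real (Suc n)) < t - b) sequentially"
    using LIMSEQ_inverse_real_of_nat by (rule order_tendstoD) (use False in simp)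
  then have "eventually (\<lambda>n. sgn (b + inverse (real (Suc n)) - t) = -1) sequentially"
    by eventually_elim (simp add: sgn_if)
  then show ?thesis using False by (simp add: tendsto_eventually)
qed

text \<open>Stieltjes inversion, in a form that serves both a density statement and an identification of
  measures. Riemann sums over the centre put \<open>arctan ((b - t) / y) - arctan ((a - t) / y)\<close> into the
  class; for \<open>y \<rightarrow> 0\<close> this tends to a combination of signs that is the indicator of the interval up to
  its value at the end points, and shifting the end points repairs the latter.\<close>

proposition poisson_class_contains_intervals:
  fixes V :: "(real \<Rightarrow> real) set"
  assumes poisson: "\<And>x y. y > 0 \<Longrightarrow> poisson_kernel x y \<in> V"
    and add: "\<And>f g. f \<in> V \<Longrightarrow> g \<in> V \<Longrightarrow> (\<lambda>t. f t + g t) \<in> V"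
    and scale: "\<And>c f. f \<in> V \<Longrightarrow> (\<lambda>t. c * f t) \<in> V"
    and lim: "\<And>f h C. (\<And>n. f n \<in> V) \<Longrightarrow> (\<And>n t. \<bar>f n t\<bar> \<le> C / (1 + t\<^sup>2)) \<Longrightarrow>
      (\<And>t. (\<lambda>n. f n t) \<longlonglongrightarrow> h t) \<Longrightarrow> h \<in> V"
    and "a < b"
  shows "indicator {a<..b} \<in> V"
proof -
  have zero: "(\<lambda>t. 0) \<in> V" using scale[OF poisson[of 1 0], of 0] by simp
  have sum: "(\<lambda>t. \<Sum>i<n. f i t) \<in> V" if "\<And>i. f i \<in> V" for f and n :: nat
    by (induction n) (auto intro!: zero add that)
  have arctan_in: "(\<lambda>t. arctan ((b - t) / y) - arctan ((a - t) / y)) \<in> V" if "y > 0" "a < b" for y a b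
  proof -
    define m where "m = max \<bar>a\<bar> \<bar>b\<bar>"
    define K where "K = y * (2 + (1 + 2 * m\<^sup>2) / y\<^sup>2)"
    define R where "R n t = (\<Sum>k<Suc n. (b - a) / Suc n * poisson_kernel (a + k * ((b - a) / Suc n)) y t)" for n t
    show ?thesis
    proof (rule lim[where f = R])
      show "R n \<in> V" for n unfolding R_def by (intro sum scale poisson that)
      show "(\<lambda>n. R n t) \<longlonglongrightarrow> arctan ((b - t) / y) - arctan ((a - t) / y)" for t
        unfolding R_def by (rule poisson_riemann_sum[OF that])
      show "\<bar>R n t\<bar> \<le> (b - a) * K / (1 + t\<^sup>2)" for n t
      proof -
        have "poisson_kernel (a + k * ((b - a) / Suc n)) y t \<le> K / (1 + t\<^sup>2)" if "k < Suc n" for k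
        proof -
          have "real k * ((b - a) / Suc n) \<le> Suc n * ((b - a) / Suc n)"
            using that \<open>a < b\<close> by (intro mult_right_mono) auto
          then have "a + k * ((b - a) / Suc n) \<le> b" by simp
          moreover have "a \<le> a + k * ((b - a) / Suc n)" using \<open>a < b\<close> by simp
          ultimately have "\<bar>a + k * ((b - a) / Suc n)\<bar> \<le> m" unfolding m_def by linarith
          then show ?thesis unfolding K_def using poisson_kernel_le[OF \<open>y > 0\<close>] by blast
        qed
        then have "R n t \<le> (\<Sum>k<Suc n. (b - a) / Suc n * (K / (1 + t\<^sup>2)))"
          unfolding R_def using \<open>a < b\<close> by (intro sum_mono mult_left_mono) auto
        also have "\<dots> = (b - a) * K / (1 + t\<^sup>2)" by simp
        finally have "R n t \<le> (b - a) * K / (1 + t\<^sup>2)" .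
        moreover have "0 \<le> R n t"
          unfolding R_def using that by (intro sum_nonneg mult_nonneg_nonneg poisson_kernel_nonneg) auto
        ultimately show ?thesis by simp
      qed
    qed
  qed
  have sgn_in: "(\<lambda>t. pi / 2 * sgn (b - t) - pi / 2 * sgn (a - t)) \<in> V" if "a < b" for a b :: real
  proof -
    obtain C where C: "\<And>y t. 0 < y \<Longrightarrow> y \<le> 1 \<Longrightarrow>
        \<bar>arctan ((b - t) / y) - arctan ((a - t) / y)\<bar> \<le> C / (1 + t\<^sup>2)"
      using arctan_diff_bound[OF \<open>a < b\<close>] by blast
    show ?thesis
    proof (rule lim[where f = "\<lambda>n t. arctan ((b - t) / inverse (real (Suc n)))
          - arctan ((a - t) / inverse (real (Suc n)))" and C = C])
      show "(\<lambda>t. arctan ((b - t) / inverse (real (Suc n))) - arctan ((a - t) / inverse (real (Suc n)))) \<in> V" for n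
        by (rule arctan_in) (use that in auto)
      show "\<bar>arctan ((b - t) / inverse (real (Suc n))) - arctan ((a - t) / inverse (real (Suc n)))\<bar> \<le> C / (1 + t\<^sup>2)" for n t
        by (rule C) (auto simp: divide_simps)
      show "(\<lambda>n. arctan ((b - t) / inverse (real (Suc n))) - arctan ((a - t) / inverse (real (Suc n))))
          \<longlonglongrightarrow> pi / 2 * sgn (b - t) - pi / 2 * sgn (a - t)" for t
        by (intro tendsto_diff arctan_scaled_tendsto)
    qed
  qed
  let ?e = "\<lambda>n. inverse (real (Suc n))"
  have "(\<lambda>t. pi * indicator {a<..b} t) \<in> V"
  proof (rule lim[where f = "\<lambda>n t. pi / 2 * sgn (b + ?e n - t) - pi / 2 * sgn (a + ?e n - t)"])
    show "(\<lambda>t. pi / 2 * sgn (b + ?e n - t) - pi / 2 * sgn (a + ?e n - t)) \<in> V" for n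
      by (rule sgn_in) (use \<open>a < b\<close> in auto)
    show "(\<lambda>n. pi / 2 * sgn (b + ?e n - t) - pi / 2 * sgn (a + ?e n - t)) \<longlonglongrightarrow> pi * indicator {a<..b} t" for t
    proof -
      have "(\<lambda>n. pi / 2 * sgn (b + ?e n - t) - pi / 2 * sgn (a + ?e n - t))
          \<longlonglongrightarrow> pi / 2 * (2 * indicator {..b} t - 1) - pi / 2 * (2 * indicator {..a} t - 1)"
        by (intro tendsto_diff tendsto_mult_left indicator_sgn_tendsto)
      also have "pi / 2 * (2 * indicator {..b} t - 1) - pi / 2 * (2 * indicator {..a} t - 1) = pi * indicator {a<..b} t"
        using \<open>a < b\<close> by (auto simp: indicator_def)
      finally show ?thesis .
    qed
    show "\<bar>pi / 2 * sgn (b + ?e n - t) - pi / 2 * sgn (a + ?e n - t)\<bar>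
        \<le> pi * (1 + (max \<bar>a\<bar> \<bar>b + 1\<bar>)\<^sup>2) / (1 + t\<^sup>2)" for n t
    proof (cases "t \<in> {a..b + 1}")
      case True
      then have "\<bar>t\<bar> \<le> max \<bar>a\<bar> \<bar>b + 1\<bar>" by auto
      then have "t\<^sup>2 \<le> (max \<bar>a\<bar> \<bar>b + 1\<bar>)\<^sup>2" by (subst power2_le_iff_abs_le) auto
      then have "pi * (1 + t\<^sup>2) \<le> pi * (1 + (max \<bar>a\<bar> \<bar>b + 1\<bar>)\<^sup>2)" by simp
      then have "pi \<le> pi * (1 + (max \<bar>a\<bar> \<bar>b + 1\<bar>)\<^sup>2) / (1 + t\<^sup>2)"
        by (simp add: pos_le_divide_eq add_pos_nonneg)
      moreover have "\<bar>pi / 2 * sgn (b + ?e n - t) - pi / 2 * sgn (a + ?e n - t)\<bar> \<le> pi"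
        by (auto simp: sgn_if)
      ultimately show ?thesis by linarith
    next
      case False
      have "sgn (b + e - t) = sgn (a + e - t)" if "0 < e" "e \<le> 1" for e
        using that False \<open>a < b\<close> by (auto simp: sgn_if)
      from this[of "?e n"] have "sgn (b + ?e n - t) = sgn (a + ?e n - t)"
        by (simp add: divide_simps)
      then show ?thesis by simp
    qed
  qed
  from scale[OF this, of "1 / pi"] show ?thesis by simp
qed

section \<open>The Cauchy kernel\<close>

definition cauchy_kernel :: "complex \<Rightarrow> real \<Rightarrow> complex" where
  "cauchy_kernel z t = 1 / (of_real t - z)"

lemma cauchy_kernel_measurable [measurable]: "cauchy_kernel z \<in> borel_measurable borel"
  unfolding cauchy_kernel_def by measurable

lemma nonreal_diff_nonzero: "Im z \<noteq> 0 \<Longrightarrow> complex_of_real t - z \<noteq> 0"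
  by (auto simp: complex_eq_iff)

lemma cnj_cauchy_kernel: "cnj (cauchy_kernel z t) = cauchy_kernel (cnj z) t"
  by (simp add: cauchy_kernel_def)

lemma cauchy_kernel_mult: "Im z \<noteq> 0 \<Longrightarrow> (of_real t - z) * cauchy_kernel z t = 1"
  using nonreal_diff_nonzero[of z t] by (simp add: cauchy_kernel_def)

lemma cauchy_kernel_eqI: "Im z \<noteq> 0 \<Longrightarrow> (of_real t - z) * a = b \<Longrightarrow> a = cauchy_kernel z t * b"
  using nonreal_diff_nonzero[of z t] by (auto simp: cauchy_kernel_def)

lemma cauchy_kernel_eq_iff: "Im z \<noteq> 0 \<Longrightarrow> cauchy_kernel z t * a = cauchy_kernel z t * b \<longleftrightarrow> a = b"
  using nonreal_diff_nonzero[of z t] by (auto simp: cauchy_kernel_def)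

lemma cauchy_kernel_resolvent:
  assumes "Im z \<noteq> 0" "Im w \<noteq> 0"
  shows "cauchy_kernel z t - cauchy_kernel w t = (z - w) * (cauchy_kernel w t * cauchy_kernel z t)"
  using nonreal_diff_nonzero[OF assms(1), of t] nonreal_diff_nonzero[OF assms(2), of t]
  by (simp add: cauchy_kernel_def field_simps)

lemma cauchy_kernel_bounded:
  assumes "Im z \<noteq> 0"
  shows "cmod (cauchy_kernel z t) \<le> 1 / \<bar>Im z\<bar>"
proof -
  have "\<bar>Im z\<bar> \<le> cmod (of_real t - z)" using abs_Im_le_cmod[of "of_real t - z"] by simp
  then show ?thesis using assms by (simp add: cauchy_kernel_def norm_divide frac_le)
qed

lemma cauchy_kernel_compare:
  assumes "Im z \<noteq> 0" "Im w \<noteq> 0"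
  shows "cmod (cauchy_kernel z t) \<le> (1 + cmod (z - w) / \<bar>Im z\<bar>) * cmod (cauchy_kernel w t)"
proof -
  have "cauchy_kernel z t = cauchy_kernel w t + (z - w) * (cauchy_kernel w t * cauchy_kernel z t)"
    using cauchy_kernel_resolvent[OF assms, of t] by (simp add: algebra_simps)
  then have "cmod (cauchy_kernel z t) \<le> cmod (cauchy_kernel w t)
      + cmod (z - w) * (cmod (cauchy_kernel w t) * cmod (cauchy_kernel z t))"
    using norm_triangle_ineq[of "cauchy_kernel w t" "(z - w) * (cauchy_kernel w t * cauchy_kernel z t)"]
    by (simp add: norm_mult)
  also have "\<dots> \<le> cmod (cauchy_kernel w t) + cmod (z - w) * (cmod (cauchy_kernel w t) * (1 / \<bar>Im z\<bar>))"
    by (intro add_left_mono mult_left_mono cauchy_kernel_bounded assms) auto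
  finally show ?thesis by (simp add: algebra_simps)
qed

lemma cauchy_kernel_i: "cauchy_kernel \<i> t = (of_real t + \<i>) / of_real (1 + t\<^sup>2)"
proof -
  have "(of_real t - \<i>) * (of_real t + \<i>) = complex_of_real (1 + t\<^sup>2)"
    by (simp add: algebra_simps power2_eq_square)
  moreover have "complex_of_real (1 + t\<^sup>2) \<noteq> 0"
    unfolding of_real_eq_0_iff by (smt (verit) zero_le_power2)
  moreover have "complex_of_real t - \<i> \<noteq> 0" by (rule nonreal_diff_nonzero) simp
  ultimately show ?thesis unfolding cauchy_kernel_def by (subst frac_eq_eq) (auto simp: mult.commute)
qed

lemma cmod_cauchy_kernel_i: "(cmod (cauchy_kernel \<i> t))\<^sup>2 = 1 / (1 + t\<^sup>2)"
  by (simp add: cauchy_kernel_def norm_divide power_divide cmod_power2 add.commute)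

lemma Im_cauchy_kernel: "y > 0 \<Longrightarrow> Im (cauchy_kernel (Complex x y) t) = poisson_kernel x y t"
  by (simp add: cauchy_kernel_def poisson_kernel_def Im_divide)

section \<open>Operators in the Hilbert space of a measure\<close>

lemma L2_pair_cases:
  assumes "T \<subseteq> vecs (L2_space M) \<times> vecs (L2_space M)" "(F, G) \<in> T"
  obtains f g where "f \<in> square_integrable M" "g \<in> square_integrable M"
    "F = L2_class M f" "G = L2_class M g"
proof -
  have "F \<in> vecs (L2_space M)" "G \<in> vecs (L2_space M)" using assms by auto
  then show ?thesis using that by (auto simp: vecs_L2)
qed

lemma adjoint_op_L2_iff:
  assumes "T \<subseteq> vecs (L2_space M) \<times> vecs (L2_space M)"
    and "y \<in> square_integrable M" "w \<in> square_integrable M"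
  shows "(L2_class M y, L2_class M w) \<in> adjoint_op (L2_space M) T \<longleftrightarrow>
    (\<forall>f\<in>square_integrable M. \<forall>g\<in>square_integrable M. (L2_class M f, L2_class M g) \<in> T \<longrightarrow>
      l2_inner M g y = l2_inner M f w)"
proof
  assume "(L2_class M y, L2_class M w) \<in> adjoint_op (L2_space M) T"
  then show "\<forall>f\<in>square_integrable M. \<forall>g\<in>square_integrable M. (L2_class M f, L2_class M g) \<in> T \<longrightarrow>
      l2_inner M g y = l2_inner M f w"
    using assms(2,3) by (fastforce simp: adjoint_op_def vinner_L2)
next
  assume *: "\<forall>f\<in>square_integrable M. \<forall>g\<in>square_integrable M. (L2_class M f, L2_class M g) \<in> T \<longrightarrow>
      l2_inner M g y = l2_inner M f w"
  have "vinner (L2_space M) G (L2_class M y) = vinner (L2_space M) F (L2_class M w)" if FG: "(F, G) \<in> T" for F G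
  proof -
    obtain f g where fg: "f \<in> square_integrable M" "g \<in> square_integrable M"
      "F = L2_class M f" "G = L2_class M g" by (rule L2_pair_cases[OF assms(1) FG])
    then have "l2_inner M g y = l2_inner M f w" using * FG by blast
    then show ?thesis using fg assms(2,3) by (simp add: vinner_L2)
  qed
  then show "(L2_class M y, L2_class M w) \<in> adjoint_op (L2_space M) T"
    using assms(2,3) by (auto simp: adjoint_op_def)
qed

lemma adjoint_op_subset: "adjoint_op X T \<subseteq> vecs X \<times> vecs X"
  by (auto simp: adjoint_op_def)

lemma linear_operator_subset: "linear_operator X T \<Longrightarrow> T \<subseteq> vecs X \<times> vecs X"
  by (simp add: linear_operator_def)

text \<open>For an operator described by a property \<open>Q\<close> of representatives. Single-valuedness is only needed at
  \<open>0\<close>: subtract two pairs with the same first component.\<close>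

lemma linear_operator_L2I:
  assumes sub: "T \<subseteq> vecs (L2_space M) \<times> vecs (L2_space M)"
    and Q: "\<And>f g. f \<in> square_integrable M \<Longrightarrow> g \<in> square_integrable M \<Longrightarrow>
      (L2_class M f, L2_class M g) \<in> T \<longleftrightarrow> Q f g"
    and zero: "Q (\<lambda>t. 0) (\<lambda>t. 0)"
    and add: "\<And>f g f' g'. f \<in> square_integrable M \<Longrightarrow> g \<in> square_integrable M \<Longrightarrow>
      f' \<in> square_integrable M \<Longrightarrow> g' \<in> square_integrable M \<Longrightarrow> Q f g \<Longrightarrow> Q f' g' \<Longrightarrow>
      Q (\<lambda>t. f t + f' t) (\<lambda>t. g t + g' t)"
    and scale: "\<And>c f g. f \<in> square_integrable M \<Longrightarrow> g \<in> square_integrable M \<Longrightarrow> Q f g \<Longrightarrow>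
      Q (\<lambda>t. c * f t) (\<lambda>t. c * g t)"
    and null: "\<And>f g. f \<in> square_integrable M \<Longrightarrow> g \<in> square_integrable M \<Longrightarrow> Q f g \<Longrightarrow>
      AE t in M. f t = 0 \<Longrightarrow> AE t in M. g t = 0"
  shows "linear_operator (L2_space M) T"
  unfolding linear_operator_def
proof (intro conjI)
  let ?X = "L2_space M" and ?S = "square_integrable M" and ?c = "L2_class M"
  show "T \<subseteq> vecs ?X \<times> vecs ?X" by fact
  show "(vzero ?X, vzero ?X) \<in> T" using Q zero by (simp add: vzero_L2)
  have addT: "(vadd ?X x y, vadd ?X u v) \<in> T" if xu: "(x, u) \<in> T" and yv: "(y, v) \<in> T" for x u y v
  proof -
    obtain f g where fg: "f \<in> ?S" "g \<in> ?S" "x = ?c f" "u = ?c g" by (rule L2_pair_cases[OF sub xu])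
    obtain f' g' where fg': "f' \<in> ?S" "g' \<in> ?S" "y = ?c f'" "v = ?c g'" by (rule L2_pair_cases[OF sub yv])
    have "Q f g" "Q f' g'" using Q[OF fg(1,2)] Q[OF fg'(1,2)] fg fg' xu yv by simp_all
    from add[OF fg(1,2) fg'(1,2) this] show ?thesis using fg fg' by (simp add: Q vadd_L2)
  qed
  then show "\<forall>(x, u)\<in>T. \<forall>(y, v)\<in>T. (vadd ?X x y, vadd ?X u v) \<in> T" by blast
  have scaleT: "(vscale ?X c x, vscale ?X c u) \<in> T" if xu: "(x, u) \<in> T" for x u c
  proof -
    obtain f g where fg: "f \<in> ?S" "g \<in> ?S" "x = ?c f" "u = ?c g" by (rule L2_pair_cases[OF sub xu])
    have "Q f g" using Q[OF fg(1,2)] fg xu by simp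
    from scale[OF fg(1,2) this] show ?thesis using fg by (simp add: Q vscale_L2)
  qed
  then show "\<forall>c. \<forall>(x, u)\<in>T. (vscale ?X c x, vscale ?X c u) \<in> T" by blast
  show "single_valued T"
  proof (rule single_valuedI)
    fix x u v assume xu: "(x, u) \<in> T" and xv: "(x, v) \<in> T"
    obtain f g where fg: "f \<in> ?S" "g \<in> ?S" "x = ?c f" "u = ?c g" by (rule L2_pair_cases[OF sub xu])
    obtain f' g' where fg': "f' \<in> ?S" "g' \<in> ?S" "x = ?c f'" "v = ?c g'" by (rule L2_pair_cases[OF sub xv])
    have "Q f g" using Q[OF fg(1,2)] fg xu by simp
    moreover have "Q f g'" using Q[OF fg(1) fg'(2)] fg fg' xv by simp
    then have "Q (\<lambda>t. - 1 * f t) (\<lambda>t. - 1 * g' t)" by (rule scale[OF fg(1) fg'(2)])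
    note neg = square_integrable_scale[OF fg(1), of "- 1"] square_integrable_scale[OF fg'(2), of "- 1"]
    have "Q (\<lambda>t. f t + - 1 * f t) (\<lambda>t. g t + - 1 * g' t)"
      by (rule add[OF fg(1,2) neg]) fact+
    then have "AE t in M. g t + - 1 * g' t = 0"
      by (rule null[OF square_integrable_add[OF fg(1) neg(1)] square_integrable_add[OF fg(2) neg(2)]]) simp
    then have "AE t in M. g t = g' t" by eventually_elim simp
    then show "u = v" using fg fg' by (simp add: L2_class_eq_iff)
  qed
qed

lemma shift_op_iff:
  "(x, v) \<in> shift_op X T z \<longleftrightarrow> (\<exists>u. (x, u) \<in> T \<and> v = vdiff X u (vscale X z x))"
  by (force simp: shift_op_def)

lemma eigenvalues_L2_iff:
  assumes "T \<subseteq> vecs (L2_space M) \<times> vecs (L2_space M)"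
  shows "z \<in> eigenvalues (L2_space M) T \<longleftrightarrow>
    (\<exists>f\<in>square_integrable M. \<not> (AE t in M. f t = 0) \<and> (L2_class M f, L2_class M (\<lambda>t. z * f t)) \<in> T)"
proof
  assume "z \<in> eigenvalues (L2_space M) T"
  then obtain x u where xu: "(x, u) \<in> T" "x \<noteq> vzero (L2_space M)"
    "vdiff (L2_space M) u (vscale (L2_space M) z x) = vzero (L2_space M)"
    by (auto simp: eigenvalues_def kernel_op_def shift_op_def)
  obtain f g where fg: "f \<in> square_integrable M" "g \<in> square_integrable M"
    "x = L2_class M f" "u = L2_class M g" by (rule L2_pair_cases[OF assms xu(1)])
  have "AE t in M. g t - z * f t = 0" using xu(3) fg by (simp add: L2_ops L2_class_eq_iff)
  then have "L2_class M g = L2_class M (\<lambda>t. z * f t)"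
    using fg by (simp add: L2_class_eq_iff)
  then show "\<exists>f\<in>square_integrable M. \<not> (AE t in M. f t = 0) \<and> (L2_class M f, L2_class M (\<lambda>t. z * f t)) \<in> T"
    using xu(1,2) fg by (intro bexI[of _ f]) (auto simp: vzero_L2 L2_class_eq_iff[of f])
next
  assume "\<exists>f\<in>square_integrable M. \<not> (AE t in M. f t = 0) \<and> (L2_class M f, L2_class M (\<lambda>t. z * f t)) \<in> T"
  then obtain f where f: "f \<in> square_integrable M" "\<not> (AE t in M. f t = 0)"
    "(L2_class M f, L2_class M (\<lambda>t. z * f t)) \<in> T" by blast
  have "vdiff (L2_space M) (L2_class M (\<lambda>t. z * f t)) (vscale (L2_space M) z (L2_class M f)) = vzero (L2_space M)"
    using f by (simp add: L2_ops)
  then have "(L2_class M f, vzero (L2_space M)) \<in> shift_op (L2_space M) T z"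
    using f(3) shift_op_iff by metis
  moreover have "L2_class M f \<noteq> vzero (L2_space M)" using f by (simp add: vzero_L2 L2_class_eq_iff)
  ultimately show "z \<in> eigenvalues (L2_space M) T"
    by (auto simp: eigenvalues_def kernel_op_def)
qed

lemma shift_op_L2_iff:
  assumes "T \<subseteq> vecs (L2_space M) \<times> vecs (L2_space M)"
    and f: "f \<in> square_integrable M" and g: "g \<in> square_integrable M"
  shows "(L2_class M f, L2_class M g) \<in> shift_op (L2_space M) T z \<longleftrightarrow>
    (L2_class M f, L2_class M (\<lambda>t. g t + z * f t)) \<in> T"
proof
  assume "(L2_class M f, L2_class M g) \<in> shift_op (L2_space M) T z"
  then obtain u where u: "(L2_class M f, u) \<in> T"
    "L2_class M g = vdiff (L2_space M) u (vscale (L2_space M) z (L2_class M f))"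
    by (auto simp: shift_op_def)
  obtain h where h: "h \<in> square_integrable M" "u = L2_class M h"
    using assms(1) u(1) vecs_L2E by blast
  have "AE t in M. g t = h t - z * f t" using u h f g by (simp add: L2_ops L2_class_eq_iff)
  then have "AE t in M. h t = g t + z * f t" by eventually_elim simp
  then have "u = L2_class M (\<lambda>t. g t + z * f t)" using h f g by (simp add: L2_class_eq_iff)
  then show "(L2_class M f, L2_class M (\<lambda>t. g t + z * f t)) \<in> T" using u(1) by simp
next
  assume *: "(L2_class M f, L2_class M (\<lambda>t. g t + z * f t)) \<in> T"
  have "vdiff (L2_space M) (L2_class M (\<lambda>t. g t + z * f t)) (vscale (L2_space M) z (L2_class M f)) = L2_class M g"
    using f g by (simp add: L2_ops)
  then show "(L2_class M f, L2_class M g) \<in> shift_op (L2_space M) T z"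
    using * shift_op_iff by metis
qed

lemma shift_op_L2_subset:
  assumes "T \<subseteq> vecs (L2_space M) \<times> vecs (L2_space M)"
  shows "shift_op (L2_space M) T z \<subseteq> vecs (L2_space M) \<times> vecs (L2_space M)"
proof
  fix p assume "p \<in> shift_op (L2_space M) T z"
  then obtain x u where xu: "(x, u) \<in> T" "p = (x, vdiff (L2_space M) u (vscale (L2_space M) z x))"
    by (auto simp: shift_op_def)
  show "p \<in> vecs (L2_space M) \<times> vecs (L2_space M)"
    by (rule L2_pair_cases[OF assms xu(1)]) (simp add: xu(2) L2_ops)
qed

text \<open>A bounded inverse of \<open>T - z\<close> maps \<open>(w - z) f\<close> back to \<open>f\<close> for every eigenvector \<open>f\<close> at \<open>w\<close>.\<close>

lemma spectrum_near_eigenvalues: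
  assumes T: "T \<subseteq> vecs (L2_space M) \<times> vecs (L2_space M)"
    and near: "\<And>e. e > 0 \<Longrightarrow> \<exists>w\<in>eigenvalues (L2_space M) T. cmod (w - z) < e"
  shows "z \<in> op_spectrum (L2_space M) T"
proof (rule ccontr)
  assume "z \<notin> op_spectrum (L2_space M) T"
  then obtain C where C: "\<forall>(x, u)\<in>(shift_op (L2_space M) T z)\<inverse>.
      vnorm (L2_space M) u \<le> C * vnorm (L2_space M) x"
    unfolding op_spectrum_def resolvent_set_def bounded_everywhere_defined_def by blast
  define D where "D = \<bar>C\<bar> + 1"
  have "1 / D > 0" by (simp add: D_def add_nonneg_pos)
  then obtain w where w: "w \<in> eigenvalues (L2_space M) T" "cmod (w - z) < 1 / D"
    using near by blast
  obtain f where f: "f \<in> square_integrable M" "\<not> (AE t in M. f t = 0)"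
    "(L2_class M f, L2_class M (\<lambda>t. w * f t)) \<in> T"
    using w(1) by (auto simp: eigenvalues_L2_iff[OF T])
  have "(L2_class M f, L2_class M (\<lambda>t. (w - z) * f t)) \<in> shift_op (L2_space M) T z"
    using f by (simp add: shift_op_L2_iff[OF T] left_diff_distrib)
  with C have "vnorm (L2_space M) (L2_class M f) \<le> C * vnorm (L2_space M) (L2_class M (\<lambda>t. (w - z) * f t))"
    by blast
  then have "l2_norm M f \<le> C * (cmod (w - z) * l2_norm M f)"
    using f(1) by (simp add: vnorm_L2 l2_norm_scale)
  also have "\<dots> \<le> D * (cmod (w - z) * l2_norm M f)"
    by (intro mult_right_mono) (auto simp: D_def)
  finally have "1 * l2_norm M f \<le> (D * cmod (w - z)) * l2_norm M f" by (simp add: mult.assoc)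
  moreover have "D * cmod (w - z) < 1" using w(2) \<open>1 / D > 0\<close> by (simp add: pos_less_divide_eq mult.commute)
  moreover have "l2_norm M f > 0" using f by (simp add: l2_norm_eq_0_iff less_le)
  ultimately show False by (metis linorder_not_le mult_less_cancel_right_pos)
qed

lemma adjoint_op_L2_limit:
  assumes T: "T \<subseteq> vecs (L2_space M) \<times> vecs (L2_space M)"
    and f: "\<And>n. f n \<in> square_integrable M" and g: "\<And>n. g n \<in> square_integrable M"
    and y: "y \<in> square_integrable M" and w: "w \<in> square_integrable M"
    and adj: "\<And>n. (L2_class M (f n), L2_class M (g n)) \<in> adjoint_op (L2_space M) T"
    and lim: "(\<lambda>n. l2_norm M (\<lambda>t. f n t - y t)) \<longlonglongrightarrow> 0" "(\<lambda>n. l2_norm M (\<lambda>t. g n t - w t)) \<longlonglongrightarrow> 0"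
  shows "(L2_class M y, L2_class M w) \<in> adjoint_op (L2_space M) T"
  unfolding adjoint_op_L2_iff[OF T y w]
proof (intro ballI impI)
  fix a b assume ab: "a \<in> square_integrable M" "b \<in> square_integrable M" "(L2_class M a, L2_class M b) \<in> T"
  have "l2_inner M b (f n) = l2_inner M a (g n)" for n
    using adj[of n] ab unfolding adjoint_op_L2_iff[OF T f g] by blast
  moreover have "(\<lambda>n. l2_inner M b (f n)) \<longlonglongrightarrow> l2_inner M b y"
    by (rule l2_inner_tendsto[OF ab(2) f y lim(1)])
  moreover have "(\<lambda>n. l2_inner M a (g n)) \<longlonglongrightarrow> l2_inner M a w"
    by (rule l2_inner_tendsto[OF ab(1) g w lim(2)])
  ultimately show "l2_inner M b y = l2_inner M a w" by (simp add: LIMSEQ_unique)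
qed

lemma closed_operator_L2I:
  assumes lin: "linear_operator (L2_space M) T"
    and closed: "\<And>f g y w. (\<And>n. f n \<in> square_integrable M) \<Longrightarrow> (\<And>n. g n \<in> square_integrable M) \<Longrightarrow>
      y \<in> square_integrable M \<Longrightarrow> w \<in> square_integrable M \<Longrightarrow>
      (\<And>n. (L2_class M (f n), L2_class M (g n)) \<in> T) \<Longrightarrow>
      (\<lambda>n. l2_norm M (\<lambda>t. f n t - y t)) \<longlonglongrightarrow> 0 \<Longrightarrow> (\<lambda>n. l2_norm M (\<lambda>t. g n t - w t)) \<longlonglongrightarrow> 0 \<Longrightarrow>
      (L2_class M y, L2_class M w) \<in> T"
  shows "closed_operator (L2_space M) T"
  unfolding closed_operator_def
proof (intro conjI lin allI ballI impI)
  fix F G x u assume x: "x \<in> vecs (L2_space M)" and u: "u \<in> vecs (L2_space M)"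
    and a: "(\<forall>n. (F n, G n) \<in> T) \<and> vtendsto (L2_space M) F x \<and> vtendsto (L2_space M) G u"
  note T = linear_operator_subset[OF lin]
  obtain y where y: "y \<in> square_integrable M" "x = L2_class M y" using x by (rule vecs_L2E)
  obtain w where w: "w \<in> square_integrable M" "u = L2_class M w" using u by (rule vecs_L2E)
  have "\<forall>n. \<exists>f g. f \<in> square_integrable M \<and> g \<in> square_integrable M \<and> F n = L2_class M f \<and> G n = L2_class M g"
    using a L2_pair_cases[OF T] by metis
  then obtain f g where fg: "\<And>n. f n \<in> square_integrable M" "\<And>n. g n \<in> square_integrable M"
    "\<And>n. F n = L2_class M (f n)" "\<And>n. G n = L2_class M (g n)" by metis
  have F: "F = (\<lambda>n. L2_class M (f n))" "G = (\<lambda>n. L2_class M (g n))" using fg by auto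
  have "(\<lambda>n. l2_norm M (\<lambda>t. f n t - y t)) \<longlonglongrightarrow> 0" "(\<lambda>n. l2_norm M (\<lambda>t. g n t - w t)) \<longlonglongrightarrow> 0"
    using a unfolding F y(2) w(2) by (simp_all add: vtendsto_L2 fg(1,2) y(1) w(1))
  then show "(x, u) \<in> T" unfolding y(2) w(2)
    using a by (intro closed[OF fg(1) fg(2) y(1) w(1)]) (auto simp: F)
qed

section \<open>The multiplication operator and its restriction\<close>

locale normalized_measure =
  fixes \<omega> :: "real measure"
  assumes sets_\<omega> [measurable_cong, simp]: "sets \<omega> = sets borel"
    and normalized: "(\<integral>\<^sup>+ t. ennreal (1 / (1 + t\<^sup>2)) \<partial>\<omega>) = 1"
    and infinite: "(\<integral>\<^sup>+ t. 1 \<partial>\<omega>) = \<infinity>"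
begin

abbreviation "L2 \<equiv> square_integrable \<omega>"
abbreviation "cls \<equiv> L2_class \<omega>"
abbreviation "X \<equiv> L2_space \<omega>"
abbreviation "ip \<equiv> l2_inner \<omega>"

lemma space_\<omega> [simp]: "space \<omega> = UNIV"
  using sets_eq_imp_space_eq[OF sets_\<omega>] by simp

lemma has_integral_weight: "has_bochner_integral \<omega> (\<lambda>t. 1 / (1 + t\<^sup>2)) 1"
  by (rule has_bochner_integral_nn_integral) (auto simp: normalized)

lemma cauchy_kernel_L2 [simp, intro]:
  assumes "Im z \<noteq> 0"
  shows "cauchy_kernel z \<in> L2"
proof -
  have "cauchy_kernel \<i> \<in> L2"
    using has_integral_weight
    by (intro square_integrableI) (auto simp: cmod_cauchy_kernel_i has_bochner_integral_iff)
  then show ?thesis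
    by (rule square_integrable_dominated[where C = "1 + cmod (z - \<i>) / \<bar>Im z\<bar>"])
      (use cauchy_kernel_compare[OF assms, of \<i>] in auto)
qed

lemma cauchy_kernel_not_null: "Im z \<noteq> 0 \<Longrightarrow> \<not> (AE t in \<omega>. cauchy_kernel z t = 0)"
proof
  assume z: "Im z \<noteq> 0" and null: "AE t in \<omega>. cauchy_kernel z t = 0"
  have "(\<integral>\<^sup>+ t. 1 \<partial>\<omega>) = (\<integral>\<^sup>+ t. 0 \<partial>\<omega>)"
  proof (rule nn_integral_cong_AE, rule AE_mp[OF null], intro AE_I2 impI)
    fix t assume "cauchy_kernel z t = 0"
    then show "(1::ennreal) = 0" using nonreal_diff_nonzero[OF z, of t] by (simp add: cauchy_kernel_def)
  qed
  then show False using infinite by simp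
qed

lemma ip_cauchy_kernel_i: "ip (cauchy_kernel \<i>) (cauchy_kernel \<i>) = 1"
proof -
  have "(l2_norm \<omega> (cauchy_kernel \<i>))\<^sup>2 = 1"
    using has_integral_weight by (simp add: l2_norm_power2 cmod_cauchy_kernel_i has_bochner_integral_iff)
  then show ?thesis by (simp add: l2_inner_self)
qed

lemma kernel_mult_L2 [simp, intro]:
  assumes "Im z \<noteq> 0" "f \<in> L2"
  shows "(\<lambda>t. cauchy_kernel z t * f t) \<in> L2"
proof (rule square_integrable_dominated[OF assms(2), where C = "1 / \<bar>Im z\<bar>"])
  show "(\<lambda>t. cauchy_kernel z t * f t) \<in> borel_measurable \<omega>"
    using assms(2) by measurable
  show "AE t in \<omega>. cmod (cauchy_kernel z t * f t) \<le> 1 / \<bar>Im z\<bar> * cmod (f t)"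
    using cauchy_kernel_bounded[OF assms(1)] by (auto simp: norm_mult simp del: times_divide_eq_left intro!: mult_right_mono)
qed

lemma const_not_L2:
  assumes "f \<in> L2" "AE t in \<omega>. f t = c"
  shows "c = 0"
proof (rule ccontr)
  assume "c \<noteq> 0"
  have "integrable \<omega> (\<lambda>t. (cmod (f t))\<^sup>2)" using assms(1) by (rule square_integrable_norm)
  then have "integrable \<omega> (\<lambda>t. (cmod c)\<^sup>2)"
    by (rule integrable_cong_AE_imp) (use assms(2) in auto)
  then have "integrable \<omega> (\<lambda>t. inverse ((cmod c)\<^sup>2) * (cmod c)\<^sup>2)" by (rule integrable_mult_right)
  then have "integrable \<omega> (\<lambda>t. 1 :: real)" using \<open>c \<noteq> 0\<close> by simp
  then show False using infinite by (simp add: integrable_iff_bounded)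
qed

text \<open>Rewriting the integral in this way shows that it is continuous for the graph norm of \<open>H\<close>.\<close>

lemma integral_eq_ip_kernel:
  assumes "Im s \<noteq> 0"
  shows "(\<integral>t. f t \<partial>\<omega>) = ip (cauchy_kernel (cnj s)) (\<lambda>t. of_real t * f t - s * f t)"
proof -
  have "cnj (cauchy_kernel (cnj s) t) * (of_real t * f t - s * f t) = f t" for t
  proof -
    have "cnj (cauchy_kernel (cnj s) t) * (of_real t * f t - s * f t) = ((of_real t - s) * cauchy_kernel s t) * f t"
      by (simp add: cnj_cauchy_kernel algebra_simps)
    then show ?thesis by (simp add: cauchy_kernel_mult[OF assms])
  qed
  then show ?thesis by (simp add: l2_inner_def)
qed

lemma integrable_of_mult_L2:
  assumes "f \<in> L2" "(\<lambda>t. of_real t * f t) \<in> L2"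
  shows "integrable \<omega> f"
proof -
  have "integrable \<omega> (\<lambda>t. cnj (cauchy_kernel \<i> t) * (of_real t * f t + \<i> * f t))"
    using assms by (intro integrable_cnj_mult square_integrable_add square_integrable_scale) auto
  moreover have "cnj (cauchy_kernel \<i> t) * (of_real t * f t + \<i> * f t) = f t" for t
  proof -
    have "cnj (cauchy_kernel \<i> t) * (of_real t * f t + \<i> * f t) = ((of_real t - - \<i>) * cauchy_kernel (- \<i>) t) * f t"
      by (simp add: cnj_cauchy_kernel algebra_simps)
    then show ?thesis by (subst (asm) cauchy_kernel_mult) simp_all
  qed
  ultimately show ?thesis by simp
qed

lemma mult_dom_iff: "f \<in> mult_dom \<omega> \<longleftrightarrow> f \<in> L2 \<and> (\<lambda>t. of_real t * f t) \<in> L2"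
proof -
  have *: "(cmod (of_real t * a))\<^sup>2 = t\<^sup>2 * (cmod a)\<^sup>2" for t a
    by (simp add: norm_mult power_mult_distrib)
  show ?thesis
  proof (cases "f \<in> borel_measurable \<omega>")
    case [measurable]: True
    have "f \<in> mult_dom \<omega> \<longleftrightarrow> integrable \<omega> (\<lambda>t. (1 + t\<^sup>2) * (cmod (f t))\<^sup>2)"
      unfolding mult_dom_def square_integrable_def
      by (subst integrable_real_density[symmetric]) auto
    also have "\<dots> \<longleftrightarrow> integrable \<omega> (\<lambda>t. (cmod (f t))\<^sup>2) \<and> integrable \<omega> (\<lambda>t. t\<^sup>2 * (cmod (f t))\<^sup>2)"
    proof safe
      assume int: "integrable \<omega> (\<lambda>t. (1 + t\<^sup>2) * (cmod (f t))\<^sup>2)"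
      show "integrable \<omega> (\<lambda>t. (cmod (f t))\<^sup>2)"
        by (rule Bochner_Integration.integrable_bound[OF int]) (auto simp: distrib_right)
      show "integrable \<omega> (\<lambda>t. t\<^sup>2 * (cmod (f t))\<^sup>2)"
        by (rule Bochner_Integration.integrable_bound[OF int]) (auto simp: distrib_right)
    qed (simp add: distrib_right)
    also have "\<dots> \<longleftrightarrow> f \<in> L2 \<and> (\<lambda>t. of_real t * f t) \<in> L2"
      by (simp add: square_integrable_def *)
    finally show ?thesis .
  next
    case False
    then show ?thesis by (simp add: mult_dom_def square_integrable_def)
  qed
qed

lemma mult_op_subset: "mult_op \<omega> \<subseteq> vecs X \<times> vecs X"
  by (auto simp: mult_op_def mult_dom_iff)

lemma mult_op_iff:
  assumes f: "f \<in> L2" and g: "g \<in> L2"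
  shows "(cls f, cls g) \<in> mult_op \<omega> \<longleftrightarrow> (AE t in \<omega>. g t = of_real t * f t)"
proof
  assume "(cls f, cls g) \<in> mult_op \<omega>"
  then obtain h where h: "h \<in> L2" "(\<lambda>t. of_real t * h t) \<in> L2" "cls f = cls h" "cls g = cls (\<lambda>t. of_real t * h t)"
    by (auto simp: mult_op_def mult_dom_iff)
  then have "AE t in \<omega>. f t = h t" "AE t in \<omega>. g t = of_real t * h t"
    using f g by (simp_all add: L2_class_eq_iff)
  then show "AE t in \<omega>. g t = of_real t * f t" by eventually_elim simp
next
  assume *: "AE t in \<omega>. g t = of_real t * f t"
  have tf: "(\<lambda>t. of_real t * f t) \<in> L2"
    by (rule square_integrable_dominated[OF g, where C = 1]) (use f * in auto)
  then have "cls g = cls (\<lambda>t. of_real t * f t)" using g * by (simp add: L2_class_eq_iff)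
  then show "(cls f, cls g) \<in> mult_op \<omega>" using f tf by (auto simp: mult_op_def mult_dom_iff)
qed

text \<open>The restriction of an operator \<open>A\<close> to the pairs annihilated by the functional
  \<open>(f, g) \<mapsto> \<integral> (g - s f) / (t - s) d\<omega>\<close>, which is continuous for the graph norm. On \<open>H\<close> this functional is
  \<open>\<integral> f d\<omega>\<close>.\<close>

definition kernel_restriction ::
  "complex \<Rightarrow> ((real \<Rightarrow> complex) set \<times> (real \<Rightarrow> complex) set) set \<Rightarrow> ((real \<Rightarrow> complex) set \<times> (real \<Rightarrow> complex) set) set"
  where "kernel_restriction s A =
    {(F, G) \<in> A. vinner X (cls (cauchy_kernel (cnj s))) (vdiff X G (vscale X s F)) = 0}"

lemma kernel_restriction_subset: "kernel_restriction s A \<subseteq> A"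
  by (auto simp: kernel_restriction_def)

lemma kernel_restriction_iff:
  assumes "Im s \<noteq> 0" "f \<in> L2" "g \<in> L2"
  shows "(cls f, cls g) \<in> kernel_restriction s A \<longleftrightarrow>
    (cls f, cls g) \<in> A \<and> ip (cauchy_kernel (cnj s)) (\<lambda>t. g t - s * f t) = 0"
  using assms by (auto simp: kernel_restriction_def L2_ops)

lemma linear_kernel_restriction:
  assumes s: "Im s \<noteq> 0" and A: "linear_operator X A"
  shows "linear_operator X (kernel_restriction s A)"
proof (rule linear_operator_L2I[OF _ kernel_restriction_iff[OF s]])
  let ?k = "cauchy_kernel (cnj s)"
  have k: "?k \<in> L2" using s by auto
  show "kernel_restriction s A \<subseteq> vecs X \<times> vecs X"
    using kernel_restriction_subset linear_operator_subset[OF A] by blast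
  show "(cls (\<lambda>t. 0), cls (\<lambda>t. 0)) \<in> A \<and> ip ?k (\<lambda>t. 0 - s * 0) = 0"
    using A by (simp add: linear_operator_def vzero_L2 l2_inner_def)
  fix f g assume fg: "f \<in> L2" "g \<in> L2" and Q: "(cls f, cls g) \<in> A \<and> ip ?k (\<lambda>t. g t - s * f t) = 0"
  {
    fix f' g' assume fg': "f' \<in> L2" "g' \<in> L2" and Q': "(cls f', cls g') \<in> A \<and> ip ?k (\<lambda>t. g' t - s * f' t) = 0"
    have "(vadd X (cls f) (cls f'), vadd X (cls g) (cls g')) \<in> A"
      using A Q Q' unfolding linear_operator_def by blast
    moreover have "(\<lambda>t. g t + g' t - s * (f t + f' t)) = (\<lambda>t. (g t - s * f t) + (g' t - s * f' t))"
      by (auto simp: algebra_simps)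
    ultimately show "(cls (\<lambda>t. f t + f' t), cls (\<lambda>t. g t + g' t)) \<in> A \<and> ip ?k (\<lambda>t. g t + g' t - s * (f t + f' t)) = 0"
      using fg fg' Q Q' k by (simp add: vadd_L2 l2_inner_add_right)
  }
  {
    fix c
    have "(vscale X c (cls f), vscale X c (cls g)) \<in> A"
      using A Q unfolding linear_operator_def by blast
    moreover have "(\<lambda>t. c * g t - s * (c * f t)) = (\<lambda>t. c * (g t - s * f t))"
      by (auto simp: algebra_simps)
    ultimately show "(cls (\<lambda>t. c * f t), cls (\<lambda>t. c * g t)) \<in> A \<and> ip ?k (\<lambda>t. c * g t - s * (c * f t)) = 0"
      using fg Q by (simp add: vscale_L2 l2_inner_scale_right)
  }
  assume "AE t in \<omega>. f t = 0"
  then have "cls f = vzero X" using fg by (simp add: vzero_L2 L2_class_eq_iff)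
  then have "cls g = vzero X"
    using A Q single_valuedD[of A "vzero X" "cls g" "vzero X"] unfolding linear_operator_def by auto
  then show "AE t in \<omega>. g t = 0" using fg by (simp add: vzero_L2 L2_class_eq_iff)
qed

lemma closed_kernel_restriction:
  assumes s: "Im s \<noteq> 0" and closed: "closed_operator X A"
  shows "closed_operator X (kernel_restriction s A)"
proof (rule closed_operator_L2I[OF linear_kernel_restriction[OF s]])
  show "linear_operator X A" using closed by (simp add: closed_operator_def)
next
  fix f g y w
  assume f: "\<And>n::nat. f n \<in> L2" and g: "\<And>n. g n \<in> L2" and y: "y \<in> L2" and w: "w \<in> L2"
    and in_T: "\<And>n. (cls (f n), cls (g n)) \<in> kernel_restriction s A"
    and lim: "(\<lambda>n. l2_norm \<omega> (\<lambda>t. f n t - y t)) \<longlonglongrightarrow> 0" "(\<lambda>n. l2_norm \<omega> (\<lambda>t. g n t - w t)) \<longlonglongrightarrow> 0"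
  let ?k = "cauchy_kernel (cnj s)"
  have k: "?k \<in> L2" using s by auto
  have "(cls y, cls w) \<in> A"
  proof -
    have "\<And>F G x y. x \<in> vecs X \<Longrightarrow> y \<in> vecs X \<Longrightarrow> (\<And>n. (F n, G n) \<in> A) \<Longrightarrow>
        vtendsto X F x \<Longrightarrow> vtendsto X G y \<Longrightarrow> (x, y) \<in> A"
      using closed unfolding closed_operator_def by blast
    from this[of "cls y" "cls w" "\<lambda>n. cls (f n)" "\<lambda>n. cls (g n)"] show ?thesis
      using y w f g lim in_T kernel_restriction_subset[of s A] by (auto simp: vtendsto_L2)
  qed
  moreover have "ip ?k (\<lambda>t. w t - s * y t) = 0"
  proof -
    have "ip ?k (g n) - s * ip ?k (f n) = 0" for n
      using in_T[of n] f g k by (simp add: kernel_restriction_iff[OF s] l2_inner_diff_right l2_inner_scale_right)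
    moreover have "(\<lambda>n. ip ?k (g n) - s * ip ?k (f n)) \<longlonglongrightarrow> ip ?k w - s * ip ?k y"
      by (intro tendsto_intros l2_inner_tendsto k f g y w lim)
    ultimately have "ip ?k w - s * ip ?k y = 0" by (simp add: LIMSEQ_const_iff)
    then show ?thesis using k y w by (simp add: l2_inner_diff_right l2_inner_scale_right)
  qed
  ultimately show "(cls y, cls w) \<in> kernel_restriction s A"
    using y w s by (simp add: kernel_restriction_iff)
qed

lemma mult_op_dot_eq:
  assumes s: "Im s \<noteq> 0"
  shows "mult_op_dot \<omega> = kernel_restriction s (mult_op \<omega>)"
proof (intro equalityI subrelI)
  fix F G assume FG: "(F, G) \<in> mult_op_dot \<omega>"
  then have H: "(F, G) \<in> mult_op \<omega>" by (simp add: mult_op_dot_def)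
  obtain f where f: "f \<in> L2" "(\<lambda>t. of_real t * f t) \<in> L2" "F = cls f" "(\<integral>t. f t \<partial>\<omega>) = 0"
    using FG by (auto simp: mult_op_dot_def mult_dom_iff)
  obtain g where g: "g \<in> L2" "G = cls g" using H mult_op_subset by (auto simp: vecs_L2)
  have gf: "AE t in \<omega>. g t = of_real t * f t" using H f g by (simp add: mult_op_iff)
  have "ip (cauchy_kernel (cnj s)) (\<lambda>t. g t - s * f t)
      = ip (cauchy_kernel (cnj s)) (\<lambda>t. of_real t * f t - s * f t)"
    using gf f g s by (intro l2_inner_cong square_integrable_diff square_integrable_scale) auto
  also have "\<dots> = 0" using integral_eq_ip_kernel[OF s] f by metis
  finally show "(F, G) \<in> kernel_restriction s (mult_op \<omega>)"
    using H f g s by (simp add: kernel_restriction_iff)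
next
  fix F G assume FG: "(F, G) \<in> kernel_restriction s (mult_op \<omega>)"
  then have H: "(F, G) \<in> mult_op \<omega>" using kernel_restriction_subset by blast
  then obtain f where f: "f \<in> L2" "(\<lambda>t. of_real t * f t) \<in> L2" "F = cls f" "G = cls (\<lambda>t. of_real t * f t)"
    by (auto simp: mult_op_def mult_dom_iff)
  have "(\<integral>t. f t \<partial>\<omega>) = 0"
    using FG f s by (simp add: kernel_restriction_iff integral_eq_ip_kernel[OF s])
  then show "(F, G) \<in> mult_op_dot \<omega>"
    using H f by (auto simp: mult_op_dot_def mult_dom_iff)
qed

lemma mult_op_dot_iff:
  assumes f: "f \<in> L2" and g: "g \<in> L2"
  shows "(cls f, cls g) \<in> mult_op_dot \<omega> \<longleftrightarrow> (AE t in \<omega>. g t = of_real t * f t) \<and> (\<integral>t. f t \<partial>\<omega>) = 0"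
proof (cases "AE t in \<omega>. g t = of_real t * f t")
  case True
  have tf: "(\<lambda>t. of_real t * f t) \<in> L2"
    by (rule square_integrable_dominated[OF g, where C = 1]) (use f True in auto)
  have "ip (cauchy_kernel (cnj \<i>)) (\<lambda>t. g t - \<i> * f t)
      = ip (cauchy_kernel (cnj \<i>)) (\<lambda>t. of_real t * f t - \<i> * f t)"
    using True f g tf by (intro l2_inner_cong square_integrable_diff square_integrable_scale) auto
  also have "\<dots> = (\<integral>t. f t \<partial>\<omega>)" by (rule integral_eq_ip_kernel[symmetric]) simp
  finally show ?thesis
    using True f g by (simp add: mult_op_dot_eq[of \<i>] kernel_restriction_iff mult_op_iff)
qed (use assms in \<open>simp add: mult_op_dot_def mult_op_iff\<close>)

lemma mult_op_dot_subset: "mult_op_dot \<omega> \<subseteq> vecs X \<times> vecs X"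
  using mult_op_subset by (auto simp: mult_op_dot_def)

lemma linear_mult_op: "linear_operator X (mult_op \<omega>)"
proof (rule linear_operator_L2I[OF mult_op_subset mult_op_iff])
  fix f g f' g' :: "real \<Rightarrow> complex" assume "AE t in \<omega>. g t = of_real t * f t" "AE t in \<omega>. g' t = of_real t * f' t"
  then show "AE t in \<omega>. g t + g' t = of_real t * (f t + f' t)"
    by eventually_elim (simp add: distrib_left)
next
  fix f g :: "real \<Rightarrow> complex" and c assume "AE t in \<omega>. g t = of_real t * f t"
  then show "AE t in \<omega>. c * g t = of_real t * (c * f t)" by eventually_elim simp
next
  fix f g :: "real \<Rightarrow> complex" assume "AE t in \<omega>. g t = of_real t * f t" "AE t in \<omega>. f t = 0"
  then show "AE t in \<omega>. g t = 0" by eventually_elim simp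
qed auto

subsection \<open>Dense domains\<close>

lemma truncation:
  assumes f: "f \<in> L2"
  defines "tr n t \<equiv> indicator {- real n..real n} t * f t"
  shows "tr n \<in> L2" "(\<lambda>t. of_real t * tr n t) \<in> L2" "(\<lambda>n. l2_norm \<omega> (\<lambda>t. tr n t - f t)) \<longlonglongrightarrow> 0"
proof -
  note [measurable] = square_integrable_measurable[OF f]
  have m: "tr n \<in> borel_measurable \<omega>" for n unfolding tr_def by measurable
  have b: "cmod (tr n t) \<le> 1 * cmod (f t)" for n t by (auto simp: tr_def indicator_def)
  have lim: "(\<lambda>n. tr n t) \<longlonglongrightarrow> f t" for t
  proof (rule tendsto_eventually)
    obtain N where "\<bar>t\<bar> \<le> real N" using real_arch_simple by blast
    then have "tr n t = f t" if "N \<le> n" for n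
      using that by (auto simp: tr_def indicator_def)
    then show "\<forall>\<^sub>F n in sequentially. tr n t = f t" unfolding eventually_sequentially by blast
  qed
  show "tr n \<in> L2" by (rule square_integrable_dominated[OF f m AE_I2[OF b]])
  show "(\<lambda>n. l2_norm \<omega> (\<lambda>t. tr n t - f t)) \<longlonglongrightarrow> 0"
    by (rule l2_dominated_convergence(3)[OF f m square_integrable_measurable[OF f] AE_I2[OF lim] AE_I2[OF b]])
  show "(\<lambda>t. of_real t * tr n t) \<in> L2"
  proof (rule square_integrable_dominated[OF f, where C = "real n"])
    show "(\<lambda>t. of_real t * tr n t) \<in> borel_measurable \<omega>" using m[of n] by measurable
    show "AE t in \<omega>. cmod (of_real t * tr n t) \<le> real n * cmod (f t)"
      by (auto simp: tr_def indicator_def norm_mult intro!: mult_right_mono)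
  qed
qed

lemma emeasure_interval_finite: "emeasure \<omega> {- real n..real n} < \<infinity>"
proof -
  have "emeasure \<omega> {- real n..real n} = (\<integral>\<^sup>+ t. indicator {- real n..real n} t \<partial>\<omega>)" by simp
  also have "\<dots> \<le> (\<integral>\<^sup>+ t. ennreal (1 + (real n)\<^sup>2) * ennreal (1 / (1 + t\<^sup>2)) \<partial>\<omega>)"
  proof (rule nn_integral_mono)
    fix t
    have "1 \<le> (1 + (real n)\<^sup>2) * (1 / (1 + t\<^sup>2))" if "\<bar>t\<bar> \<le> real n"
      using that by (simp add: pos_le_divide_eq add_pos_nonneg power2_le_iff_abs_le)
    from ennreal_leI[OF this] have "1 \<le> ennreal (1 + (real n)\<^sup>2) * ennreal (1 / (1 + t\<^sup>2))" if "\<bar>t\<bar> \<le> real n"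
      using that by (subst ennreal_mult[symmetric]) auto
    then show "indicator {- real n..real n} t \<le> ennreal (1 + (real n)\<^sup>2) * ennreal (1 / (1 + t\<^sup>2))"
      by (cases "\<bar>t\<bar> \<le> real n") (auto simp: indicator_def)
  qed
  also have "\<dots> = ennreal (1 + (real n)\<^sup>2)" by (simp add: nn_integral_cmult normalized)
  finally show ?thesis by (simp add: order_le_less_trans)
qed

lemma measure_interval_unbounded: "filterlim (\<lambda>n. measure \<omega> {- real n..real n}) at_top sequentially"
proof -
  have "(\<lambda>n. emeasure \<omega> {- real n..real n}) \<longlonglongrightarrow> emeasure \<omega> (\<Union>n. {- real n..real n})"
    by (rule Lim_emeasure_incseq) (auto simp: incseq_def)
  also have "(\<Union>n. {- real n..real n}) = UNIV"
  proof (intro set_eqI iffI UNIV_I)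
    fix t :: real
    obtain N where "\<bar>t\<bar> \<le> real N" using real_arch_simple by blast
    then show "t \<in> (\<Union>n. {- real n..real n})" by (intro UN_I[of N]) auto
  qed
  also have "emeasure \<omega> UNIV = \<infinity>" using infinite by simp
  finally have lim: "(\<lambda>n. emeasure \<omega> {- real n..real n}) \<longlonglongrightarrow> \<infinity>" .
  show ?thesis unfolding filterlim_at_top_dense
  proof
    fix Z
    have "eventually (\<lambda>n. ennreal Z < emeasure \<omega> {- real n..real n}) sequentially"
      using lim by (rule order_tendstoD) simp
    then show "eventually (\<lambda>n. Z < measure \<omega> {- real n..real n}) sequentially"
    proof eventually_elim
      case (elim n)
      then show ?case using emeasure_interval_finite[of n]
        by (simp add: emeasure_eq_ennreal_measure ennreal_less_iff less_top)
          (smt (verit) ennreal_less_iff measure_nonneg ennreal_neg)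
    qed
  qed
qed

text \<open>The constraint \<open>\<integral> f d\<omega> = 0\<close> is met by truncating \<open>f\<close> and then subtracting a multiple of the
  indicator of a long interval \<open>I\<close>; the norm of this multiple is \<open>|\<integral> f d\<omega>| / sqrt (\<omega> I)\<close>, which is small because \<open>\<omega>\<close> is infinite.\<close>

lemma dense_domain_dot: "vclosure X (Domain (mult_op_dot \<omega>)) = vecs X"
proof (intro equalityI subsetI)
  fix F assume "F \<in> vecs X"
  then obtain f where f: "f \<in> L2" "F = cls f" by (rule vecs_L2E)
  have sub: "Domain (mult_op_dot \<omega>) \<subseteq> vecs X" using mult_op_dot_subset by auto
  show "F \<in> vclosure X (Domain (mult_op_dot \<omega>))"
    unfolding f(2) L2_class_vclosure_iff[OF f(1) sub]
  proof (intro allI impI)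
    fix e :: real assume e: "e > 0"
    define I where "I n = {- real n..real n}" for n
    have "eventually (\<lambda>n. l2_norm \<omega> (\<lambda>t. indicator (I n) t * f t - f t) < e / 2) sequentially"
      using truncation(3)[OF f(1)] unfolding I_def by (rule order_tendstoD) (use e in simp)
    then obtain n where n: "l2_norm \<omega> (\<lambda>t. indicator (I n) t * f t - f t) < e / 2"
      by (auto simp: eventually_sequentially)
    define p where "p t = indicator (I n) t * f t" for t
    have p: "p \<in> L2" "(\<lambda>t. of_real t * p t) \<in> L2"
      using truncation(1,2)[OF f(1), of n] by (simp_all add: p_def[abs_def] I_def)
    define a where "a = (\<integral>t. p t \<partial>\<omega>)"
    have "eventually (\<lambda>m. (2 * cmod a / e)\<^sup>2 < measure \<omega> (I m)) sequentially"
      using measure_interval_unbounded unfolding I_def filterlim_at_top_dense by blast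
    then obtain m where m: "(2 * cmod a / e)\<^sup>2 < measure \<omega> (I m)"
      by (auto simp: eventually_sequentially)
    define \<mu> where "\<mu> = measure \<omega> (I m)"
    have \<mu>: "\<mu> > 0" using m zero_le_power2[of "2 * cmod a / e"] unfolding \<mu>_def by linarith
    define q where "q t = complex_of_real (indicator (I m) t)" for t
    have I: "I m \<in> sets \<omega>" "emeasure \<omega> (I m) < \<infinity>"
      using emeasure_interval_finite[of m] by (simp_all add: I_def)
    have qi: "(\<integral>t. (cmod (q t))\<^sup>2 \<partial>\<omega>) = \<mu>" "integrable \<omega> (\<lambda>t. (cmod (q t))\<^sup>2)"
      "integrable \<omega> q" "(\<integral>t. q t \<partial>\<omega>) = of_real \<mu>"
    proof -
      have "(cmod (q t))\<^sup>2 = indicator (I m) t" for t by (auto simp: q_def indicator_def)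
      then show "(\<integral>t. (cmod (q t))\<^sup>2 \<partial>\<omega>) = \<mu>" "integrable \<omega> (\<lambda>t. (cmod (q t))\<^sup>2)"
        using I by (simp_all add: \<mu>_def)
      show "integrable \<omega> q" "(\<integral>t. q t \<partial>\<omega>) = of_real \<mu>"
        unfolding q_def using I by (simp_all add: \<mu>_def)
    qed
    have q: "q \<in> L2" using qi by (intro square_integrableI) (auto simp: q_def I_def)
    have "(\<lambda>t. of_real t * q t) \<in> L2"
    proof (rule square_integrable_dominated[OF q, where C = "real m"])
      show "(\<lambda>t. of_real t * q t) \<in> borel_measurable \<omega>"
        using square_integrable_measurable[OF q] by measurable
      show "AE t in \<omega>. cmod (of_real t * q t) \<le> real m * cmod (q t)"
        by (auto simp: q_def I_def indicator_def norm_mult)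
    qed
    note q = q this
    define b where "b = - a / of_real \<mu>"
    define h where "h t = p t + b * q t" for t
    have h: "h \<in> L2" "(\<lambda>t. of_real t * h t) \<in> L2"
    proof -
      show "h \<in> L2" unfolding h_def using p q by auto
      have "(\<lambda>t. of_real t * h t) = (\<lambda>t. of_real t * p t + b * (of_real t * q t))"
        by (auto simp: h_def algebra_simps)
      then show "(\<lambda>t. of_real t * h t) \<in> L2" using p q by auto
    qed
    have "(\<integral>t. h t \<partial>\<omega>) = a + b * of_real \<mu>"
      unfolding h_def a_def using integrable_of_mult_L2[OF p] qi by simp
    also have "\<dots> = 0" using \<mu> by (simp add: b_def)
    finally have "(cls h, cls (\<lambda>t. of_real t * h t)) \<in> mult_op_dot \<omega>"
      using h by (simp add: mult_op_dot_iff)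
    then have "cls h \<in> Domain (mult_op_dot \<omega>)" by blast
    moreover have "l2_norm \<omega> (\<lambda>t. h t - f t) < e"
    proof -
      have "l2_norm \<omega> (\<lambda>t. h t - f t) = l2_norm \<omega> (\<lambda>t. (p t - f t) + b * q t)"
        by (simp add: h_def algebra_simps)
      also have "\<dots> \<le> l2_norm \<omega> (\<lambda>t. p t - f t) + l2_norm \<omega> (\<lambda>t. b * q t)"
        using p f q by (intro l2_norm_add_le) auto
      also have "l2_norm \<omega> (\<lambda>t. b * q t) = cmod b * sqrt \<mu>"
        by (simp add: l2_norm_scale) (simp add: l2_norm_def qi)
      also have "\<dots> = cmod a / sqrt \<mu>"
      proof -
        have "cmod b * sqrt \<mu> = cmod a * sqrt \<mu> / (sqrt \<mu> * sqrt \<mu>)"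
          using \<mu> by (simp add: b_def norm_divide)
        then show ?thesis using \<mu> by (simp del: real_sqrt_mult_self)
      qed
      also have "\<dots> < e / 2"
      proof -
        have "2 * cmod a / e < sqrt \<mu>"
          using real_less_rsqrt[OF m] by (simp add: \<mu>_def)
        then show ?thesis using e \<mu> by (simp add: field_simps)
      qed
      also have "l2_norm \<omega> (\<lambda>t. p t - f t) < e / 2" using n by (simp add: p_def)
      finally show ?thesis by simp
    qed
    ultimately show "\<exists>g\<in>L2. cls g \<in> Domain (mult_op_dot \<omega>) \<and> l2_norm \<omega> (\<lambda>t. g t - f t) < e"
      using h by blast
  qed
qed (auto simp: vclosure_def)

lemma linear_mult_op_dot: "linear_operator X (mult_op_dot \<omega>)"
  using linear_kernel_restriction[OF _ linear_mult_op, of \<i>] by (simp add: mult_op_dot_eq[of \<i>])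

lemma densely_defined_dot: "densely_defined X (mult_op_dot \<omega>)"
  by (simp add: densely_defined_def dense_domain_dot linear_mult_op_dot)

lemma dot_subset: "mult_op_dot \<omega> \<subseteq> mult_op \<omega>"
  by (auto simp: mult_op_dot_def)

lemma densely_defined_mult_op: "densely_defined X (mult_op \<omega>)"
proof -
  have "vclosure X (Domain (mult_op_dot \<omega>)) \<subseteq> vclosure X (Domain (mult_op \<omega>))"
    using dot_subset by (fastforce simp: vclosure_def)
  then show ?thesis
    using linear_mult_op dense_domain_dot by (auto simp: densely_defined_def vclosure_def)
qed

end

context normalized_measure
begin

section \<open>The adjoints\<close>

lemma of_real_mult_kernel: "Im z \<noteq> 0 \<Longrightarrow> of_real t * cauchy_kernel z t = 1 + z * cauchy_kernel z t"
  using cauchy_kernel_mult[of z t] by (simp add: algebra_simps)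

lemma of_real_mult_kernel_mult:
  "Im z \<noteq> 0 \<Longrightarrow> of_real t * (cauchy_kernel z t * a) = a + z * (cauchy_kernel z t * a)"
  by (simp add: mult.assoc[symmetric] of_real_mult_kernel distrib_right)

lemma kernel_test_L2:
  assumes "v \<in> L2"
  shows "(\<lambda>t. of_real t * (cauchy_kernel (- \<i>) t * v t)) \<in> L2"
proof -
  have "(\<lambda>t. of_real t * (cauchy_kernel (- \<i>) t * v t)) = (\<lambda>t. v t + - \<i> * (cauchy_kernel (- \<i>) t * v t))"
    by (simp add: of_real_mult_kernel_mult)
  then show ?thesis
    using assms by (simp only:) (intro square_integrable_add square_integrable_scale kernel_mult_L2, auto)
qed

text \<open>The range of \<open>H + \<i>\<close> is the whole space: the vectors \<open>v / (t + \<i>)\<close> with \<open>v\<close> square integrable serve as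
  test functions for the adjoint, and reduce the question to orthogonality in \<open>L\<^sup>2\<close>.\<close>

lemma adjoint_orthogonality:
  assumes T: "T \<subseteq> vecs X \<times> vecs X" and y: "y \<in> L2" and w: "w \<in> L2"
    and adj: "(cls y, cls w) \<in> adjoint_op X T" and v: "v \<in> L2"
    and test: "(cls (\<lambda>t. cauchy_kernel (- \<i>) t * v t), cls (\<lambda>t. of_real t * (cauchy_kernel (- \<i>) t * v t))) \<in> T"
  shows "ip v (\<lambda>t. cauchy_kernel \<i> t * (of_real t * y t - w t)) = 0"
proof -
  define x where "x t = cauchy_kernel (- \<i>) t * v t" for t
  define u where "u t = of_real t * x t" for t
  have x: "x \<in> L2" unfolding x_def using v by auto
  have u: "u \<in> L2" unfolding u_def x_def using v by (rule kernel_test_L2)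
  have "ip u y = ip x w"
    using adj test u x unfolding adjoint_op_L2_iff[OF T y w] x_def[symmetric] u_def[symmetric] by blast
  then have "0 = (\<integral>t. cnj (u t) * y t - cnj (x t) * w t \<partial>\<omega>)"
    using u x y w by (simp add: l2_inner_def)
  also have "\<dots> = ip v (\<lambda>t. cauchy_kernel \<i> t * (of_real t * y t - w t))"
    unfolding l2_inner_def by (rule Bochner_Integration.integral_cong) (simp_all add: u_def x_def cnj_cauchy_kernel algebra_simps)
  finally show ?thesis by simp
qed

lemma kernel_defect_L2:
  assumes "y \<in> L2" "w \<in> L2"
  shows "(\<lambda>t. cauchy_kernel \<i> t * (of_real t * y t - w t)) \<in> L2"
proof -
  have "(\<lambda>t. cauchy_kernel \<i> t * (of_real t * y t - w t))
      = (\<lambda>t. (y t + \<i> * (cauchy_kernel \<i> t * y t)) - cauchy_kernel \<i> t * w t)"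
  proof
    fix t
    have "cauchy_kernel \<i> t * (of_real t * y t - w t)
        = of_real t * (cauchy_kernel \<i> t * y t) - cauchy_kernel \<i> t * w t"
      by (simp add: algebra_simps)
    then show "cauchy_kernel \<i> t * (of_real t * y t - w t)
        = (y t + \<i> * (cauchy_kernel \<i> t * y t)) - cauchy_kernel \<i> t * w t"
      by (simp add: of_real_mult_kernel_mult)
  qed
  then show ?thesis using assms by auto
qed

lemma adjoint_mult_op_iff:
  assumes y: "y \<in> L2" and w: "w \<in> L2"
  shows "(cls y, cls w) \<in> adjoint_op X (mult_op \<omega>) \<longleftrightarrow> (AE t in \<omega>. w t = of_real t * y t)"
proof
  assume adj: "(cls y, cls w) \<in> adjoint_op X (mult_op \<omega>)"
  define p where "p t = cauchy_kernel \<i> t * (of_real t * y t - w t)" for t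
  have p: "p \<in> L2" unfolding p_def using y w by (rule kernel_defect_L2)
  have "ip p p = 0"
  proof (rule adjoint_orthogonality[OF mult_op_subset y w adj p, folded p_def])
    show "(cls (\<lambda>t. cauchy_kernel (- \<i>) t * p t), cls (\<lambda>t. of_real t * (cauchy_kernel (- \<i>) t * p t))) \<in> mult_op \<omega>"
      using p kernel_test_L2[OF p] by (subst mult_op_iff) auto
  qed
  then have "AE t in \<omega>. p t = 0" using p by (simp add: l2_inner_self l2_norm_eq_0_iff)
  then show "AE t in \<omega>. w t = of_real t * y t"
  proof eventually_elim
    fix t assume "p t = 0"
    then show "w t = of_real t * y t"
      using nonreal_diff_nonzero[of \<i> t] by (simp add: p_def cauchy_kernel_def)
  qed
next
  assume wy: "AE t in \<omega>. w t = of_real t * y t"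
  show "(cls y, cls w) \<in> adjoint_op X (mult_op \<omega>)"
    unfolding adjoint_op_L2_iff[OF mult_op_subset y w]
  proof (intro ballI impI)
    fix f g assume fg: "f \<in> L2" "g \<in> L2" "(cls f, cls g) \<in> mult_op \<omega>"
    then have gf: "AE t in \<omega>. g t = of_real t * f t" by (simp add: mult_op_iff)
    note [measurable] = fg(1,2)[THEN square_integrable_measurable] y[THEN square_integrable_measurable] w[THEN square_integrable_measurable]
    show "ip g y = ip f w" unfolding l2_inner_def
    proof (rule integral_cong_AE)
      show "AE t in \<omega>. cnj (g t) * y t = cnj (f t) * w t"
        using gf wy by eventually_elim simp
    qed measurable
  qed
qed

lemma self_adjoint_mult_op: "self_adjoint X (mult_op \<omega>)"
proof -
  have "mult_op \<omega> = adjoint_op X (mult_op \<omega>)"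
  proof (intro equalityI subrelI)
    fix F G assume FG: "(F, G) \<in> mult_op \<omega>"
    obtain f g where "f \<in> L2" "g \<in> L2" "F = cls f" "G = cls g" by (rule L2_pair_cases[OF mult_op_subset FG])
    then show "(F, G) \<in> adjoint_op X (mult_op \<omega>)" using FG by (simp add: mult_op_iff adjoint_mult_op_iff)
  next
    fix F G assume FG: "(F, G) \<in> adjoint_op X (mult_op \<omega>)"
    obtain f g where "f \<in> L2" "g \<in> L2" "F = cls f" "G = cls g" by (rule L2_pair_cases[OF adjoint_op_subset FG])
    then show "(F, G) \<in> mult_op \<omega>" using FG by (simp add: mult_op_iff adjoint_mult_op_iff)
  qed
  then show ?thesis using densely_defined_mult_op by (simp add: self_adjoint_def)
qed

text \<open>The constraint \<open>\<integral> f d\<omega> = 0\<close> leaves as test vectors \<open>v\<close> exactly those orthogonal to \<open>1 / (t - \<i>)\<close>.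
  Hence \<open>(t y - w) / (t - \<i>)\<close> is a multiple of \<open>1 / (t - \<i>)\<close>, that is, \<open>t y - w\<close> is a constant.\<close>

lemma adjoint_dot_iff:
  assumes y: "y \<in> L2" and w: "w \<in> L2"
  shows "(cls y, cls w) \<in> adjoint_op X (mult_op_dot \<omega>) \<longleftrightarrow> (\<exists>c. AE t in \<omega>. w t = of_real t * y t - c)"
proof
  assume adj: "(cls y, cls w) \<in> adjoint_op X (mult_op_dot \<omega>)"
  let ?k = "cauchy_kernel \<i>"
  define p where "p t = ?k t * (of_real t * y t - w t)" for t
  have p: "p \<in> L2" unfolding p_def using y w by (rule kernel_defect_L2)
  have k: "?k \<in> L2" by auto
  define c where "c = ip ?k p"
  define v where "v t = p t - c * ?k t" for t
  have v: "v \<in> L2" unfolding v_def using p k by auto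
  have kv: "ip ?k v = 0" unfolding v_def using p k
    by (simp add: l2_inner_diff_right l2_inner_scale_right ip_cauchy_kernel_i c_def)
  have "(cls (\<lambda>t. cauchy_kernel (- \<i>) t * v t), cls (\<lambda>t. of_real t * (cauchy_kernel (- \<i>) t * v t))) \<in> mult_op_dot \<omega>"
  proof (subst mult_op_dot_iff)
    have "(\<integral>t. cauchy_kernel (- \<i>) t * v t \<partial>\<omega>) = ip ?k v"
      by (simp add: l2_inner_def cnj_cauchy_kernel)
    then show "(AE t in \<omega>. of_real t * (cauchy_kernel (- \<i>) t * v t) = of_real t * (cauchy_kernel (- \<i>) t * v t)) \<and>
        (\<integral>t. cauchy_kernel (- \<i>) t * v t \<partial>\<omega>) = 0" using kv by simp
  qed (use v kernel_test_L2[OF v] in auto)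
  then have "ip v p = 0"
    unfolding p_def by (rule adjoint_orthogonality[OF mult_op_dot_subset y w adj v])
  moreover have "ip v ?k = 0" using kv l2_inner_cnj[of \<omega> ?k v] by simp
  moreover have "ip v v = ip v p - c * ip v ?k"
  proof -
    have "ip v (\<lambda>t. p t - c * ?k t) = ip v p - c * ip v ?k"
      using v p k by (simp add: l2_inner_diff_right l2_inner_scale_right)
    then show ?thesis by (simp add: v_def[abs_def])
  qed
  ultimately have "ip v v = 0" by simp
  then have "AE t in \<omega>. v t = 0" using v by (simp add: l2_inner_self l2_norm_eq_0_iff)
  then have "AE t in \<omega>. w t = of_real t * y t - c"
  proof eventually_elim
    fix t assume "v t = 0"
    then have "?k t * (of_real t * y t - w t) = ?k t * c" by (simp add: v_def p_def)
    then have "of_real t * y t - w t = c" by (subst (asm) cauchy_kernel_eq_iff) simp_all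
    then show "w t = of_real t * y t - c" by (simp add: algebra_simps)
  qed
  then show "\<exists>c. AE t in \<omega>. w t = of_real t * y t - c" by blast
next
  assume "\<exists>c. AE t in \<omega>. w t = of_real t * y t - c"
  then obtain c where c: "AE t in \<omega>. w t = of_real t * y t - c" by blast
  show "(cls y, cls w) \<in> adjoint_op X (mult_op_dot \<omega>)"
    unfolding adjoint_op_L2_iff[OF mult_op_dot_subset y w]
  proof (intro ballI impI)
    fix f g assume fg: "f \<in> L2" "g \<in> L2" "(cls f, cls g) \<in> mult_op_dot \<omega>"
    then have gf: "AE t in \<omega>. g t = of_real t * f t" and f0: "(\<integral>t. f t \<partial>\<omega>) = 0" by (simp_all add: mult_op_dot_iff)
    note [measurable] = fg(1,2)[THEN square_integrable_measurable] y[THEN square_integrable_measurable] w[THEN square_integrable_measurable]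
    have tf: "(\<lambda>t. of_real t * f t) \<in> L2"
      by (rule square_integrable_dominated[OF fg(2), where C = 1]) (use gf in auto)
    have "ip f w = (\<integral>t. cnj (g t) * y t - c * cnj (f t) \<partial>\<omega>)" unfolding l2_inner_def
    proof (rule integral_cong_AE)
      show "AE t in \<omega>. cnj (f t) * w t = cnj (g t) * y t - c * cnj (f t)"
        using gf c
      proof eventually_elim
        fix t assume gw: "g t = of_real t * f t" "w t = of_real t * y t - c"
        show "cnj (f t) * w t = cnj (g t) * y t - c * cnj (f t)"
          unfolding gw by (simp add: algebra_simps)
      qed
    qed measurable
    also have "\<dots> = ip g y - c * cnj (\<integral>t. f t \<partial>\<omega>)"
      using fg y integrable_of_mult_L2[OF fg(1) tf] by (simp add: l2_inner_def)
    finally show "ip g y = ip f w" using f0 by simp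
  qed
qed

lemma linear_adjoint_dot: "linear_operator X (adjoint_op X (mult_op_dot \<omega>))"
proof (rule linear_operator_L2I[OF adjoint_op_subset adjoint_dot_iff])
  show "\<exists>c. AE t in \<omega>. (0::complex) = of_real t * 0 - c" by (intro exI[of _ 0]) simp
next
  fix f g f' g' :: "real \<Rightarrow> complex"
  assume "\<exists>c. AE t in \<omega>. g t = of_real t * f t - c" "\<exists>c. AE t in \<omega>. g' t = of_real t * f' t - c"
  then obtain c c' where "AE t in \<omega>. g t = of_real t * f t - c" "AE t in \<omega>. g' t = of_real t * f' t - c'" by blast
  then have "AE t in \<omega>. g t + g' t = of_real t * (f t + f' t) - (c + c')"
    by eventually_elim (simp add: algebra_simps)
  then show "\<exists>c. AE t in \<omega>. g t + g' t = of_real t * (f t + f' t) - c" by blast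
next
  fix f g :: "real \<Rightarrow> complex" and a assume "\<exists>c. AE t in \<omega>. g t = of_real t * f t - c"
  then obtain c where "AE t in \<omega>. g t = of_real t * f t - c" by blast
  then have "AE t in \<omega>. a * g t = of_real t * (a * f t) - a * c"
    by eventually_elim (simp only: right_diff_distrib mult.left_commute)
  then show "\<exists>c. AE t in \<omega>. a * g t = of_real t * (a * f t) - c" by blast
next
  fix f g assume g: "g \<in> L2" and "\<exists>c. AE t in \<omega>. g t = of_real t * f t - c" and f0: "AE t in \<omega>. f t = 0"
  then obtain c where "AE t in \<omega>. g t = of_real t * f t - c" by blast
  then have gc: "AE t in \<omega>. g t = - c" using f0 by eventually_elim simp
  then have "- c = 0" by (rule const_not_L2[OF g])
  then show "AE t in \<omega>. g t = 0" using gc by simp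
qed

lemma closed_adjoint_dot: "closed_operator X (adjoint_op X (mult_op_dot \<omega>))"
  by (rule closed_operator_L2I[OF linear_adjoint_dot]) (rule adjoint_op_L2_limit[OF mult_op_dot_subset])

lemma closed_mult_op: "closed_operator X (mult_op \<omega>)"
proof (rule closed_operator_L2I[OF linear_mult_op])
  have "mult_op \<omega> = adjoint_op X (mult_op \<omega>)" using self_adjoint_mult_op by (simp add: self_adjoint_def)
  then show "(cls y, cls w) \<in> mult_op \<omega>"
    if "\<And>n. f n \<in> L2" "\<And>n. g n \<in> L2" "y \<in> L2" "w \<in> L2" "\<And>n. (cls (f n), cls (g n)) \<in> mult_op \<omega>"
      "(\<lambda>n. l2_norm \<omega> (\<lambda>t. f n t - y t)) \<longlonglongrightarrow> 0" "(\<lambda>n. l2_norm \<omega> (\<lambda>t. g n t - w t)) \<longlonglongrightarrow> 0" for f g y w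
    using adjoint_op_L2_limit[OF mult_op_subset that(1-4) _ that(6,7)] that(5) by simp
qed

lemma closed_dot: "closed_operator X (mult_op_dot \<omega>)"
  using closed_kernel_restriction[OF _ closed_mult_op, of \<i>] by (simp add: mult_op_dot_eq[of \<i>])

lemma mult_op_subset_adjoint_dot: "mult_op \<omega> \<subseteq> adjoint_op X (mult_op_dot \<omega>)"
proof (rule subrelI)
  fix F G assume FG: "(F, G) \<in> mult_op \<omega>"
  obtain f g where fg: "f \<in> L2" "g \<in> L2" "F = cls f" "G = cls g" by (rule L2_pair_cases[OF mult_op_subset FG])
  then have "AE t in \<omega>. g t = of_real t * f t - 0" using FG by (simp add: mult_op_iff)
  then show "(F, G) \<in> adjoint_op X (mult_op_dot \<omega>)" using fg by (auto simp: adjoint_dot_iff)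
qed

lemma symmetric_dot: "symmetric_operator X (mult_op_dot \<omega>)"
  using densely_defined_dot dot_subset mult_op_subset_adjoint_dot by (auto simp: symmetric_operator_def)

section \<open>Deficiency indices\<close>

lemma kernel_op_adjoint_dot:
  assumes z: "Im z \<noteq> 0"
  shows "kernel_op X (shift_op X (adjoint_op X (mult_op_dot \<omega>)) z) = range (\<lambda>c. cls (\<lambda>t. c * cauchy_kernel z t))"
proof -
  have *: "(cls f, vzero X) \<in> shift_op X (adjoint_op X (mult_op_dot \<omega>)) z \<longleftrightarrow> (\<exists>c. cls f = cls (\<lambda>t. c * cauchy_kernel z t))"
    if f: "f \<in> L2" for f
  proof -
    have "(cls f, vzero X) \<in> shift_op X (adjoint_op X (mult_op_dot \<omega>)) z
        \<longleftrightarrow> (\<exists>c. AE t in \<omega>. z * f t = of_real t * f t - c)"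
      using f by (simp add: vzero_L2 shift_op_L2_iff[OF adjoint_op_subset] adjoint_dot_iff)
    also have "\<dots> \<longleftrightarrow> (\<exists>c. AE t in \<omega>. f t = c * cauchy_kernel z t)"
    proof -
      have "z * f t = of_real t * f t - c \<longleftrightarrow> f t = c * cauchy_kernel z t" for c t
        using nonreal_diff_nonzero[OF z, of t] by (auto simp: cauchy_kernel_def field_simps)
      then show ?thesis by simp
    qed
    finally show ?thesis using f z by (simp add: L2_class_eq_iff)
  qed
  have "F \<in> kernel_op X (shift_op X (adjoint_op X (mult_op_dot \<omega>)) z)
      \<longleftrightarrow> F \<in> range (\<lambda>c. cls (\<lambda>t. c * cauchy_kernel z t))" for F
  proof (cases "F \<in> vecs X")
    case True
    then show ?thesis by (rule vecs_L2E) (use * in \<open>auto simp: kernel_op_def\<close>)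
  next
    case False
    then show ?thesis
      using shift_op_L2_subset[OF adjoint_op_subset, of \<omega> "mult_op_dot \<omega>" z] z by (auto simp: kernel_op_def)
  qed
  then show ?thesis by blast
qed

lemma vsubspace_range_scale:
  assumes "u \<in> L2"
  shows "vsubspace X (range (\<lambda>c. cls (\<lambda>t. c * u t)))"
  unfolding vsubspace_def
proof (intro conjI)
  show "vzero X \<in> range (\<lambda>c. cls (\<lambda>t. c * u t))"
    by (rule image_eqI[of _ _ 0]) (simp_all add: vzero_L2)
  have "vadd X (cls (\<lambda>t. c * u t)) (cls (\<lambda>t. d * u t)) = cls (\<lambda>t. (c + d) * u t)" for c d
    using assms by (simp add: vadd_L2 distrib_right)
  then show "\<forall>x\<in>range (\<lambda>c. cls (\<lambda>t. c * u t)). \<forall>y\<in>range (\<lambda>c. cls (\<lambda>t. c * u t)).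
      vadd X x y \<in> range (\<lambda>c. cls (\<lambda>t. c * u t))" by auto
  have "vscale X d (cls (\<lambda>t. c * u t)) = cls (\<lambda>t. (d * c) * u t)" for c d
    using assms by (simp add: vscale_L2 mult.assoc)
  then show "\<forall>d. \<forall>x\<in>range (\<lambda>c. cls (\<lambda>t. c * u t)). vscale X d x \<in> range (\<lambda>c. cls (\<lambda>t. c * u t))" by auto
qed (use assms in auto)

lemma has_vdim_range_scale:
  assumes u: "u \<in> L2" and nz: "\<not> (AE t in \<omega>. u t = 0)"
  shows "has_vdim X (range (\<lambda>c. cls (\<lambda>t. c * u t))) 1"
proof -
  have "vspan X {cls u} = range (\<lambda>c. cls (\<lambda>t. c * u t))"
    unfolding vspan_def
  proof (rule hull_unique)
    show "{cls u} \<subseteq> range (\<lambda>c. cls (\<lambda>t. c * u t))" by (auto intro: image_eqI[of _ _ 1])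
    show "vsubspace X (range (\<lambda>c. cls (\<lambda>t. c * u t)))" using u by (rule vsubspace_range_scale)
    fix W assume W: "{cls u} \<subseteq> W" "vsubspace X W"
    show "range (\<lambda>c. cls (\<lambda>t. c * u t)) \<subseteq> W"
    proof safe
      fix c
      have "vscale X c (cls u) \<in> W" using W by (auto simp: vsubspace_def)
      then show "cls (\<lambda>t. c * u t) \<in> W" using u by (simp add: vscale_L2)
    qed
  qed
  moreover have "vspan X {} = {vzero X}"
    unfolding vspan_def
    by (rule hull_unique) (use vsubspace_range_scale[of "\<lambda>t. 0"] in \<open>auto simp: vzero_L2 vsubspace_def\<close>)
  then have "cls u \<notin> vspan X ({cls u} - {cls u})" using u nz by (simp add: vzero_L2 L2_class_eq_iff)
  ultimately show ?thesis unfolding has_vdim_def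
    by (intro exI[of _ "{cls u}"]) (use u in auto)
qed

lemma deficiency_indices_dot: "has_deficiency_indices X (mult_op_dot \<omega>) 1 1"
  unfolding has_deficiency_indices_def
  by (subst (1 2) kernel_op_adjoint_dot) (auto intro!: has_vdim_range_scale cauchy_kernel_not_null simp del: One_nat_def)

section \<open>Extensions by a Cauchy kernel\<close>

lemma linear_operator_combine:
  assumes S: "linear_operator X S"
    and fg: "f \<in> L2" "g \<in> L2" "f' \<in> L2" "g' \<in> L2" "(cls f, cls g) \<in> S" "(cls f', cls g') \<in> S"
  shows "(cls (\<lambda>t. f t + c * f' t), cls (\<lambda>t. g t + c * g' t)) \<in> S"
proof -
  have "(vscale X c (cls f'), vscale X c (cls g')) \<in> S"
    using S fg(6) unfolding linear_operator_def by blast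
  then have "(vadd X (cls f) (vscale X c (cls f')), vadd X (cls g) (vscale X c (cls g'))) \<in> S"
    using S fg(5) unfolding linear_operator_def by blast
  then show ?thesis using fg by (simp add: vscale_L2 vadd_L2)
qed

text \<open>The value of \<open>\<integral> (1/(t - z) - 1/(t - s)) d\<omega>\<close>: the increment from \<open>s\<close> to \<open>z\<close> of the function that the half-plane
  representation prescribes. It is written as an inner product to be compared with boundary
  conditions.\<close>

definition kernel_pairing :: "complex \<Rightarrow> complex \<Rightarrow> complex" where
  "kernel_pairing s z = (z - s) * ip (cauchy_kernel (cnj s)) (cauchy_kernel z)"

lemma kernel_pairing_integral:
  assumes s: "Im s \<noteq> 0" and z: "Im z \<noteq> 0"
  shows "has_bochner_integral \<omega> (\<lambda>t. cauchy_kernel z t - cauchy_kernel s t) (kernel_pairing s z)"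
proof -
  have "(\<lambda>t. cauchy_kernel z t - cauchy_kernel s t)
      = (\<lambda>t. (z - s) * (cnj (cauchy_kernel (cnj s) t) * cauchy_kernel z t))"
    using cauchy_kernel_resolvent[OF z s] by (auto simp: cnj_cauchy_kernel)
  then show ?thesis
    unfolding kernel_pairing_def l2_inner_def has_bochner_integral_iff using s z by simp
qed

lemma kernel_in_adjoint_dot:
  assumes z: "Im z \<noteq> 0"
  shows "(cls (cauchy_kernel z), cls (\<lambda>t. z * cauchy_kernel z t)) \<in> adjoint_op X (mult_op_dot \<omega>)"
  using z by (auto simp: adjoint_dot_iff of_real_mult_kernel intro!: exI[of _ 1])

text \<open>Eigenvectors of the adjoint at a nonreal \<open>z\<close> are multiples of the Cauchy kernel, which therefore
  lies in the domain of every extension with the eigenvalue \<open>z\<close>.\<close>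

lemma kernel_of_eigenvalue:
  assumes S: "linear_operator X S" and sub: "S \<subseteq> adjoint_op X (mult_op_dot \<omega>)"
    and z: "Im z \<noteq> 0" and ev: "z \<in> eigenvalues X S"
  shows "(cls (cauchy_kernel z), cls (\<lambda>t. z * cauchy_kernel z t)) \<in> S"
proof -
  obtain f where f: "f \<in> L2" "\<not> (AE t in \<omega>. f t = 0)" "(cls f, cls (\<lambda>t. z * f t)) \<in> S"
    using ev eigenvalues_L2_iff[OF linear_operator_subset[OF S]] by blast
  then have "(cls f, cls (\<lambda>t. z * f t)) \<in> adjoint_op X (mult_op_dot \<omega>)" using sub by blast
  then obtain c where c: "AE t in \<omega>. z * f t = of_real t * f t - c"
    using f(1) by (auto simp: adjoint_dot_iff)
  have fk: "AE t in \<omega>. f t = c * cauchy_kernel z t"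
    using c
  proof eventually_elim
    fix t assume "z * f t = of_real t * f t - c"
    then have "(of_real t - z) * f t = c" by (simp add: algebra_simps)
    from cauchy_kernel_eqI[OF z this] show "f t = c * cauchy_kernel z t" by (simp add: mult.commute)
  qed
  have "c \<noteq> 0" using fk f(2) by auto
  have "(vscale X (1 / c) (cls f), vscale X (1 / c) (cls (\<lambda>t. z * f t))) \<in> S"
    using S f(3) unfolding linear_operator_def by blast
  moreover have "cls f = cls (\<lambda>t. c * cauchy_kernel z t)"
    using f z fk by (simp add: L2_class_eq_iff)
  moreover have "cls (\<lambda>t. z * f t) = cls (\<lambda>t. z * (c * cauchy_kernel z t))"
    using f z fk by (auto simp: L2_class_eq_iff)
  ultimately show ?thesis using z \<open>c \<noteq> 0\<close> by (simp add: vscale_L2)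
qed

text \<open>The domain of the adjoint is two dimensions larger than that of the symmetric operator. An
  extension that contains both kernels contains their difference, which belongs to \<open>dom H\<close>. If its
  integral did not vanish, the difference and \<open>1 / (t - s)\<close> would span the two missing dimensions, and
  the extension would be the whole adjoint.\<close>

lemma proper_extension_kernel_pairing:
  assumes S: "linear_operator X S" and dot: "mult_op_dot \<omega> \<subseteq> S" and proper: "S \<subset> adjoint_op X (mult_op_dot \<omega>)"
    and s: "Im s \<noteq> 0" and z: "Im z \<noteq> 0"
    and s_in: "(cls (cauchy_kernel s), cls (\<lambda>t. s * cauchy_kernel s t)) \<in> S"
    and z_in: "(cls (cauchy_kernel z), cls (\<lambda>t. z * cauchy_kernel z t)) \<in> S"
  shows "kernel_pairing s z = 0"
proof (rule ccontr)
  let ?k = "cauchy_kernel (cnj s)" and ?s = "cauchy_kernel s" and ?z = "cauchy_kernel z"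
  assume nz: "kernel_pairing s z \<noteq> 0"
  have k: "?k \<in> L2" "?s \<in> L2" "?z \<in> L2" using s z by auto
  have "adjoint_op X (mult_op_dot \<omega>) \<subseteq> S"
  proof (rule subrelI)
    fix F G assume FG: "(F, G) \<in> adjoint_op X (mult_op_dot \<omega>)"
    obtain f g where fg: "f \<in> L2" "g \<in> L2" "F = cls f" "G = cls g" by (rule L2_pair_cases[OF adjoint_op_subset FG])
    obtain c where c: "AE t in \<omega>. g t = of_real t * f t - c" using FG fg by (auto simp: adjoint_dot_iff)
    \<comment> \<open>The total coefficient \<open>a + b = c\<close> of the two kernels cancels the constant in \<open>g = t f - c\<close>, and \<open>b\<close>
      cancels the boundary value.\<close>
    define b where "b = ip ?k (\<lambda>t. g t - s * f t) / kernel_pairing s z"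
    define a where "a = c - b"
    define f' where "f' t = f t + (- a) * ?s t + (- b) * ?z t" for t
    define g' where "g' t = g t + (- a) * (s * ?s t) + (- b) * (z * ?z t)" for t
    have f': "f' \<in> L2" unfolding f'_def by (intro square_integrable_add square_integrable_scale fg k)
    have g': "g' \<in> L2" unfolding g'_def by (intro square_integrable_add square_integrable_scale fg k)
    have "AE t in \<omega>. g' t = of_real t * f' t"
      using c
    proof eventually_elim
      fix t assume gt: "g t = of_real t * f t - c"
      have "of_real t * f' t = of_real t * f t - a * (of_real t * ?s t) - b * (of_real t * ?z t)"
        by (simp add: f'_def algebra_simps)
      also have "\<dots> = g' t"
        using s z by (simp add: of_real_mult_kernel g'_def gt a_def algebra_simps)
      finally show "g' t = of_real t * f' t" by simp
    qed
    moreover have "ip ?k (\<lambda>t. g' t - s * f' t) = 0"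
    proof -
      have "(\<lambda>t. g' t - s * f' t) = (\<lambda>t. (g t - s * f t) - b * ((z - s) * ?z t))"
        by (auto simp: f'_def g'_def algebra_simps)
      then have "ip ?k (\<lambda>t. g' t - s * f' t) = ip ?k (\<lambda>t. g t - s * f t) - b * kernel_pairing s z"
        using k fg by (simp add: l2_inner_diff_right[of ?k \<omega> "\<lambda>t. g t - s * f t"] l2_inner_scale_right kernel_pairing_def)
      then show ?thesis using nz by (simp add: b_def)
    qed
    ultimately have "(cls f', cls g') \<in> mult_op_dot \<omega>"
      using f' g' s by (simp add: mult_op_dot_eq[OF s] kernel_restriction_iff mult_op_iff)
    then have "(cls f', cls g') \<in> S" using dot by blast
    from linear_operator_combine[OF S f' g' k(2) square_integrable_scale[OF k(2)] this s_in, of a]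
    have "(cls (\<lambda>t. f' t + a * ?s t), cls (\<lambda>t. g' t + a * (s * ?s t))) \<in> S" .
    from linear_operator_combine[OF S square_integrable_add[OF f' square_integrable_scale[OF k(2)]]
        square_integrable_add[OF g' square_integrable_scale[OF square_integrable_scale[OF k(2)]]]
        k(3) square_integrable_scale[OF k(3)] this z_in, of b]
    have "(cls (\<lambda>t. f' t + a * ?s t + b * ?z t), cls (\<lambda>t. g' t + a * (s * ?s t) + b * (z * ?z t))) \<in> S" .
    then show "(F, G) \<in> S" using fg by (simp add: f'_def g'_def)
  qed
  then show False using proper by blast
qed

text \<open>The domain is spanned by \<open>1 / (t - s)\<close> and the domain of the symmetric operator. The description by a
  boundary condition on the adjoint makes closedness immediate and gives a membership test for the
  other Cauchy kernels.\<close>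

definition kernel_extension :: "complex \<Rightarrow> ((real \<Rightarrow> complex) set \<times> (real \<Rightarrow> complex) set) set" where
  "kernel_extension s = kernel_restriction s (adjoint_op X (mult_op_dot \<omega>))"

lemma kernel_extension_subset: "kernel_extension s \<subseteq> vecs X \<times> vecs X"
  using kernel_restriction_subset adjoint_op_subset unfolding kernel_extension_def by fast

lemma kernel_extension_iff:
  assumes "Im s \<noteq> 0" "f \<in> L2" "g \<in> L2"
  shows "(cls f, cls g) \<in> kernel_extension s \<longleftrightarrow>
    (\<exists>c. AE t in \<omega>. g t = of_real t * f t - c) \<and> ip (cauchy_kernel (cnj s)) (\<lambda>t. g t - s * f t) = 0"
  using assms by (simp add: kernel_extension_def kernel_restriction_iff adjoint_dot_iff)

lemma linear_kernel_extension: "Im s \<noteq> 0 \<Longrightarrow> linear_operator X (kernel_extension s)"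
  unfolding kernel_extension_def by (intro linear_kernel_restriction linear_adjoint_dot)

lemma closed_kernel_extension: "Im s \<noteq> 0 \<Longrightarrow> closed_operator X (kernel_extension s)"
  unfolding kernel_extension_def by (intro closed_kernel_restriction closed_adjoint_dot)

lemma kernel_in_extension_iff:
  assumes s: "Im s \<noteq> 0" and z: "Im z \<noteq> 0"
  shows "(cls (cauchy_kernel z), cls (\<lambda>t. z * cauchy_kernel z t)) \<in> kernel_extension s \<longleftrightarrow> kernel_pairing s z = 0"
proof -
  have "ip (cauchy_kernel (cnj s)) (\<lambda>t. z * cauchy_kernel z t - s * cauchy_kernel z t) = kernel_pairing s z"
    by (simp add: kernel_pairing_def l2_inner_scale_right flip: left_diff_distrib)
  then show ?thesis using s z kernel_in_adjoint_dot[OF z]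
    by (simp add: kernel_extension_def kernel_restriction_iff)
qed

lemma kernel_pairing_same [simp]: "kernel_pairing s s = 0"
  by (simp add: kernel_pairing_def)

text \<open>The boundary condition, evaluated on the Cauchy kernel at \<open>z\<close>, is \<^const>\<open>kernel_pairing\<close>.\<close>

lemma nonreal_eigenvalue_iff:
  assumes s: "Im s \<noteq> 0" and z: "Im z \<noteq> 0"
  shows "z \<in> eigenvalues X (kernel_extension s) \<longleftrightarrow> kernel_pairing s z = 0"
proof
  assume "z \<in> eigenvalues X (kernel_extension s)"
  from kernel_of_eigenvalue[OF linear_kernel_extension[OF s] _ z this]
  show "kernel_pairing s z = 0"
    using kernel_in_extension_iff[OF s z] kernel_restriction_subset by (simp add: kernel_extension_def)
next
  assume "kernel_pairing s z = 0"
  then show "z \<in> eigenvalues X (kernel_extension s)"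
    using kernel_in_extension_iff[OF s z] cauchy_kernel_not_null[OF z] z
    by (auto simp: eigenvalues_L2_iff[OF kernel_extension_subset])
qed

lemma nonreal_eigenvalue_not_self_adjoint:
  assumes S: "linear_operator X S" and z: "Im z \<noteq> 0" and ev: "z \<in> eigenvalues X S"
  shows "\<not> self_adjoint X S"
proof
  note sub = linear_operator_subset[OF S]
  assume "self_adjoint X S"
  then have adj: "S = adjoint_op X S" by (simp add: self_adjoint_def)
  obtain f where f: "f \<in> L2" "\<not> (AE t in \<omega>. f t = 0)" "(cls f, cls (\<lambda>t. z * f t)) \<in> S"
    using ev eigenvalues_L2_iff[OF sub] by blast
  have "(cls f, cls (\<lambda>t. z * f t)) \<in> adjoint_op X S" using adj f(3) by simp
  then have "ip (\<lambda>t. z * f t) f = ip f (\<lambda>t. z * f t)"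
    using f adjoint_op_L2_iff[OF sub f(1) square_integrable_scale[OF f(1)]] by blast
  then have "cnj z * ip f f = z * ip f f" by (simp add: l2_inner_scale_left l2_inner_scale_right)
  moreover have "ip f f \<noteq> 0" using f by (simp add: l2_inner_self l2_norm_eq_0_iff)
  ultimately have "cnj z = z" by simp
  then show False using z by (simp add: complex_eq_iff)
qed

text \<open>Solving \<open>(t - z) f - c = g\<close> gives \<open>f = (g + c) / (t - z)\<close>, and the boundary condition determines \<open>c\<close>
  as soon as \<open>\<integral> (1/(t - z) - 1/(t - s)) d\<omega> \<noteq> 0\<close>.\<close>

lemma kernel_extension_resolvent:
  assumes s: "Im s \<noteq> 0" and z: "Im z \<noteq> 0" and nz: "kernel_pairing s z \<noteq> 0"
  shows "z \<in> resolvent_set X (kernel_extension s)"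
proof -
  let ?k = "cauchy_kernel (cnj s)" and ?z = "cauchy_kernel z" and ?z' = "cauchy_kernel (cnj z)"
  let ?E = "kernel_extension s"
  have k: "?k \<in> L2" "?z \<in> L2" "?z' \<in> L2" using s z by auto
  define \<gamma> where "\<gamma> g = - ip ?z' g / kernel_pairing s z" for g
  define R where "R g t = ?z t * g t + \<gamma> g * ?z t" for g t
  have R: "R g \<in> L2" if "g \<in> L2" for g unfolding R_def using that k z by auto
  have functional: "ip ?k (\<lambda>t. (g t + z * (?z t * g t + c * ?z t)) - s * (?z t * g t + c * ?z t))
      = ip ?z' g + c * kernel_pairing s z" if g: "g \<in> L2" for g c
  proof -
    have "(\<lambda>t. (g t + z * (?z t * g t + c * ?z t)) - s * (?z t * g t + c * ?z t))
        = (\<lambda>t. (g t + (z - s) * (?z t * g t)) + (c * (z - s)) * ?z t)"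
      by (auto simp: algebra_simps)
    then have "ip ?k (\<lambda>t. (g t + z * (?z t * g t + c * ?z t)) - s * (?z t * g t + c * ?z t))
        = ip ?k (\<lambda>t. g t + (z - s) * (?z t * g t)) + c * kernel_pairing s z"
      using k g z by (simp add: l2_inner_add_right[of ?k \<omega> "\<lambda>t. g t + (z - s) * (?z t * g t)"]
          l2_inner_scale_right kernel_pairing_def)
    also have "ip ?k (\<lambda>t. g t + (z - s) * (?z t * g t)) = ip ?z' g"
      unfolding l2_inner_def
    proof (rule Bochner_Integration.integral_cong)
      fix t
      have "?z t = cauchy_kernel s t + (z - s) * (cauchy_kernel s t * ?z t)"
        using cauchy_kernel_resolvent[OF z s, of t] by (simp add: algebra_simps)
      then have "?z t * g t = (cauchy_kernel s t + (z - s) * (cauchy_kernel s t * ?z t)) * g t" by (rule arg_cong)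
      then show "cnj (?k t) * (g t + (z - s) * (?z t * g t)) = cnj (?z' t) * g t"
        by (simp add: cnj_cauchy_kernel algebra_simps)
    qed simp
    finally show ?thesis .
  qed
  have graph: "(cls g, cls f) \<in> (shift_op X ?E z)\<inverse> \<longleftrightarrow> cls f = cls (R g)" if f: "f \<in> L2" and g: "g \<in> L2" for f g
  proof -
    have "(cls g, cls f) \<in> (shift_op X ?E z)\<inverse> \<longleftrightarrow> (cls f, cls (\<lambda>t. g t + z * f t)) \<in> ?E"
      using f g by (simp add: shift_op_L2_iff[OF kernel_extension_subset])
    also have "\<dots> \<longleftrightarrow> (\<exists>c. AE t in \<omega>. g t + z * f t = of_real t * f t - c) \<and>
        ip ?k (\<lambda>t. (g t + z * f t) - s * f t) = 0"
      using f g s by (simp add: kernel_extension_iff)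
    also have "\<dots> \<longleftrightarrow> (\<exists>c. (AE t in \<omega>. f t = ?z t * g t + c * ?z t)) \<and> ip ?k (\<lambda>t. (g t + z * f t) - s * f t) = 0"
    proof -
      have "g t + z * f t = of_real t * f t - c \<longleftrightarrow> f t = ?z t * g t + c * ?z t" for t c
      proof -
        have "g t + z * f t = of_real t * f t - c \<longleftrightarrow> (of_real t - z) * f t = g t + c"
          by (auto simp: algebra_simps)
        also have "\<dots> \<longleftrightarrow> f t = ?z t * (g t + c)"
        proof
          assume "f t = ?z t * (g t + c)"
          then show "(of_real t - z) * f t = g t + c"
            by (simp add: mult.assoc[symmetric] cauchy_kernel_mult[OF z])
        qed (rule cauchy_kernel_eqI[OF z])
        finally show ?thesis by (simp add: distrib_left mult.commute)
      qed
      then show ?thesis by simp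
    qed
    also have "\<dots> \<longleftrightarrow> (\<exists>c. (AE t in \<omega>. f t = ?z t * g t + c * ?z t) \<and> ip ?z' g + c * kernel_pairing s z = 0)"
    proof -
      have "ip ?k (\<lambda>t. (g t + z * f t) - s * f t) = ip ?z' g + c * kernel_pairing s z"
        if "AE t in \<omega>. f t = ?z t * g t + c * ?z t" for c
      proof -
        have "ip ?k (\<lambda>t. (g t + z * f t) - s * f t)
            = ip ?k (\<lambda>t. (g t + z * (?z t * g t + c * ?z t)) - s * (?z t * g t + c * ?z t))"
          using that by (intro l2_inner_cong square_integrable_add square_integrable_diff square_integrable_scale
              kernel_mult_L2 f g k z) auto
        then show ?thesis using functional[OF g] by simp
      qed
      then show ?thesis by auto
    qed
    also have "\<dots> \<longleftrightarrow> (\<exists>c. (AE t in \<omega>. f t = ?z t * g t + c * ?z t) \<and> c = \<gamma> g)"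
    proof -
      have "ip ?z' g + c * kernel_pairing s z = 0 \<longleftrightarrow> c = \<gamma> g" for c
        unfolding \<gamma>_def using nz by (subst nonzero_eq_divide_eq) (auto simp: add_eq_0_iff)
      then show ?thesis by simp
    qed
    finally show ?thesis using f R[OF g] by (simp add: L2_class_eq_iff R_def)
  qed
  have sub: "(shift_op X ?E z)\<inverse> \<subseteq> vecs X \<times> vecs X"
    using shift_op_L2_subset[OF kernel_extension_subset] by fast
  have \<gamma>_add: "\<gamma> (\<lambda>t. g t + h t) = \<gamma> g + \<gamma> h" if "g \<in> L2" "h \<in> L2" for g h
    using that k by (simp add: \<gamma>_def l2_inner_add_right add_divide_distrib diff_divide_distrib)
  have \<gamma>_scale: "\<gamma> (\<lambda>t. c * g t) = c * \<gamma> g" for g c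
    by (simp add: \<gamma>_def l2_inner_scale_right)
  have lin: "linear_operator X ((shift_op X ?E z)\<inverse>)"
  proof (rule linear_operator_L2I[OF sub graph])
    have "\<gamma> (\<lambda>t. 0) = 0" by (simp add: \<gamma>_def l2_inner_def)
    then show "cls (\<lambda>t. 0) = cls (R (\<lambda>t. 0))" by (simp add: R_def[abs_def])
  next
    fix g f g' f' assume *: "g \<in> L2" "f \<in> L2" "g' \<in> L2" "f' \<in> L2" "cls f = cls (R g)" "cls f' = cls (R g')"
    then have "AE t in \<omega>. f t = R g t" "AE t in \<omega>. f' t = R g' t" using R by (simp_all add: L2_class_eq_iff)
    then have "AE t in \<omega>. f t + f' t = R (\<lambda>t. g t + g' t) t"
      by eventually_elim (use * in \<open>simp add: R_def \<gamma>_add algebra_simps\<close>)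
    then show "cls (\<lambda>t. f t + f' t) = cls (R (\<lambda>t. g t + g' t))" using * R by (simp add: L2_class_eq_iff)
  next
    fix g f c assume *: "g \<in> L2" "f \<in> L2" "cls f = cls (R g)"
    then have "AE t in \<omega>. f t = R g t" using R by (simp add: L2_class_eq_iff)
    then have "AE t in \<omega>. c * f t = R (\<lambda>t. c * g t) t"
      by eventually_elim (use * in \<open>simp add: R_def \<gamma>_scale algebra_simps\<close>)
    then show "cls (\<lambda>t. c * f t) = cls (R (\<lambda>t. c * g t))" using * R by (simp add: L2_class_eq_iff)
  next
    fix g f assume *: "g \<in> L2" "f \<in> L2" "cls f = cls (R g)" "AE t in \<omega>. g t = 0"
    then have fR: "AE t in \<omega>. f t = R g t" using R by (simp add: L2_class_eq_iff)
    have "ip ?z' g = ip ?z' (\<lambda>t. 0)" using * k by (intro l2_inner_cong) auto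
    then have \<gamma>0: "\<gamma> g = 0" by (simp add: \<gamma>_def l2_inner_def)
    have imp: "f t = 0" if "f t = R g t \<and> g t = 0" for t
      using that \<gamma>0 by (simp add: R_def)
    show "AE t in \<omega>. f t = 0"
      by (rule AE_mp[OF AE_conjI[OF fR *(4)]]) (use imp in blast)
  qed
  have dom: "Domain ((shift_op X ?E z)\<inverse>) = vecs X"
  proof (intro equalityI subsetI)
    fix G assume "G \<in> vecs X"
    then obtain g where g: "g \<in> L2" "G = cls g" by (rule vecs_L2E)
    then have "(G, cls (R g)) \<in> (shift_op X ?E z)\<inverse>" using graph[OF R[OF g(1)] g(1)] by simp
    then show "G \<in> Domain ((shift_op X ?E z)\<inverse>)" by blast
  qed (use sub in blast)
  define C where "C = 1 / \<bar>Im z\<bar> + l2_norm \<omega> ?z' * l2_norm \<omega> ?z / cmod (kernel_pairing s z)"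
  have bound: "l2_norm \<omega> (R g) \<le> C * l2_norm \<omega> g" if g: "g \<in> L2" for g
  proof -
    note [measurable] = square_integrable_measurable[OF g]
    have "l2_norm \<omega> (R g) \<le> l2_norm \<omega> (\<lambda>t. ?z t * g t) + l2_norm \<omega> (\<lambda>t. \<gamma> g * ?z t)"
      unfolding R_def using g k z by (intro l2_norm_add_le) auto
    also have "l2_norm \<omega> (\<lambda>t. ?z t * g t) \<le> (1 / \<bar>Im z\<bar>) * l2_norm \<omega> g"
    proof (rule l2_norm_mono[OF g])
      show "AE t in \<omega>. cmod (?z t * g t) \<le> 1 / \<bar>Im z\<bar> * cmod (g t)"
        using cauchy_kernel_bounded[OF z] by (auto simp: norm_mult simp del: times_divide_eq_left intro!: mult_right_mono)
    qed auto
    also have "l2_norm \<omega> (\<lambda>t. \<gamma> g * ?z t) = cmod (ip ?z' g) * l2_norm \<omega> ?z / cmod (kernel_pairing s z)"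
      by (subst l2_norm_scale) (simp add: \<gamma>_def norm_divide)
    also have "\<dots> \<le> (l2_norm \<omega> ?z' * l2_norm \<omega> g) * l2_norm \<omega> ?z / cmod (kernel_pairing s z)"
      using g k by (intro divide_right_mono mult_right_mono l2_Cauchy_Schwarz) auto
    finally show ?thesis by (simp add: C_def algebra_simps)
  qed
  have "\<exists>C. \<forall>(x, u)\<in>(shift_op X ?E z)\<inverse>. vnorm X u \<le> C * vnorm X x"
  proof (intro exI[of _ C] ballI, clarify)
    fix F G assume FG: "(F, G) \<in> shift_op X ?E z"
    then have GF: "(G, F) \<in> (shift_op X ?E z)\<inverse>" by simp
    obtain g f where fg: "g \<in> L2" "f \<in> L2" "G = cls g" "F = cls f" by (rule L2_pair_cases[OF sub GF])
    then have "F = cls (R g)" using GF graph by simp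
    then show "vnorm X F \<le> C * vnorm X G" using fg bound R by (simp add: vnorm_L2)
  qed
  then show ?thesis
    unfolding resolvent_set_def bounded_everywhere_defined_def using lin dom by blast
qed

end

section \<open>Primeness\<close>

lemma vsubspace_vspan:
  assumes "vsubspace Y (vecs Y)" "U \<subseteq> vecs Y"
  shows "vsubspace Y (vspan Y U)"
proof -
  have "vspan Y U \<subseteq> vecs Y" using assms by (auto simp: vspan_def hull_def)
  then show ?thesis unfolding vsubspace_def vspan_def hull_def by blast
qed

lemma vsubspace_vecs_L2: "vsubspace (L2_space M) (vecs (L2_space M))"
  unfolding vsubspace_def by (auto simp: vecs_L2 vzero_L2 vadd_L2 vscale_L2)

definition closure_functions :: "'a measure \<Rightarrow> ('a \<Rightarrow> complex) set set \<Rightarrow> ('a \<Rightarrow> complex) set" where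
  "closure_functions M U = {f \<in> square_integrable M. L2_class M f \<in> vclosure (L2_space M) U}"

lemma closure_functions_iff:
  assumes "vsubspace (L2_space M) U"
  shows "f \<in> closure_functions M U \<longleftrightarrow> f \<in> square_integrable M \<and>
    (\<forall>e>0. \<exists>g\<in>square_integrable M. L2_class M g \<in> U \<and> l2_norm M (\<lambda>x. g x - f x) < e)"
  using assms L2_class_vclosure_iff[of f M U] by (auto simp: closure_functions_def vsubspace_def)

lemma closure_functions_L2: "f \<in> closure_functions M U \<Longrightarrow> f \<in> square_integrable M"
  by (simp add: closure_functions_def)

lemma closure_functions_base:
  assumes "vsubspace (L2_space M) U" "f \<in> square_integrable M" "L2_class M f \<in> U"
  shows "f \<in> closure_functions M U"
  unfolding closure_functions_iff[OF assms(1)]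
  using assms(2,3) by (auto intro!: bexI[of _ f] simp: l2_norm_def)

lemma closure_functions_limit:
  assumes U: "vsubspace (L2_space M) U" and f: "\<And>n::nat. f n \<in> closure_functions M U"
    and h: "h \<in> square_integrable M" and lim: "(\<lambda>n. l2_norm M (\<lambda>x. f n x - h x)) \<longlonglongrightarrow> 0"
  shows "h \<in> closure_functions M U"
  unfolding closure_functions_iff[OF U]
proof (intro conjI h allI impI)
  fix e :: real assume e: "e > 0"
  have "eventually (\<lambda>n. l2_norm M (\<lambda>x. f n x - h x) < e / 2) sequentially"
    using lim by (rule order_tendstoD) (use e in simp)
  then obtain n where n: "l2_norm M (\<lambda>x. f n x - h x) < e / 2" by (auto simp: eventually_sequentially)
  have "e / 2 > 0" using e by simp
  then obtain g where g: "g \<in> square_integrable M" "L2_class M g \<in> U" "l2_norm M (\<lambda>x. g x - f n x) < e / 2"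
    using f[of n] unfolding closure_functions_iff[OF U] by blast
  have "l2_norm M (\<lambda>x. (g x - f n x) + (f n x - h x)) \<le> l2_norm M (\<lambda>x. g x - f n x) + l2_norm M (\<lambda>x. f n x - h x)"
    by (intro l2_norm_add_le square_integrable_diff g h closure_functions_L2[OF f])
  then have "l2_norm M (\<lambda>x. g x - h x) < e" using n g(3) by simp
  then show "\<exists>g\<in>square_integrable M. L2_class M g \<in> U \<and> l2_norm M (\<lambda>x. g x - h x) < e" using g by blast
qed

lemma closure_functions_add:
  assumes U: "vsubspace (L2_space M) U" and f: "f \<in> closure_functions M U" and g: "g \<in> closure_functions M U"
  shows "(\<lambda>x. f x + g x) \<in> closure_functions M U"
  unfolding closure_functions_iff[OF U]
proof (intro conjI allI impI)
  note fg = f[THEN closure_functions_L2] g[THEN closure_functions_L2]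
  show "(\<lambda>x. f x + g x) \<in> square_integrable M" using fg by auto
  fix e :: real assume "e > 0"
  then have e: "e / 2 > 0" by simp
  obtain f' where f': "f' \<in> square_integrable M" "L2_class M f' \<in> U" "l2_norm M (\<lambda>x. f' x - f x) < e / 2"
    using f e unfolding closure_functions_iff[OF U] by blast
  obtain g' where g': "g' \<in> square_integrable M" "L2_class M g' \<in> U" "l2_norm M (\<lambda>x. g' x - g x) < e / 2"
    using g e unfolding closure_functions_iff[OF U] by blast
  have "vadd (L2_space M) (L2_class M f') (L2_class M g') \<in> U" using U f' g' by (auto simp: vsubspace_def)
  then have "L2_class M (\<lambda>x. f' x + g' x) \<in> U" using f' g' by (simp add: vadd_L2)
  moreover have "l2_norm M (\<lambda>x. (f' x - f x) + (g' x - g x)) \<le> l2_norm M (\<lambda>x. f' x - f x) + l2_norm M (\<lambda>x. g' x - g x)"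
    by (intro l2_norm_add_le square_integrable_diff f' g' fg)
  then have "l2_norm M (\<lambda>x. (f' x + g' x) - (f x + g x)) < e"
    using f'(3) g'(3) by (simp add: algebra_simps)
  ultimately show "\<exists>h\<in>square_integrable M. L2_class M h \<in> U \<and> l2_norm M (\<lambda>x. h x - (f x + g x)) < e"
    using f' g' by (intro bexI[of _ "\<lambda>x. f' x + g' x"]) auto
qed

lemma closure_functions_scale:
  assumes U: "vsubspace (L2_space M) U" and f: "f \<in> closure_functions M U"
  shows "(\<lambda>x. c * f x) \<in> closure_functions M U"
  unfolding closure_functions_iff[OF U]
proof (intro conjI allI impI)
  note fL = f[THEN closure_functions_L2]
  show "(\<lambda>x. c * f x) \<in> square_integrable M" using fL by auto
  fix e :: real assume e: "e > 0"
  have c: "cmod c + 1 > 0" by (simp add: add_nonneg_pos)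
  then have "e / (cmod c + 1) > 0" using e by simp
  then obtain g where g: "g \<in> square_integrable M" "L2_class M g \<in> U" "l2_norm M (\<lambda>x. g x - f x) < e / (cmod c + 1)"
    using f unfolding closure_functions_iff[OF U] by blast
  have "vscale (L2_space M) c (L2_class M g) \<in> U" using U g by (auto simp: vsubspace_def)
  then have "L2_class M (\<lambda>x. c * g x) \<in> U" using g by (simp add: vscale_L2)
  moreover have "l2_norm M (\<lambda>x. c * g x - c * f x) < e"
  proof -
    have "l2_norm M (\<lambda>x. c * g x - c * f x) = cmod c * l2_norm M (\<lambda>x. g x - f x)"
      by (simp add: l2_norm_scale flip: right_diff_distrib)
    also have "\<dots> \<le> (cmod c + 1) * l2_norm M (\<lambda>x. g x - f x)" by (intro mult_right_mono) auto
    also have "\<dots> < e" using g(3) c by (simp add: pos_less_divide_eq mult.commute)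
    finally show ?thesis .
  qed
  ultimately show "\<exists>h\<in>square_integrable M. L2_class M h \<in> U \<and> l2_norm M (\<lambda>x. h x - c * f x) < e"
    using g by (intro bexI[of _ "\<lambda>x. c * g x"]) auto
qed

lemma closure_functions_dominated:
  assumes U: "vsubspace (L2_space M) U" and f: "\<And>n::nat. f n \<in> closure_functions M U"
    and g: "g \<in> square_integrable M" and bound: "\<And>n x. cmod (f n x) \<le> C * cmod (g x)"
    and lim: "\<And>x. (\<lambda>n. f n x) \<longlonglongrightarrow> h x"
  shows "h \<in> closure_functions M U"
proof -
  have m: "f n \<in> borel_measurable M" for n using f[of n] closure_functions_L2 square_integrable_measurable by blast
  have "h \<in> borel_measurable M" by (rule borel_measurable_LIMSEQ_metric[OF m lim])
  note * = l2_dominated_convergence[OF g m this AE_I2[OF lim] AE_I2[OF bound]]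
  show ?thesis by (rule closure_functions_limit[OF U f *(1,3)])
qed

context normalized_measure
begin

text \<open>If a closed subspace contains \<open>k(t) / (t - z)\<close> for all nonreal \<open>z\<close>, where \<open>k\<close> has no zero, then it is
  everything. The real functions \<open>F\<close> for which \<open>F k\<close> lies in it form a class closed under dominated
  limits that contains the Poisson kernels, hence the indicators of intervals, then by a Dynkin
  argument those of all Borel sets; simple functions times \<open>k\<close> approximate any \<open>f = (f / k) k\<close>.\<close>

lemma closure_functions_total:
  assumes U: "vsubspace X U" and k: "k \<in> L2"
    and kernels: "\<And>z. Im z \<noteq> 0 \<Longrightarrow> (\<lambda>t. cauchy_kernel z t * k t) \<in> closure_functions \<omega> U"
    and nz: "\<And>t. k t \<noteq> 0" and f: "f \<in> L2"
  shows "f \<in> closure_functions \<omega> U"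
proof -
  let ?W = "closure_functions \<omega> U"
  define V where "V = {F :: real \<Rightarrow> real. (\<lambda>t. of_real (F t) * k t) \<in> ?W}"
  have zero: "(\<lambda>t. 0) \<in> ?W" using closure_functions_scale[OF U kernels[of \<i>], of 0] by simp
  have interval: "indicator {a<..b} \<in> V" if "a < b" for a b :: real
  proof (rule poisson_class_contains_intervals)
    fix x y :: real assume y: "y > 0"
    define z where "z = Complex x y"
    have z: "Im z \<noteq> 0" "Im (cnj z) \<noteq> 0" using y by (simp_all add: z_def)
    have "of_real (poisson_kernel x y t) * k t
        = - \<i> / 2 * (cauchy_kernel z t * k t) + \<i> / 2 * (cauchy_kernel (cnj z) t * k t)" for t
    proof -
      have "cauchy_kernel z t - cnj (cauchy_kernel z t) = of_real (2 * poisson_kernel x y t) * \<i>"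
        using Im_cauchy_kernel[OF y, of x t] by (simp only: complex_diff_cnj z_def)
      then have "of_real (poisson_kernel x y t) = - \<i> / 2 * (cauchy_kernel z t - cauchy_kernel (cnj z) t)"
        by (simp add: cnj_cauchy_kernel) (simp add: complex_eq_iff)
      then have "of_real (poisson_kernel x y t) * k t
          = - \<i> / 2 * (cauchy_kernel z t - cauchy_kernel (cnj z) t) * k t" by (rule arg_cong)
      then show ?thesis by (simp only: right_diff_distrib left_diff_distrib) (simp add: mult.assoc)
    qed
    then show "poisson_kernel x y \<in> V"
      using closure_functions_add[OF U closure_functions_scale[OF U kernels[OF z(1)], of "- \<i> / 2"]
          closure_functions_scale[OF U kernels[OF z(2)], of "\<i> / 2"]]
      by (simp add: V_def)
  next
    fix F G assume "F \<in> V" "G \<in> V"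
    then show "(\<lambda>t. F t + G t) \<in> V"
      using closure_functions_add[OF U, of "\<lambda>t. of_real (F t) * k t" "\<lambda>t. of_real (G t) * k t"]
      by (simp add: V_def distrib_right)
  next
    fix c F assume "F \<in> V"
    then show "(\<lambda>t. c * F t) \<in> V"
      using closure_functions_scale[OF U, of "\<lambda>t. of_real (F t) * k t" "of_real c"]
      by (simp add: V_def mult.assoc)
  next
    fix F h C assume F: "\<And>n::nat. F n \<in> V" and bound: "\<And>n t. \<bar>F n t\<bar> \<le> C / (1 + t\<^sup>2)"
      and lim: "\<And>t. (\<lambda>n. F n t) \<longlonglongrightarrow> h t"
    have C: "C \<ge> 0" using bound[of 0 0] by simp
    have "(\<lambda>t. of_real (h t) * k t) \<in> ?W"
    proof (rule closure_functions_dominated[OF U _ k])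
      show "(\<lambda>t. of_real (F n t) * k t) \<in> ?W" for n using F by (simp add: V_def)
      show "cmod (of_real (F n t) * k t) \<le> C * cmod (k t)" for n t
      proof -
        have "\<bar>F n t\<bar> \<le> C / (1 + t\<^sup>2)" by (rule bound)
        also have "\<dots> \<le> C / 1" using C by (intro divide_left_mono) (auto simp: add_pos_nonneg)
        finally show ?thesis by (auto simp: norm_mult intro: mult_right_mono)
      qed
      show "(\<lambda>n. of_real (F n t) * k t) \<longlonglongrightarrow> of_real (h t) * k t" for t
        by (intro tendsto_intros lim)
    qed
    then show "h \<in> V" by (simp add: V_def)
  qed fact
  have ind_norm: "cmod (indicator A t * a) \<le> 1 * cmod a" for A and t :: real and a
    by (auto simp: indicator_def)
  have set_in: "(\<lambda>t. indicator A t * k t) \<in> ?W" if "A \<in> sets borel" for A :: "real set"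
  proof -
    have whole: "k \<in> ?W"
    proof (rule closure_functions_dominated[OF U _ k])
      have "(\<lambda>t. of_real (indicator {- real (Suc n)<..real (Suc n)} t) * k t) \<in> ?W" for n
        using interval[of "- real (Suc n)" "real (Suc n)"] by (simp add: V_def)
      then show "(\<lambda>t. indicator {- real (Suc n)<..real (Suc n)} t * k t) \<in> ?W" for n
        by (simp add: of_real_indicator)
      show "cmod (indicator {- real (Suc n)<..real (Suc n)} t * k t) \<le> 1 * cmod (k t)" for n t
        by (rule ind_norm)
      show "(\<lambda>n. indicator {- real (Suc n)<..real (Suc n)} t * k t) \<longlonglongrightarrow> k t" for t
      proof (rule tendsto_eventually)
        obtain N where "\<bar>t\<bar> \<le> real N" using real_arch_simple by blast
        then have "indicator {- real (Suc n)<..real (Suc n)} t * k t = k t" if "N \<le> n" for n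
          using that by (auto simp: indicator_def)
        then show "\<forall>\<^sub>F n in sequentially. indicator {- real (Suc n)<..real (Suc n)} t * k t = k t"
          unfolding eventually_sequentially by blast
      qed
    qed
    let ?G = "range (\<lambda>(a, b). {a<..b::real})"
    have "Int_stable ?G"
    proof (rule Int_stableI)
      fix A B assume "A \<in> ?G" "B \<in> ?G"
      then obtain a b c d where "A = {a<..b}" "B = {c<..d}" by auto
      then have "A \<inter> B = (case (max a c, min b d) of (a, b) \<Rightarrow> {a<..b})" by auto
      then show "A \<inter> B \<in> ?G" by blast
    qed
    moreover have "?G \<subseteq> Pow UNIV" by simp
    moreover have "A \<in> sigma_sets UNIV ?G" using that by (simp add: borel_sigma_sets_Ioc)
    ultimately show ?thesis
    proof (induction rule: sigma_sets_induct_disjoint)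
      case (basic B)
      then obtain a b where B: "B = {a<..b}" by auto
      show ?case
      proof (cases "a < b")
        case True
        then show ?thesis using interval[OF True] by (simp add: V_def B of_real_indicator)
      qed (use zero in \<open>simp add: B\<close>)
    next
      case empty
      then show ?case using zero by simp
    next
      case (compl B)
      have "(\<lambda>t. indicator (UNIV - B) t * k t) = (\<lambda>t. k t + - 1 * (indicator B t * k t))"
        by (auto simp: indicator_def)
      then show ?case
        using closure_functions_add[OF U whole closure_functions_scale[OF U compl(2), of "- 1"]] by simp
    next
      case (union B)
      show ?case
      proof (rule closure_functions_dominated[OF U _ k])
        show "(\<lambda>t. indicator (\<Union>i<n. B i) t * k t) \<in> ?W" for n
        proof (induction n)
          case (Suc n)
          have "disjnt (B n) (\<Union>i<n. B i)"
          proof -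
            have "B n \<inter> B i = {}" if "i < n" for i
              using union(1) that by (intro disjoint_family_onD[of B UNIV]) auto
            then show ?thesis by (auto simp: disjnt_def)
          qed
          then have "(\<lambda>t. indicator (\<Union>i<Suc n. B i) t * k t)
              = (\<lambda>t. indicator (\<Union>i<n. B i) t * k t + indicator (B n) t * k t)"
            by (auto simp: indicator_def lessThan_Suc disjnt_def fun_eq_iff)
          then show ?case using closure_functions_add[OF U Suc union(3)[of n]] by simp
        qed (use zero in simp)
        show "cmod (indicator (\<Union>i<n. B i) t * k t) \<le> 1 * cmod (k t)" for n t by (rule ind_norm)
        show "(\<lambda>n. indicator (\<Union>i<n. B i) t * k t) \<longlonglongrightarrow> indicator (\<Union>i. B i) t * k t" for t
          by (intro tendsto_mult_right LIMSEQ_indicator_UN)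
      qed
    qed
  qed
  note [measurable] = square_integrable_measurable[OF f] square_integrable_measurable[OF k]
  define h where "h t = f t / k t" for t
  have "h \<in> borel_measurable \<omega>" unfolding h_def by measurable
  then obtain s where s: "\<And>n. simple_function \<omega> (s n)" "\<And>t. t \<in> space \<omega> \<Longrightarrow> (\<lambda>n. s n t) \<longlonglongrightarrow> h t"
    "\<And>n t. t \<in> space \<omega> \<Longrightarrow> dist (s n t) 0 \<le> 2 * dist (h t) 0"
    using borel_measurable_implies_sequence_metric[of h \<omega> 0] by metis
  show ?thesis
  proof (rule closure_functions_dominated[OF U _ f])
    show "(\<lambda>t. s n t * k t) \<in> ?W" for n
    proof -
      have fin: "finite (range (s n))" using s(1)[of n] by (simp add: simple_function_def)
      have "s n t * k t = (\<Sum>y\<in>range (s n). y * (indicator (s n -` {y}) t * k t))" for t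
      proof -
        have "s n t = (\<Sum>y\<in>range (s n). indicator (s n -` {y}) t *\<^sub>R y)"
          using simple_function_indicator_representation_banach[OF s(1)[of n], of t] by (simp only: space_\<omega> UNIV_I Int_UNIV_right)
        then have "s n t * k t = (\<Sum>y\<in>range (s n). indicator (s n -` {y}) t *\<^sub>R y) * k t" by (rule arg_cong)
        also have "\<dots> = (\<Sum>y\<in>range (s n). y * (indicator (s n -` {y}) t * k t))"
          unfolding sum_distrib_right by (rule sum.cong) (auto simp: indicator_def)
        finally show ?thesis .
      qed
      moreover have "(\<lambda>t. \<Sum>y\<in>Y. y * (indicator (s n -` {y}) t * k t)) \<in> ?W" if "finite Y" for Y
        using that
      proof (induction Y rule: finite_induct)
        case (insert y Y)
        have "s n -` {y} \<in> sets borel"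
          using simple_functionD(2)[OF s(1)[of n], of "{y}"] by simp
        from closure_functions_add[OF U closure_functions_scale[OF U set_in[OF this], of y] insert.IH]
        show ?case using insert.hyps by simp
      qed (use zero in simp)
      ultimately show ?thesis using fin by presburger
    qed
    show "cmod (s n t * k t) \<le> 2 * cmod (f t)" for n t
    proof -
      have "cmod (s n t) \<le> 2 * cmod (h t)" using s(3)[of t n] by simp
      then have "cmod (s n t) * cmod (k t) \<le> 2 * cmod (h t) * cmod (k t)" by (rule mult_right_mono) simp
      also have "\<dots> = 2 * cmod (f t)" using nz[of t] by (simp add: h_def norm_divide)
      finally show ?thesis by (simp add: norm_mult)
    qed
    show "(\<lambda>n. s n t * k t) \<longlonglongrightarrow> f t" for t
      using tendsto_mult_right[OF s(2)[of t], of "k t"] nz[of t] by (simp add: h_def)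
  qed
qed

lemma prime_dot: "prime_operator X (mult_op_dot \<omega>)"
  unfolding prime_operator_def
proof (intro exI[of _ "mult_op \<omega>"] conjI)
  show "self_adjoint X (mult_op \<omega>)" by (rule self_adjoint_mult_op)
  show "mult_op_dot \<omega> \<subseteq> mult_op \<omega>" by (rule dot_subset)
  let ?K = "kernel_op X (shift_op X (adjoint_op X (mult_op_dot \<omega>)) \<i>)"
  define U where "U = (\<Union>z\<in>{z. Im z \<noteq> 0}. (shift_op X (mult_op \<omega>) z)\<inverse> `` ?K)"
  have U: "U \<subseteq> vecs X" unfolding U_def using shift_op_L2_subset[OF mult_op_subset] by fast
  have sub: "vsubspace X (vspan X U)" by (rule vsubspace_vspan[OF vsubspace_vecs_L2 U])
  have kernels: "(\<lambda>t. cauchy_kernel z t * cauchy_kernel \<i> t) \<in> closure_functions \<omega> (vspan X U)" if z: "Im z \<noteq> 0" for z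
  proof (rule closure_functions_base[OF sub])
    show k: "(\<lambda>t. cauchy_kernel z t * cauchy_kernel \<i> t) \<in> L2" using z by auto
    have "(cls (\<lambda>t. cauchy_kernel z t * cauchy_kernel \<i> t), cls (cauchy_kernel \<i>)) \<in> shift_op X (mult_op \<omega>) z"
      using z k by (simp add: shift_op_L2_iff[OF mult_op_subset] mult_op_iff of_real_mult_kernel_mult)
    moreover have "cls (cauchy_kernel \<i>) \<in> ?K"
      by (subst kernel_op_adjoint_dot) (auto intro: image_eqI[of _ _ 1])
    ultimately have "cls (\<lambda>t. cauchy_kernel z t * cauchy_kernel \<i> t) \<in> U" using z unfolding U_def by blast
    then show "cls (\<lambda>t. cauchy_kernel z t * cauchy_kernel \<i> t) \<in> vspan X U"
      unfolding vspan_def by (rule hull_inc)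
  qed
  have nz: "cauchy_kernel \<i> t \<noteq> 0" for t
    using nonreal_diff_nonzero[of \<i> t] by (simp add: cauchy_kernel_def)
  have "f \<in> closure_functions \<omega> (vspan X U)" if "f \<in> L2" for f
    by (rule closure_functions_total[OF sub _ kernels nz that]) auto
  then have "vecs X \<subseteq> vclosure X (vspan X U)"
    by (auto simp: vecs_L2 closure_functions_def)
  then show "vclosure X (vspan X U) = vecs X" by (auto simp: vclosure_def)
qed

lemma prime_symmetric_dot: "prime_symmetric_operator_11 X (mult_op_dot \<omega>)"
  using densely_defined_dot closed_dot symmetric_dot deficiency_indices_dot prime_dot
  by (simp add: prime_symmetric_operator_11_def)

end

section \<open>The half-plane representation\<close>

lemma has_bochner_integral_dominated:
  fixes F :: "nat \<Rightarrow> 'a \<Rightarrow> real"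
  assumes "\<And>n. has_bochner_integral M (F n) (r n)" "integrable M w" "\<And>n x. \<bar>F n x\<bar> \<le> w x"
    and lim: "\<And>x. (\<lambda>n. F n x) \<longlonglongrightarrow> h x"
  shows "integrable M h" "r \<longlonglongrightarrow> integral\<^sup>L M h"
proof -
  have m: "F n \<in> borel_measurable M" for n using assms(1)[of n] by (auto simp: has_bochner_integral_iff)
  have h: "h \<in> borel_measurable M" by (rule borel_measurable_LIMSEQ_metric[OF m lim])
  have bnd: "AE x in M. norm (F n x) \<le> w x" for n using assms(3) by simp
  show "integrable M h" by (rule integrable_dominated_convergence[OF h m assms(2) AE_I2[OF lim] bnd])
  have "(\<lambda>n. integral\<^sup>L M (F n)) \<longlonglongrightarrow> integral\<^sup>L M h"
    by (rule integral_dominated_convergence[OF h m assms(2) AE_I2[OF lim] bnd])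
  then show "r \<longlonglongrightarrow> integral\<^sup>L M h"
    using assms(1) by (simp add: has_bochner_integral_iff)
qed

lemma has_integral_weight_lborel: "has_bochner_integral lborel (\<lambda>t::real. inverse (1 + t\<^sup>2)) pi"
  using integrable_inverse_1_plus_square LBINT_inverse_1_plus_square
  by (simp add: has_bochner_integral_iff set_integrable_def interval_lebesgue_integral_def
      set_lebesgue_integral_def einterval_def)

lemma has_integral_poisson_lborel:
  assumes "y > 0"
  shows "has_bochner_integral lborel (poisson_kernel x y) pi"
proof -
  have "has_bochner_integral lborel (\<lambda>t. inverse (1 + (- x / y + 1 / y * t)\<^sup>2)) (pi /\<^sub>R \<bar>1 / y\<bar>)"
    using assms has_integral_weight_lborel by (subst lborel_has_bochner_integral_real_affine_iff[symmetric]) auto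
  then have "has_bochner_integral lborel (\<lambda>t. 1 / y * inverse (1 + (- x / y + 1 / y * t)\<^sup>2)) (1 / y * (pi /\<^sub>R \<bar>1 / y\<bar>))"
    by (rule has_bochner_integral_mult_right[rotated])
  moreover have "1 / y * inverse (1 + (- x / y + 1 / y * t)\<^sup>2) = poisson_kernel x y t" for t
  proof -
    have "1 + (- x / y + 1 / y * t)\<^sup>2 = ((t - x)\<^sup>2 + y\<^sup>2) / y\<^sup>2"
    proof -
      have "- x / y + 1 / y * t = (t - x) / y" by (simp add: diff_divide_distrib)
      then show ?thesis using assms by (simp add: power_divide add_divide_distrib)
    qed
    then show ?thesis using assms by (simp add: poisson_kernel_def power2_eq_square)
  qed
  ultimately show ?thesis using assms by simp
qed

definition weyl_integrand :: "complex \<Rightarrow> real \<Rightarrow> complex" where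
  "weyl_integrand z t = inverse (of_real t - z) - of_real (t * inverse (1 + t\<^sup>2))"

lemma weyl_integrand_cnj: "weyl_integrand (cnj z) t = cnj (weyl_integrand z t)"
  by (simp add: weyl_integrand_def)

lemma weyl_integrand_eq:
  "weyl_integrand z t = 1 / 2 * (cauchy_kernel z t - cauchy_kernel \<i> t)
     + 1 / 2 * (cauchy_kernel z t - cauchy_kernel (- \<i>) t)"
proof -
  have "cauchy_kernel (- \<i>) t = cnj (cauchy_kernel \<i> t)" by (simp add: cnj_cauchy_kernel)
  then have "cauchy_kernel (- \<i>) t = (of_real t - \<i>) / of_real (1 + t\<^sup>2)" by (simp add: cauchy_kernel_i)
  moreover have "(a + \<i>) * b + (a - \<i>) * b = 2 * (a * b)" for a b :: complex
    by (simp add: algebra_simps)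
  ultimately have "cauchy_kernel \<i> t + cauchy_kernel (- \<i>) t = 2 * of_real (t * inverse (1 + t\<^sup>2))"
    by (simp add: cauchy_kernel_i divide_inverse)
  then have half: "of_real (t * inverse (1 + t\<^sup>2)) = (cauchy_kernel \<i> t + cauchy_kernel (- \<i>) t) / 2"
    by simp
  have split: "c - (a + b) / 2 = 1 / 2 * (c - a) + 1 / 2 * (c - b)" for a b c :: complex
    by (simp add: field_simps)
  have "weyl_integrand z t = cauchy_kernel z t - of_real (t * inverse (1 + t\<^sup>2))"
    by (simp add: weyl_integrand_def cauchy_kernel_def divide_inverse)
  then show ?thesis unfolding half by (simp only: split)
qed

context normalized_measure
begin

lemma half_plane_representation_eq:
  "half_plane_representation \<omega> \<longleftrightarrow> (\<forall>z. (Im z > 0 \<longrightarrow> integral\<^sup>L \<omega> (weyl_integrand z) = \<i>) \<and>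
    (Im z < 0 \<longrightarrow> integral\<^sup>L \<omega> (weyl_integrand z) = - \<i>))"
  by (simp add: half_plane_representation_def weyl_integrand_def[abs_def])

text \<open>As \<open>1/(t - \<i>) - 1/(t + \<i>) = 2 \<i> / (1 + t\<^sup>2)\<close>, the normalization of \<open>\<omega>\<close> gives the values.\<close>

lemma kernel_pairing_i: "kernel_pairing (- \<i>) \<i> = 2 * \<i>" "kernel_pairing \<i> (- \<i>) = - 2 * \<i>"
proof -
  show *: "kernel_pairing (- \<i>) \<i> = 2 * \<i>" by (simp add: kernel_pairing_def ip_cauchy_kernel_i)
  have "has_bochner_integral \<omega> (\<lambda>t. - (cauchy_kernel \<i> t - cauchy_kernel (- \<i>) t)) (- kernel_pairing (- \<i>) \<i>)"
    by (intro has_bochner_integral_minus kernel_pairing_integral) auto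
  then have "has_bochner_integral \<omega> (\<lambda>t. cauchy_kernel (- \<i>) t - cauchy_kernel \<i> t) (- kernel_pairing (- \<i>) \<i>)"
    by simp
  from has_bochner_integral_eq[OF this kernel_pairing_integral[of \<i> "- \<i>"]]
  show "kernel_pairing \<i> (- \<i>) = - 2 * \<i>" using * by simp
qed

lemma weyl_integral:
  assumes z: "Im z \<noteq> 0" and s: "s \<in> {\<i>, - \<i>}"
  shows "has_bochner_integral \<omega> (weyl_integrand z) (kernel_pairing s z + s)"
proof -
  have *: "has_bochner_integral \<omega> (\<lambda>t. (cauchy_kernel z t - cauchy_kernel r t) + (cauchy_kernel r t - cauchy_kernel s t))
      (kernel_pairing r z + kernel_pairing s r)" if "Im r \<noteq> 0" "Im s \<noteq> 0" for r s
    using that z by (intro has_bochner_integral_add kernel_pairing_integral)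
  have chain: "kernel_pairing s z = kernel_pairing r z + kernel_pairing s r" if "Im r \<noteq> 0" "Im s \<noteq> 0" for r s
    using has_bochner_integral_eq[OF kernel_pairing_integral[OF that(2) z]] *[OF that] by simp
  have "has_bochner_integral \<omega> (weyl_integrand z) (1 / 2 * kernel_pairing \<i> z + 1 / 2 * kernel_pairing (- \<i>) z)"
    unfolding weyl_integrand_eq[abs_def]
    using z by (intro has_bochner_integral_add has_bochner_integral_mult_right kernel_pairing_integral) auto
  moreover have "1 / 2 * kernel_pairing \<i> z + 1 / 2 * kernel_pairing (- \<i>) z = kernel_pairing s z + s"
    using s chain[of "- \<i>" \<i>] chain[of \<i> "- \<i>"] by (auto simp: kernel_pairing_i field_simps)
  ultimately show ?thesis by simp
qed

text \<open>Conjugation exchanges the half-planes, so one of them suffices; there the integral has the value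
  \<open>s\<close> at \<open>s\<close>, and \<^const>\<open>kernel_pairing\<close> is its deviation from that value.\<close>

lemma half_plane_representation_iff:
  assumes s: "s \<in> {\<i>, - \<i>}"
  shows "half_plane_representation \<omega> \<longleftrightarrow> (\<forall>z. Im z * Im s > 0 \<longrightarrow> kernel_pairing s z = 0)"
proof -
  define m where "m z = integral\<^sup>L \<omega> (weyl_integrand z)" for z
  have m: "m z = kernel_pairing s z + s" if "Im z \<noteq> 0" for z
    using weyl_integral[OF that s] by (simp add: m_def has_bochner_integral_iff)
  have cnj: "m (cnj z) = cnj (m z)" for z
    by (simp add: m_def weyl_integrand_cnj[abs_def])
  have "half_plane_representation \<omega> \<longleftrightarrow> (\<forall>z. Im z * Im s > 0 \<longrightarrow> m z = s \<and> m (cnj z) = - s)"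
  proof
    assume "half_plane_representation \<omega>"
    then show "\<forall>z. Im z * Im s > 0 \<longrightarrow> m z = s \<and> m (cnj z) = - s"
      using s by (auto simp: half_plane_representation_eq m_def)
  next
    assume r: "\<forall>z. Im z * Im s > 0 \<longrightarrow> m z = s \<and> m (cnj z) = - s"
    show "half_plane_representation \<omega>"
      unfolding half_plane_representation_eq m_def[symmetric]
      using s r[rule_format, of z for z] r[rule_format, of "cnj z" for z] by auto
  qed
  also have "\<dots> \<longleftrightarrow> (\<forall>z. Im z * Im s > 0 \<longrightarrow> m z = s)" using s by (auto simp: cnj)
  also have "\<dots> \<longleftrightarrow> (\<forall>z. Im z * Im s > 0 \<longrightarrow> kernel_pairing s z = 0)"
  proof -
    have "m z = s \<longleftrightarrow> kernel_pairing s z = 0" if "Im z * Im s > 0" for z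
    proof -
      have "Im z \<noteq> 0" using that by auto
      then show ?thesis by (simp add: m)
    qed
    then show ?thesis by blast
  qed
  finally show ?thesis .
qed

text \<open>The imaginary part of the representation says that all Poisson integrals of \<open>\<omega>\<close> are \<open>1\<close>, as they are
  for \<open>\<pi>\<^sup>-\<^sup>1\<close> times Lebesgue measure. Functions with equal integrals for both measures form a class to
  which Stieltjes inversion applies.\<close>

lemma half_plane_representation_lebesgue:
  assumes "half_plane_representation \<omega>"
  shows "\<omega> = density lborel (\<lambda>t. ennreal (1 / pi))"
proof -
  define V where "V = {F. \<exists>r. has_bochner_integral \<omega> F r \<and> has_bochner_integral lborel F (pi * r)}"
  have interval: "indicator {a<..b} \<in> V" if "a < b" for a b :: real
  proof (rule poisson_class_contains_intervals)
    fix x y :: real assume y: "y > 0"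
    have "has_bochner_integral \<omega> (weyl_integrand (Complex x y)) \<i>"
      using assms weyl_integral[of "Complex x y" \<i>] y
      by (simp add: half_plane_representation_eq has_bochner_integral_iff)
    then have "has_bochner_integral \<omega> (\<lambda>t. Im (weyl_integrand (Complex x y) t)) (Im \<i>)"
      by (rule has_bochner_integral_Im)
    moreover have "Im (weyl_integrand (Complex x y) t) = poisson_kernel x y t" for t
      using Im_cauchy_kernel[OF y, of x t] by (simp add: weyl_integrand_def cauchy_kernel_def divide_inverse)
    ultimately have "has_bochner_integral \<omega> (poisson_kernel x y) 1" by simp
    then show "poisson_kernel x y \<in> V"
      using has_integral_poisson_lborel[OF y, of x] unfolding V_def by (auto intro!: exI[of _ 1])
  next
    fix F G assume "F \<in> V" "G \<in> V"
    then show "(\<lambda>t. F t + G t) \<in> V"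
      unfolding V_def by (force intro: has_bochner_integral_add simp: distrib_left)
  next
    fix c F assume "F \<in> V"
    then obtain r where "has_bochner_integral \<omega> F r" "has_bochner_integral lborel F (pi * r)" by (auto simp: V_def)
    then have "has_bochner_integral \<omega> (\<lambda>t. c * F t) (c * r)" "has_bochner_integral lborel (\<lambda>t. c * F t) (c * (pi * r))"
      by (simp_all add: has_bochner_integral_mult_right)
    then show "(\<lambda>t. c * F t) \<in> V"
      unfolding V_def by (auto simp: mult.left_commute)
  next
    fix F h C assume F: "\<And>n::nat. F n \<in> V" and bound: "\<And>n t. \<bar>F n t\<bar> \<le> C / (1 + t\<^sup>2)"
      and lim: "\<And>t. (\<lambda>n. F n t) \<longlonglongrightarrow> h t"
    obtain r where r: "\<And>n. has_bochner_integral \<omega> (F n) (r n)" "\<And>n. has_bochner_integral lborel (F n) (pi * r n)"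
      using F unfolding V_def mem_Collect_eq by metis
    have "integrable \<omega> (\<lambda>t. C * (1 / (1 + t\<^sup>2)))"
      using has_integral_weight by (intro integrable_mult_right) (simp add: has_bochner_integral_iff)
    then have w: "integrable \<omega> (\<lambda>t. C / (1 + t\<^sup>2))" by simp
    have "integrable lborel (\<lambda>t. C * inverse (1 + t\<^sup>2))"
      using has_integral_weight_lborel by (intro integrable_mult_right) (simp add: has_bochner_integral_iff)
    then have w': "integrable lborel (\<lambda>t. C / (1 + t\<^sup>2))" by (simp add: divide_inverse)
    note 1 = has_bochner_integral_dominated[OF r(1) w bound lim]
    note 2 = has_bochner_integral_dominated[OF r(2) w' bound lim]
    have "integral\<^sup>L lborel h = pi * integral\<^sup>L \<omega> h"
      using LIMSEQ_unique[OF 2(2) tendsto_mult_left[OF 1(2)]] .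
    then show "h \<in> V" using 1(1) 2(1) by (auto simp: V_def has_bochner_integral_iff)
  qed fact
  let ?G = "range (\<lambda>(a, b). {a<..b::real})" and ?L = "density lborel (\<lambda>t. ennreal (1 / pi))"
  have em: "emeasure \<omega> {a<..b} = emeasure ?L {a<..b}" "emeasure \<omega> {a<..b} < \<infinity>" for a b :: real
  proof -
    have "emeasure \<omega> {a<..b} = emeasure ?L {a<..b} \<and> emeasure \<omega> {a<..b} < \<infinity>"
    proof (cases "a < b")
      case True
      obtain r where r: "has_bochner_integral \<omega> (indicator {a<..b} :: real \<Rightarrow> real) r"
        "has_bochner_integral lborel (indicator {a<..b} :: real \<Rightarrow> real) (pi * r)"
        using interval[OF True] by (auto simp: V_def)
      have fin: "emeasure \<omega> {a<..b} < \<infinity>" and "measure \<omega> {a<..b} = r"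
        using r(1) by (auto simp: has_bochner_integral_iff integrable_indicator_iff)
      moreover have "b - a = pi * r" using r(2) True by (simp add: has_bochner_integral_iff)
      ultimately have "emeasure \<omega> {a<..b} = ennreal ((b - a) / pi)"
        by (simp add: emeasure_eq_ennreal_measure less_top)
      moreover have "emeasure ?L {a<..b} = ennreal (1 / pi) * ennreal (b - a)"
        using True by (simp add: emeasure_density nn_integral_cmult)
      then have "emeasure ?L {a<..b} = ennreal ((b - a) / pi)"
        using True by (simp add: ennreal_mult[symmetric])
      ultimately show ?thesis using fin by simp
    qed simp
    then show "emeasure \<omega> {a<..b} = emeasure ?L {a<..b}" "emeasure \<omega> {a<..b} < \<infinity>" by auto
  qed
  show ?thesis
  proof (rule measure_eqI_generator_eq[where E = ?G and \<Omega> = UNIV and A = "\<lambda>n. {- real n<..real n}"])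
    show "Int_stable ?G"
    proof (rule Int_stableI)
      fix A B assume "A \<in> ?G" "B \<in> ?G"
      then obtain a b c d where "A = {a<..b}" "B = {c<..d}" by auto
      then have "A \<inter> B = (case (max a c, min b d) of (a, b) \<Rightarrow> {a<..b})" by auto
      then show "A \<inter> B \<in> ?G" by blast
    qed
    show "emeasure \<omega> A = emeasure ?L A" if "A \<in> ?G" for A using that em by auto
    show "range (\<lambda>n. {- real n<..real n}) \<subseteq> ?G" by auto
    show "(\<Union>n. {- real n<..real n}) = UNIV"
    proof (intro set_eqI iffI UNIV_I)
      fix t :: real
      obtain N where "\<bar>t\<bar> < real N" using reals_Archimedean2 by blast
      then show "t \<in> (\<Union>n. {- real n<..real n})" by (intro UN_I[of N]) auto
    qed
    show "emeasure \<omega> {- real n<..real n} \<noteq> \<infinity>" for n using em(2)[of "- real n" "real n"] by simp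
  qed (simp_all add: borel_sigma_sets_Ioc)
qed

text \<open>An eigenfunction at a real point \<open>z\<close> is proportional to \<open>1 / (t - z)\<close> away from \<open>z\<close>, which is not square
  integrable near \<open>z\<close> for Lebesgue measure.\<close>

lemma real_not_eigenvalue:
  assumes \<omega>: "\<omega> = density lborel (\<lambda>t. ennreal (1 / pi))" and S: "S \<subseteq> adjoint_op X (mult_op_dot \<omega>)"
    and z: "Im z = 0"
  shows "z \<notin> eigenvalues X S"
proof
  define x where "x = Re z"
  have zx: "z = of_real x" using z by (simp add: x_def complex_eq_iff)
  assume "z \<in> eigenvalues X S"
  moreover have "S \<subseteq> vecs X \<times> vecs X" using S adjoint_op_subset by blast
  ultimately obtain f where f: "f \<in> L2" "\<not> (AE t in \<omega>. f t = 0)" "(cls f, cls (\<lambda>t. z * f t)) \<in> S"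
    using eigenvalues_L2_iff by blast
  then have "(cls f, cls (\<lambda>t. z * f t)) \<in> adjoint_op X (mult_op_dot \<omega>)" using S by blast
  then obtain c where c: "AE t in \<omega>. z * f t = of_real t * f t - c"
    using f(1) by (auto simp: adjoint_dot_iff)
  then have c: "AE t in \<omega>. of_real (t - x) * f t = c"
    by eventually_elim (simp add: zx algebra_simps)
  have "AE t in \<omega>. t \<noteq> x"
    by (subst \<omega>) (use AE_lborel_singleton[of x] in \<open>simp add: AE_density\<close>)
  with c have fx: "AE t in \<omega>. f t = c / of_real (t - x)"
    by eventually_elim (auto simp: field_simps simp del: of_real_diff)
  then have "c \<noteq> 0" using f(2) by auto
  define I where "I = (\<integral>t. (cmod (f t))\<^sup>2 \<partial>\<omega>)"
  have I: "I \<ge> 0" by (simp add: I_def)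
  \<comment> \<open>On \<open>(x, x + e]\<close>, of measure \<open>e / \<pi>\<close>, the square \<open>|f|\<^sup>2\<close> is at least \<open>|c|\<^sup>2 / e\<^sup>2\<close>; this \<open>e\<close> makes the resulting
    lower bound for \<open>I\<close> equal to \<open>I + 1\<close>.\<close>
  define e where "e = (cmod c)\<^sup>2 / (pi * (I + 1))"
  have e: "e > 0" using \<open>c \<noteq> 0\<close> I by (simp add: e_def)
  have em: "emeasure \<omega> {x<..x + e} = ennreal (e / pi)"
    by (subst \<omega>) (use e in \<open>simp add: emeasure_density nn_integral_cmult ennreal_mult[symmetric]\<close>)
  have "(\<integral>t. (cmod c / e)\<^sup>2 * indicator {x<..x + e} t \<partial>\<omega>) \<le> I"
    unfolding I_def
  proof (rule integral_mono_AE)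
    show "integrable \<omega> (\<lambda>t. (cmod c / e)\<^sup>2 * indicator {x<..x + e} t)"
      using em by (intro integrable_mult_right integrable_real_indicator) auto
    show "AE t in \<omega>. (cmod c / e)\<^sup>2 * indicator {x<..x + e} t \<le> (cmod (f t))\<^sup>2"
      using fx
    proof eventually_elim
      fix t assume ft: "f t = c / of_real (t - x)"
      have "cmod c / e \<le> cmod (f t)" if "x < t" "t \<le> x + e"
        using that e unfolding ft norm_divide norm_of_real by (intro divide_left_mono) auto
      then show "(cmod c / e)\<^sup>2 * indicator {x<..x + e} t \<le> (cmod (f t))\<^sup>2"
        using e by (auto simp: indicator_def intro!: power_mono)
    qed
  qed (use f square_integrable_norm in auto)
  moreover have "(\<integral>t. (cmod c / e)\<^sup>2 * indicator {x<..x + e} t \<partial>\<omega>) = (cmod c / e)\<^sup>2 * (e / pi)"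
    using em e by (simp add: measure_def)
  moreover have "(cmod c / e)\<^sup>2 * (e / pi) = (cmod c)\<^sup>2 / (pi * e)"
    using e by (simp add: power2_eq_square)
  moreover have "(cmod c)\<^sup>2 / (pi * e) = I + 1"
    using I \<open>c \<noteq> 0\<close> by (simp add: e_def)
  ultimately show False by simp
qed

text \<open>Both half-planes are treated at once: \<open>Im z * Im s > 0\<close> says that \<open>z\<close> lies on the same side as
  \<open>s = \<plusminus> \<i>\<close>. Given the representation, \<^const>\<open>kernel_pairing\<close> has the value \<open>- 2 s\<close> on the opposite side, so that the resolvent of the
  extension by \<open>1 / (t - s)\<close> exists there.\<close>

theorem quasi_hermitian_extension_half_plane:
  assumes s: "s \<in> {\<i>, - \<i>}"
  shows "(\<exists>S. quasi_hermitian_extension X (mult_op_dot \<omega>) S \<and>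
      eigenvalues X S = {z. Im z * Im s > 0} \<and> op_spectrum X S = {z. Im z * Im s \<ge> 0})
    \<longleftrightarrow> half_plane_representation \<omega>"
proof
  have s0: "Im s \<noteq> 0" using s by auto
  assume "\<exists>S. quasi_hermitian_extension X (mult_op_dot \<omega>) S \<and>
      eigenvalues X S = {z. Im z * Im s > 0} \<and> op_spectrum X S = {z. Im z * Im s \<ge> 0}"
  then obtain S where S: "closed_operator X S" "mult_op_dot \<omega> \<subset> S" "S \<subset> adjoint_op X (mult_op_dot \<omega>)"
    and ev: "eigenvalues X S = {z. Im z * Im s > 0}"
    unfolding quasi_hermitian_extension_def by blast
  have lin: "linear_operator X S" using S(1) by (simp add: closed_operator_def)
  have kernels: "(cls (cauchy_kernel z), cls (\<lambda>t. z * cauchy_kernel z t)) \<in> S" if "Im z * Im s > 0" for z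
  proof -
    have "Im z \<noteq> 0" using that by auto
    then show ?thesis
      by (rule kernel_of_eigenvalue[OF lin psubset_imp_subset[OF S(3)]]) (simp add: ev that)
  qed
  show "half_plane_representation \<omega>"
    unfolding half_plane_representation_iff[OF s]
  proof (intro allI impI)
    fix z assume z: "Im z * Im s > 0"
    then have "Im z \<noteq> 0" by auto
    moreover have "Im s * Im s > 0" using s0 by (simp add: zero_less_mult_iff) linarith
    ultimately show "kernel_pairing s z = 0"
      using proper_extension_kernel_pairing[OF lin psubset_imp_subset[OF S(2)] S(3) s0] kernels z by blast
  qed
next
  have s0: "Im s \<noteq> 0" using s by auto
  assume rep: "half_plane_representation \<omega>"
  let ?E = "kernel_extension s"
  note sub = kernel_extension_subset[of s]
  have sub_adj: "?E \<subseteq> adjoint_op X (mult_op_dot \<omega>)"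
    unfolding kernel_extension_def by (rule kernel_restriction_subset)
  have \<omega>: "\<omega> = density lborel (\<lambda>t. ennreal (1 / pi))" by (rule half_plane_representation_lebesgue[OF rep])
  have same: "kernel_pairing s z = 0" if "Im z * Im s > 0" for z
    using rep that half_plane_representation_iff[OF s] by blast
  have opposite: "kernel_pairing s z \<noteq> 0" if "Im z * Im s < 0" for z
  proof -
    have z: "Im z \<noteq> 0" using that by auto
    have "integral\<^sup>L \<omega> (weyl_integrand z) = - s"
      using rep s that by (auto simp: half_plane_representation_eq)
    then have "kernel_pairing s z + s = - s"
      using weyl_integral[OF z s] by (simp add: has_bochner_integral_iff)
    then show ?thesis using s by auto
  qed
  have ev: "eigenvalues X ?E = {z. Im z * Im s > 0}"
  proof (intro set_eqI)
    fix z
    show "z \<in> eigenvalues X ?E \<longleftrightarrow> z \<in> {z. Im z * Im s > 0}"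
    proof (cases "Im z = 0")
      case True
      then show ?thesis using real_not_eigenvalue[OF \<omega> sub_adj True] by simp
    next
      case False
      then have "Im z * Im s > 0 \<or> Im z * Im s < 0" using s0 by (simp add: neq_iff zero_less_mult_iff mult_less_0_iff) linarith
      then show ?thesis using nonreal_eigenvalue_iff[OF s0 False] same[of z] opposite[of z] by auto
    qed
  qed
  have spec: "op_spectrum X ?E = {z. Im z * Im s \<ge> 0}"
  proof (intro set_eqI)
    fix z
    show "z \<in> op_spectrum X ?E \<longleftrightarrow> z \<in> {z. Im z * Im s \<ge> 0}"
    proof (cases "Im z * Im s < 0")
      case True
      then have "Im z \<noteq> 0" by auto
      from kernel_extension_resolvent[OF s0 this opposite[OF True]] True show ?thesis
        by (simp add: op_spectrum_def)
    next
      case False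
      have "z \<in> op_spectrum X ?E"
      proof (rule spectrum_near_eigenvalues[OF sub])
        fix e :: real assume e: "e > 0"
        \<comment> \<open>A point on the boundary is a limit of eigenvalues; a point inside stays inside.\<close>
        define w where "w = z + of_real (e / 2) * s"
        have "Im w * Im s = Im z * Im s + e / 2" using s by (auto simp: w_def algebra_simps)
        then have "w \<in> eigenvalues X ?E" using False e by (simp add: ev)
        moreover have "cmod (w - z) < e" using s e by (auto simp: w_def norm_mult)
        ultimately show "\<exists>w\<in>eigenvalues X ?E. cmod (w - z) < e" by blast
      qed
      then show ?thesis using False by simp
    qed
  qed
  have s_in: "(cls (cauchy_kernel s), cls (\<lambda>t. s * cauchy_kernel s t)) \<in> ?E"
    using kernel_in_extension_iff[OF s0 s0] by simp
  have "\<not> (AE t in \<omega>. s * cauchy_kernel s t = of_real t * cauchy_kernel s t)"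
  proof
    assume "AE t in \<omega>. s * cauchy_kernel s t = of_real t * cauchy_kernel s t"
    then have "AE t in \<omega>. cauchy_kernel s t = 0"
      by eventually_elim (use s0 in \<open>simp add: of_real_mult_kernel\<close>)
    then show False using cauchy_kernel_not_null[OF s0] by simp
  qed
  then have "(cls (cauchy_kernel s), cls (\<lambda>t. s * cauchy_kernel s t)) \<notin> mult_op_dot \<omega>"
    using s0 by (simp add: mult_op_dot_iff)
  moreover have "mult_op_dot \<omega> \<subseteq> ?E"
    unfolding mult_op_dot_eq[OF s0] kernel_extension_def
    using mult_op_subset_adjoint_dot by (auto simp: kernel_restriction_def mult_op_dot_eq[OF s0])
  ultimately have "mult_op_dot \<omega> \<subset> ?E" using s_in by blast
  moreover have "?E \<subset> adjoint_op X (mult_op_dot \<omega>)"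
  proof -
    have "Im (- s) \<noteq> 0" "Im (- s) * Im s < 0" using s by auto
    then have "(cls (cauchy_kernel (- s)), cls (\<lambda>t. - s * cauchy_kernel (- s) t)) \<notin> ?E"
      using kernel_in_extension_iff[OF s0] opposite by blast
    then show ?thesis using kernel_in_adjoint_dot[OF \<open>Im (- s) \<noteq> 0\<close>] sub_adj by blast
  qed
  moreover have "\<not> self_adjoint X ?E"
  proof (rule nonreal_eigenvalue_not_self_adjoint[OF linear_kernel_extension[OF s0] s0])
    show "s \<in> eigenvalues X ?E" using nonreal_eigenvalue_iff[OF s0 s0] by simp
  qed
  ultimately have "quasi_hermitian_extension X (mult_op_dot \<omega>) ?E"
    using prime_symmetric_dot closed_kernel_extension[OF s0] by (simp add: quasi_hermitian_extension_def)
  then show "\<exists>S. quasi_hermitian_extension X (mult_op_dot \<omega>) S \<and>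
      eigenvalues X S = {z. Im z * Im s > 0} \<and> op_spectrum X S = {z. Im z * Im s \<ge> 0}"
    using ev spec by blast
qed

end

theorem theorem5p13:
  fixes \<omega> :: "real measure"
  assumes "sets \<omega> = sets borel"
    and "(\<integral>\<^sup>+ t. ennreal (1 / (1 + t\<^sup>2)) \<partial>\<omega>) = 1"
    and "(\<integral>\<^sup>+ t. 1 \<partial>\<omega>) = \<infinity>"
  shows "self_adjoint (L2_space \<omega>) (mult_op \<omega>) \<and>
    prime_symmetric_operator_11 (L2_space \<omega>) (mult_op_dot \<omega>) \<and>
    ((\<exists>S. quasi_hermitian_extension (L2_space \<omega>) (mult_op_dot \<omega>) S \<and>
          eigenvalues (L2_space \<omega>) S = {z. Im z > 0} \<and>
          op_spectrum (L2_space \<omega>) S = {z. Im z \<ge> 0}) \<longleftrightarrow> half_plane_representation \<omega>) \<and>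
    ((\<exists>S. quasi_hermitian_extension (L2_space \<omega>) (mult_op_dot \<omega>) S \<and>
          eigenvalues (L2_space \<omega>) S = {z. Im z < 0} \<and>
          op_spectrum (L2_space \<omega>) S = {z. Im z \<le> 0}) \<longleftrightarrow> half_plane_representation \<omega>) \<and>
    (half_plane_representation \<omega> \<longrightarrow> \<omega> = density lborel (\<lambda>t. ennreal (1 / pi)))"
proof -
  interpret normalized_measure \<omega> by unfold_locales fact+
  show ?thesis
    using self_adjoint_mult_op prime_symmetric_dot half_plane_representation_lebesgue
      quasi_hermitian_extension_half_plane[of \<i>] quasi_hermitian_extension_half_plane[of "- \<i>"]
    by simp
qed

end
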